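(* Let $\beta\geq -1$ be real and let $X_0,X_1,X_2,X_3$ be independent identically distributed random points in the three-dimensional unit ball $\mathbb{B}^3$ sampled from the beta distribution $f_{3,\beta}$ (for $\beta=-1$: the uniform distribution on the unit sphere $\mathbb{S}^2$). Let $T_\beta:=[X_0,\ldots,X_3]$ be their convex hull. Then the expected sum of the solid angles of the tetrahedron $T_\beta$ at its vertices is $$ \mathbb{E}\, s_0(T_\beta) = 2 - \frac{6\, \Gamma^2(\beta+\frac 52)\,\Gamma(2\beta+4)}{\pi^{3/2}\,\Gamma^2(\beta +2)\,\Gamma(2\beta + \frac 72)} \int_{-\pi/2}^{+\pi/2} (\cos\varphi)^{4\beta + 6} \left(\int_{-\pi/2}^\varphi (\cos \theta)^{2\beta+3}\,\mathrm{d} \theta\right)^2 \mathrm{d} \varphi. $$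
   Context: For $d\in\mathbb{N}$ and $\beta>-1$, the $d$-dimensional beta distribution with parameter $\beta$ is the probability distribution on $\mathbb{R}^d$ with Lebesgue density $$f_{d,\beta}(x)=c_{d,\beta}\,(1-\|x\|^2)^\beta\,\mathbf{1}_{\{\|x\|<1\}},\qquad c_{d,\beta}=\frac{\Gamma(\frac d2+\beta+1)}{\pi^{d/2}\,\Gamma(\beta+1)},$$ where $\|\cdot\|$ is the Euclidean norm. For $\beta=-1$, by convention, the distribution $f_{d,-1}$ is the uniform distribution on the unit sphere $\mathbb{S}^{d-1}=\{x\in\mathbb{R}^d\colon\|x\|=1\}$ (the weak limit as $\beta\downarrow-1$). $\mathbb{B}^d=\{x\in\mathbb{R}^d\colon\|x\|\le 1\}$. For a $d$-dimensional convex polytope $P\subset\mathbb{R}^d$ with vertex set $\mathcal{F}_0(P)$, the internal (solid) angle of $P$ at a vertex $x_0$, normalized so that the full solid angle equals $1$, is $$\beta(x_0,P):=\mathbb{P}[\exists\, \varepsilon>0 \text{ such that } x_0+\varepsilon U\in P],$$ where $U$ is a random vector uniformly distributed on $\mathbb{S}^{d-1}$ (this function $\beta(\cdot,\cdot)$ is unrelated to the real parameter $\beta$). The angle sum at vertices is $s_0(P)=\sum_{x_0\in\mathcal{F}_0(P)}\beta(x_0,P)$. With probability $1$, the random convex hull $T_\beta$ is a $3$-dimensional simplex with vertices $X_0,\ldots,X_3$, so $s_0(T_\beta)$ is almost surely defined. $\Gamma$ is the Gamma function and $\Gamma^2(x)=(\Gamma(x))^2$. *)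

theory Defs
  imports "HOL-Probability.Probability"
begin

(* There is no surface measure in the library.  The uniform distribution on the unit sphere is the
   law of V / |V| for V uniform on the unit ball; the lemmas below confirm that it is a probability
   measure that is carried by the sphere and invariant under orthogonal transformations. *)
definition uniform_sphere :: "'a::euclidean_space measure" where
  "uniform_sphere = distr (uniform_measure lborel (cball 0 1)) borel (\<lambda>x. x /\<^sub>R norm x)"

definition beta_const :: "nat \<Rightarrow> real \<Rightarrow> real" where
  "beta_const d \<beta> = Gamma (real d / 2 + \<beta> + 1) / (pi powr (real d / 2) * Gamma (\<beta> + 1))"

definition beta_density :: "real \<Rightarrow> 'a::euclidean_space \<Rightarrow> real" where
  "beta_density \<beta> x =
     beta_const DIM('a) \<beta> * (1 - (norm x)\<^sup>2) powr \<beta> * indicator {x. norm x < 1} x"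

(* Meaningful for \<beta> \<ge> -1 only. *)
definition beta_distribution :: "real \<Rightarrow> 'a::euclidean_space measure" where
  "beta_distribution \<beta> =
     (if \<beta> = -1 then uniform_sphere else density lborel (\<lambda>x. ennreal (beta_density \<beta> x)))"

definition solid_angle :: "'a::euclidean_space \<Rightarrow> 'a set \<Rightarrow> real" where
  "solid_angle x\<^sub>0 P = measure uniform_sphere {u. \<exists>\<epsilon>>0. x\<^sub>0 + \<epsilon> *\<^sub>R u \<in> P}"

(* The vertices of a polytope are its extreme points.  If P is not full-dimensional, all its solid
   angles vanish, so the (almost surely excluded) degenerate case contributes the value 0. *)
definition vertex_angle_sum :: "'a::euclidean_space set \<Rightarrow> real" where
  "vertex_angle_sum P = (\<Sum>x\<^sub>0\<in>{x. x extreme_point_of P}. solid_angle x\<^sub>0 P)"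

lemma emeasure_unit_cball:
  "emeasure lborel (cball (0::'a::euclidean_space) 1) \<noteq> 0"
  "emeasure lborel (cball (0::'a::euclidean_space) 1) \<noteq> \<infinity>"
proof -
  have "0 < measure lborel (cball (0::'a) 1)"
    by (simp add: content_cball_pos)
  then show "emeasure lborel (cball (0::'a) 1) \<noteq> 0"
    by (auto simp: measure_def)
  show "emeasure lborel (cball (0::'a) 1) \<noteq> \<infinity>"
    using emeasure_lborel_cball_finite[of "0::'a" 1] by simp
qed

lemma prob_space_uniform_sphere: "prob_space (uniform_sphere :: 'a::euclidean_space measure)"
  unfolding uniform_sphere_def
  by (intro prob_space.prob_space_distr prob_space_uniform_measure emeasure_unit_cball) simp

lemma AE_uniform_sphere: "AE u in (uniform_sphere :: 'a::euclidean_space measure). u \<in> sphere 0 1"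
proof -
  have "AE x in lborel. x \<noteq> (0::'a)"
    by (rule AE_I[where N="{0}"]) auto
  then have "AE x in uniform_measure lborel (cball (0::'a) 1). x /\<^sub>R norm x \<in> sphere 0 1"
    by (subst AE_uniform_measure) (use emeasure_unit_cball[where 'a='a] in \<open>auto simp: less_top\<close>)
  then show ?thesis
    unfolding uniform_sphere_def by (subst AE_distr_iff) auto
qed

lemma uniform_sphere_orthogonal_invariant:
  fixes T :: "real ^ 'n::{finite,wellorder} \<Rightarrow> real ^ 'n::{finite,wellorder}"
  assumes T: "orthogonal_transformation T"
  shows "distr uniform_sphere borel T = uniform_sphere"
proof -
  let ?U = "uniform_measure lborel (cball (0::real^'n::{finite,wellorder}) 1)"
  let ?p = "\<lambda>x::real^'n::{finite,wellorder}. x /\<^sub>R norm x"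
  have lin: "linear T" and nrm: "\<And>x. norm (T x) = norm x"
    using T by (auto simp: orthogonal_transformation_linear orthogonal_transformation_norm)
  have Tm: "T \<in> borel_measurable borel"
    using lin by (intro borel_measurable_continuous_onI linear_continuous_on linear_conv_bounded_linear[THEN iffD1])
  have "bij T" using T by (rule orthogonal_transformation_bij)
  have ball: "A \<inter> cball 0 1 \<in> lmeasurable" if "A \<in> sets borel" for A :: "(real^'n::{finite,wellorder}) set"
    using that by (intro bounded_set_imp_lmeasurable) (auto intro: bounded_subset[OF bounded_cball])
  have ms: "emeasure lborel (cball 0 1 \<inter> (T -` A)) = emeasure lborel (cball 0 1 \<inter> A)"
    if A: "A \<in> sets borel" for A
  proof -
    have TA: "T -` A \<in> sets borel" using measurable_sets[OF Tm A] by simp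
    have im: "T ` ((T -` A) \<inter> cball 0 1) = A \<inter> cball 0 1"
    proof (intro equalityI subsetI)
      fix y assume y: "y \<in> A \<inter> cball 0 1"
      obtain x where "y = T x" using \<open>bij T\<close> by (metis bij_pointE)
      then show "y \<in> T ` ((T -` A) \<inter> cball 0 1)" using y nrm by auto
    qed (use nrm in auto)
    have "measure lebesgue (A \<inter> cball 0 1) = measure lebesgue ((T -` A) \<inter> cball 0 1)"
      using measure_orthogonal_image[OF T ball[OF TA]] im by simp
    then have "emeasure lebesgue (A \<inter> cball 0 1) = emeasure lebesgue ((T -` A) \<inter> cball 0 1)"
      using ball[OF TA] ball[OF A] by (simp add: emeasure_eq_measure2 fmeasurableD2)
    then show ?thesis using A TA by (simp add: Int_commute)
  qed
  have U: "distr ?U borel T = distr ?U borel (\<lambda>x. x)"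
  proof (rule measure_eqI)
    fix A assume "A \<in> sets (distr ?U borel T)"
    then have A: "A \<in> sets borel" by simp
    have TA: "T -` A \<in> sets borel" using measurable_sets[OF Tm A] by simp
    show "emeasure (distr ?U borel T) A = emeasure (distr ?U borel (\<lambda>x. x)) A"
      using A TA Tm ms[OF A] by (simp add: emeasure_distr)
  qed simp
  have "distr uniform_sphere borel T = distr ?U borel (T \<circ> ?p)"
    unfolding uniform_sphere_def using Tm by (subst distr_distr) auto
  also have "T \<circ> ?p = ?p \<circ> T"
    using nrm by (auto simp: fun_eq_iff linear_cmul[OF lin])
  also have "distr ?U borel (?p \<circ> T) = distr (distr ?U borel T) borel ?p"
    using Tm by (subst distr_distr) auto
  also have "\<dots> = uniform_sphere"
    unfolding U uniform_sphere_def by (subst distr_distr) (auto simp: comp_def)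
  finally show ?thesis .
qed

end

(* Fix a direction u. Almost surely, the number of vertices x of the tetrahedron T such that u or -u
   points from x into T is the number of points that lie inside the triangle of the other three after
   the projection of the X_i along u, and this is 4 minus the number of edges of the projected hull.
   Averaging over u gives 2 E s_0 = 4 - 6 q, where q is the probability that the line through the
   projections of X_0 and X_1 has those of X_2 and X_3 on the same side. By rotation invariance q does
   not depend on u. The projection of the beta distribution along u is a beta distribution in the disc
   with parameter beta + 1/2 (for beta = -1 as well), and the signed distance h of the origin from
   the line through two such points has density proportional to (1 - h^2)^(2 beta + 5/2). Given the
   line, the two remaining points lie on the same side with probability F(h)^2 + F(-h)^2, where F is
   the distribution function of the density proportional to (1 - t^2)^(beta + 1). Finally put
   h = sin phi. Apart from the one-dimensional Beta integrals, no normalizing constant has to be computed: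
   the others are determined by total mass 1. *)

theory Submission
  imports Defs
begin

subsection \<open>Substitution and Lebesgue measure\<close>

text \<open>Integrals over points, lines and directions are nonnegative and extended-valued. Orders
  of integration then change without integrability proofs, and a constant may stay unknown, even
  possibly infinite, until the test function 1 determines it. For the same reason the counts of
  inward directions and of edges are kept as a sum equal to 4; subtraction comes only after this sum
  has forced finiteness. The obstacle is beta = -1, where the law has no density in space. There the
  projection is found by integrating over the solid ball along rays, by way of central projection to
  the plane z = 1; otherwise z is simply integrated out. Both cases end in the same planar weight.
  The exponent 2 beta + 5/2 arises as 2 (beta + 1/2) + 3/2: each of the two points brings its weight
  on the chord at distance |h|, and three lengths along the chord, two coordinates and one Jacobian,
  bring (1 - h^2)^(1/2) each. The 6 of the final formula is 3, half the number of edges, times 2,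
  because h -> -h exchanges F(h)^2 and F(-h)^2.\<close>

lemma emeasure_injective_image:
  fixes g g' :: "real \<Rightarrow> real"
  assumes S: "S \<in> sets borel" and gS: "g ` S \<in> sets borel"
    and der: "\<And>x. x \<in> S \<Longrightarrow> (g has_field_derivative g' x) (at x)"
    and inj: "inj_on g S" and [measurable]: "g' \<in> borel_measurable borel"
  shows "emeasure lborel (g ` S) = (\<integral>\<^sup>+x\<in>S. ennreal \<bar>g' x\<bar> \<partial>lborel)"
proof -
  note [measurable] = S gS
  have eq: "(\<integral>\<^sup>+x\<in>A. ennreal (f x) \<partial>lborel) = ennreal (integral A f)"
    if "f absolutely_integrable_on A" "A \<in> sets borel" "f \<in> borel_measurable borel" "\<And>x. f x \<ge> 0"
    for f :: "real \<Rightarrow> real" and A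
    using nn_integral_has_integral_lebesgue'[of A f "integral A f"] that
    by (simp add: set_lebesgue_integral_eq_integral(1) integrable_integral)
  have fin: "f absolutely_integrable_on A"
    if "(\<integral>\<^sup>+x\<in>A. ennreal (f x) \<partial>lborel) < \<infinity>" and [measurable]: "A \<in> sets borel" "f \<in> borel_measurable borel"
      and "\<And>x. f x \<ge> 0" for f :: "real \<Rightarrow> real" and A
  proof -
    have "(\<integral>\<^sup>+x. ennreal (indicator A x * f x) \<partial>lborel) < \<infinity>"
      using that(1) by (subst mult.commute) (simp add: nn_integral_set_ennreal)
    then have "integrable lborel (\<lambda>x. indicator A x * f x)"
      using that(4) by (intro integrableI_nonneg) auto
    then have "integrable lebesgue (\<lambda>x. indicator A x *\<^sub>R f x)"
      by (subst integrable_completion) auto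
    then show ?thesis unfolding set_integrable_def .
  qed
  have cov: "(\<lambda>x. \<bar>g' x\<bar> * 1) absolutely_integrable_on S \<and> integral S (\<lambda>x. \<bar>g' x\<bar> * 1) = b
     \<longleftrightarrow> (\<lambda>_. 1 :: real) absolutely_integrable_on (g ` S) \<and> integral (g ` S) (\<lambda>_. 1) = b" for b
    using S der inj by (intro has_absolute_integral_change_of_variables_1')
      (auto intro: has_field_derivative_at_within)
  have emg: "emeasure lborel (g ` S) = (\<integral>\<^sup>+x\<in>g ` S. ennreal 1 \<partial>lborel)"
    by simp
  show ?thesis
  proof (cases "(\<lambda>_. 1 :: real) absolutely_integrable_on (g ` S)")
    case True
    have *: "(\<lambda>x. \<bar>g' x\<bar>) absolutely_integrable_on S"
      "integral S (\<lambda>x. \<bar>g' x\<bar>) = integral (g ` S) (\<lambda>_. 1)"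
      using cov[of "integral (g ` S) (\<lambda>_. 1)"] True by simp_all
    have "(\<integral>\<^sup>+x\<in>S. ennreal \<bar>g' x\<bar> \<partial>lborel) = ennreal (integral S (\<lambda>x. \<bar>g' x\<bar>))"
      by (rule eq[OF *(1) S]) simp_all
    also have "\<dots> = (\<integral>\<^sup>+x\<in>g ` S. ennreal 1 \<partial>lborel)"
      unfolding *(2) by (rule eq[OF True gS, symmetric]) simp_all
    finally show ?thesis by (simp only: emg)
  next
    \<comment> \<open>Failure of integrability passes from the image to the derivative. For
      nonnegative functions it means an infinite integral, so both sides are infinite.\<close>
    case False
    then have F: "\<not> (\<lambda>x. \<bar>g' x\<bar>) absolutely_integrable_on S"
      using cov by auto
    have "\<not> (\<integral>\<^sup>+x\<in>g ` S. ennreal 1 \<partial>lborel) < \<infinity>"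
    proof
      assume "(\<integral>\<^sup>+x\<in>g ` S. ennreal 1 \<partial>lborel) < \<infinity>"
      then have "(\<lambda>_. 1 :: real) absolutely_integrable_on g ` S"
        by (rule fin) (use gS in simp_all)
      with False show False ..
    qed
    moreover have "\<not> (\<integral>\<^sup>+x\<in>S. ennreal \<bar>g' x\<bar> \<partial>lborel) < \<infinity>"
    proof
      assume "(\<integral>\<^sup>+x\<in>S. ennreal \<bar>g' x\<bar> \<partial>lborel) < \<infinity>"
      then have "(\<lambda>x. \<bar>g' x\<bar>) absolutely_integrable_on S"
        by (rule fin) (use S in simp_all)
      with F show False ..
    qed
    ultimately show ?thesis unfolding emg by (simp add: not_less top_unique del: nn_integral_indicator)
  qed
qed

text \<open>Two measures coincide: Lebesgue measure restricted to the image, and the push-forward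
  under \<open>g\<close> of the density \<open>\<bar>g' x\<bar>\<close> on \<open>S\<close>. On a
  Borel set \<open>A\<close> this is the measure formula for the part of \<open>S\<close> that
  \<open>g\<close> sends into \<open>A\<close>. Integrating \<open>f\<close> against both gives the
  claim, also for infinite integrals.\<close>

lemma nn_integral_injective_substitution:
  fixes g g' :: "real \<Rightarrow> real" and f :: "real \<Rightarrow> ennreal"
  assumes S[measurable]: "S \<in> sets borel" and gS[measurable]: "g ` S \<in> sets borel"
    and der: "\<And>x. x \<in> S \<Longrightarrow> (g has_field_derivative g' x) (at x)"
    and inj: "inj_on g S"
    and [measurable]: "g \<in> borel_measurable borel" "g' \<in> borel_measurable borel"
      "f \<in> borel_measurable borel"
  shows "(\<integral>\<^sup>+x\<in>g ` S. f x \<partial>lborel) = (\<integral>\<^sup>+x\<in>S. ennreal \<bar>g' x\<bar> * f (g x) \<partial>lborel)"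
proof -
  let ?R = "distr (density lborel (\<lambda>x. ennreal \<bar>g' x\<bar> * indicator S x)) borel g"
  have "density lborel (indicator (g ` S)) = ?R"
  proof (rule measure_eqI)
    fix A assume "A \<in> sets (density lborel (indicator (g ` S) :: real \<Rightarrow> ennreal))"
    then have A[measurable]: "A \<in> sets borel" by simp
    let ?T = "S \<inter> g -` A"
    have T[measurable]: "?T \<in> sets borel"
      using measurable_sets[of g borel borel A] by simp
    have im: "g ` ?T = g ` S \<inter> A" by auto
    have "emeasure lborel (g ` ?T) = (\<integral>\<^sup>+x\<in>?T. ennreal \<bar>g' x\<bar> \<partial>lborel)"
      using der inj by (intro emeasure_injective_image) (auto simp: im inj_on_def)
    also have "\<dots> = (\<integral>\<^sup>+x. ennreal \<bar>g' x\<bar> * indicator S x * indicator (g -` A) x \<partial>lborel)"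
      by (intro nn_integral_cong) (simp add: indicator_def)
    finally have 1: "emeasure lborel (g ` S \<inter> A) = \<dots>" by (simp only: im)
    have gA: "g -` A \<in> sets borel"
      using measurable_sets[of g borel borel A] by simp
    have "emeasure (density lborel (indicator (g ` S))) A = emeasure lborel (g ` S \<inter> A)"
      by (subst emeasure_density) (simp_all add: indicator_inter_arith[symmetric] Int_commute)
    moreover have "emeasure ?R A = (\<integral>\<^sup>+x. ennreal \<bar>g' x\<bar> * indicator S x * indicator (g -` A) x \<partial>lborel)"
      using gA by (subst emeasure_distr) (simp_all add: emeasure_density)
    ultimately show "emeasure (density lborel (indicator (g ` S))) A = emeasure ?R A"
      using 1 by simp
  qed simp
  then have "(\<integral>\<^sup>+x. f x \<partial>density lborel (indicator (g ` S))) = (\<integral>\<^sup>+x. f x \<partial>?R)"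
    by simp
  then show ?thesis
    by (simp add: nn_integral_density nn_integral_distr mult_ac)
qed

section \<open>Lebesgue measure on three-space: iterated integrals and rotation invariance\<close>

lemma lborel_vec3_eq:
  "(lborel :: (real^3) measure) =
     distr (lborel \<Otimes>\<^sub>M (lborel \<Otimes>\<^sub>M lborel)) borel (\<lambda>(x, y, z). vector [x, y, z])"
proof (rule lborel_eqI)
  have m: "(\<lambda>(x, y, z). vector [x, y, z] :: real^3) \<in> borel_measurable (lborel \<Otimes>\<^sub>M (lborel \<Otimes>\<^sub>M lborel))"
  proof -
    have "(\<lambda>(x, y, z). vector [x, y, z] :: real^3) = (\<lambda>p. \<chi> i. if i = 1 then fst p else if i = 2 then fst (snd p) else snd (snd p))"
      by (auto simp: fun_eq_iff vec_eq_iff forall_3)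
    moreover have "\<dots> \<in> borel_measurable borel"
    proof (intro borel_measurable_continuous_onI continuous_on_vec_lambda)
      fix i :: 3
      show "continuous_on UNIV (\<lambda>p::real \<times> real \<times> real. if i = 1 then fst p else if i = 2 then fst (snd p) else snd (snd p))"
        by (cases "i = 1"; cases "i = 2")
          (simp_all add: continuous_on_fst continuous_on_snd)
    qed
    ultimately show ?thesis by (simp add: lborel_prod)
  qed
  fix l u :: "real^3" assume lu: "\<And>b. b \<in> Basis \<Longrightarrow> l \<bullet> b \<le> u \<bullet> b"
  then have le: "l $ i \<le> u $ i" for i
    using lu[of "axis i 1"] by (simp add: inner_axis axis_in_Basis_iff)
  have "(\<lambda>(x, y, z). vector [x, y, z] :: real^3) -` box l u \<inter> space (lborel \<Otimes>\<^sub>M (lborel \<Otimes>\<^sub>M lborel)) =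
     {l$1<..<u$1} \<times> ({l$2<..<u$2} \<times> {l$3<..<u$3})"
    by (auto simp: space_pair_measure mem_box_cart forall_3)
  moreover have "(\<Prod>b\<in>Basis. (u - l) \<bullet> b) = (u$1 - l$1) * ((u$2 - l$2) * (u$3 - l$3))"
  proof -
    have *: "(Basis :: (real^3) set) = (\<lambda>i. axis i 1) ` {1, 2, 3}"
      by (auto simp: Basis_vec_def simp flip: UNIV_3)
    show ?thesis
      unfolding * by (subst prod.reindex) (simp_all add: inj_on_def axis_eq_axis inner_axis mult.assoc)
  qed
  moreover have "emeasure (lborel \<Otimes>\<^sub>M (lborel \<Otimes>\<^sub>M lborel)) ({l$1<..<u$1} \<times> ({l$2<..<u$2} \<times> {l$3<..<u$3}))
      = emeasure lborel {l$1<..<u$1} * (emeasure lborel {l$2<..<u$2} * emeasure lborel {l$3<..<u$3})"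
  proof -
    have "sigma_finite_measure (lborel \<Otimes>\<^sub>M lborel :: (real \<times> real) measure)"
      by (simp add: lborel_prod sigma_finite_lborel)
    then show ?thesis
      by (subst sigma_finite_measure.emeasure_pair_measure_Times)
        (simp_all add: lborel.emeasure_pair_measure_Times)
  qed
  ultimately show "emeasure (distr (lborel \<Otimes>\<^sub>M (lborel \<Otimes>\<^sub>M lborel)) borel (\<lambda>(x, y, z). vector [x, y, z])) (box l u)
      = ennreal (\<Prod>b\<in>Basis. (u - l) \<bullet> b)"
    using le[of 1] le[of 2] le[of 3] m by (simp add: emeasure_distr ennreal_mult)
qed simp

lemma borel_measurable_vector3 [measurable (raw)]:
  assumes [measurable]: "f \<in> borel_measurable M" "g \<in> borel_measurable M" "h \<in> borel_measurable M"
  shows "(\<lambda>x. vector [f x, g x, h x] :: real^3) \<in> borel_measurable M"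
proof -
  have "(\<lambda>x. vector [f x, g x, h x] :: real^3) =
      (\<lambda>x. f x *\<^sub>R axis 1 1 + g x *\<^sub>R axis 2 1 + h x *\<^sub>R axis 3 1)"
    by (auto simp: fun_eq_iff vec_eq_iff forall_3 axis_def)
  then show ?thesis by simp
qed

lemma nn_integral_lborel_vec3:
  fixes f :: "real^3 \<Rightarrow> ennreal"
  assumes [measurable]: "f \<in> borel_measurable borel"
  shows "(\<integral>\<^sup>+v. f v \<partial>lborel) = (\<integral>\<^sup>+x. \<integral>\<^sup>+y. \<integral>\<^sup>+z. f (vector [x, y, z]) \<partial>lborel \<partial>lborel \<partial>lborel)"
proof -
  have P: "sigma_finite_measure (lborel \<Otimes>\<^sub>M lborel :: (real \<times> real) measure)"
    by (simp add: lborel_prod sigma_finite_lborel)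
  have "(\<integral>\<^sup>+v. f v \<partial>lborel) = (\<integral>\<^sup>+p. f (case p of (x, y, z) \<Rightarrow> vector [x, y, z]) \<partial>(lborel \<Otimes>\<^sub>M (lborel \<Otimes>\<^sub>M lborel)))"
    by (subst lborel_vec3_eq, subst nn_integral_distr) simp_all
  also have "\<dots> = (\<integral>\<^sup>+x. \<integral>\<^sup>+q. f (case (x, q) of (x, y, z) \<Rightarrow> vector [x, y, z]) \<partial>(lborel \<Otimes>\<^sub>M lborel) \<partial>lborel)"
    by (rule sigma_finite_measure.nn_integral_fst[OF P, symmetric]) simp
  also have "\<dots> = (\<integral>\<^sup>+x. \<integral>\<^sup>+y. \<integral>\<^sup>+z. f (vector [x, y, z]) \<partial>lborel \<partial>lborel \<partial>lborel)"
    by (intro nn_integral_cong, subst lborel.nn_integral_fst[symmetric]) simp_all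
  finally show ?thesis .
qed

text \<open>Serves the integral over cones in space: the height must be fixed before the horizontal
  coordinates are rescaled by it, and is integrated out first afterwards.\<close>

lemma nn_integral_lborel_reverse3:
  fixes f :: "real \<times> real \<times> real \<Rightarrow> ennreal"
  assumes [measurable]: "f \<in> borel_measurable (borel \<Otimes>\<^sub>M (borel \<Otimes>\<^sub>M borel))"
  shows "(\<integral>\<^sup>+x. \<integral>\<^sup>+y. \<integral>\<^sup>+z. f (x, y, z) \<partial>lborel \<partial>lborel \<partial>lborel) =
    (\<integral>\<^sup>+z. \<integral>\<^sup>+y. \<integral>\<^sup>+x. f (x, y, z) \<partial>lborel \<partial>lborel \<partial>lborel)"
proof -
  have "(\<integral>\<^sup>+x. \<integral>\<^sup>+y. \<integral>\<^sup>+z. f (x, y, z) \<partial>lborel \<partial>lborel \<partial>lborel)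
      = (\<integral>\<^sup>+x. \<integral>\<^sup>+z. \<integral>\<^sup>+y. f (x, y, z) \<partial>lborel \<partial>lborel \<partial>lborel)"
    by (intro nn_integral_cong lborel_pair.Fubini') simp
  also have "\<dots> = (\<integral>\<^sup>+z. \<integral>\<^sup>+x. \<integral>\<^sup>+y. f (x, y, z) \<partial>lborel \<partial>lborel \<partial>lborel)"
    by (intro lborel_pair.Fubini') simp
  also have "\<dots> = (\<integral>\<^sup>+z. \<integral>\<^sup>+y. \<integral>\<^sup>+x. f (x, y, z) \<partial>lborel \<partial>lborel \<partial>lborel)"
    by (intro nn_integral_cong lborel_pair.Fubini') simp
  finally show ?thesis .
qed

text \<open>Boxes determine Lebesgue measure. The preimage of a box is its image under the inverse,
  hence bounded and of finite measure, so that the invariance of volume under orthogonal images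
  applies to it.\<close>

lemma distr_lborel_orthogonal:
  fixes T :: "real ^ 'n::{finite,wellorder} \<Rightarrow> real ^ 'n::{finite,wellorder}"
  assumes T: "orthogonal_transformation T"
  shows "distr lborel borel T = lborel"
proof -
  have lin: "linear T"
    using T by (auto simp: orthogonal_transformation_linear)
  have Tm: "T \<in> borel_measurable borel"
    using lin by (intro borel_measurable_continuous_onI linear_continuous_on linear_conv_bounded_linear[THEN iffD1])
  have "bij T" using T by (rule orthogonal_transformation_bij)
  have "lborel = distr lborel borel T"
  proof (rule lborel_eqI)
    fix l u :: "real ^ 'n::{finite,wellorder}"
    assume lu: "\<And>b. b \<in> Basis \<Longrightarrow> l \<bullet> b \<le> u \<bullet> b"
    have P: "T -` box l u \<in> sets borel"
      using measurable_sets[OF Tm, of "box l u"] by simp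
    have "T -` box l u = inv T ` box l u"
      using \<open>bij T\<close> by (simp add: bij_vimage_eq_inv_image)
    moreover have "bounded (inv T ` box l u)"
      by (intro bounded_linear_image bounded_box linear_conv_bounded_linear[THEN iffD1]
          orthogonal_transformation_linear orthogonal_transformation_inv T)
    ultimately have lm: "T -` box l u \<in> lmeasurable"
      using P by (intro bounded_set_imp_lmeasurable) auto
    have "measure lebesgue (box l u) = measure lebesgue (T -` box l u)"
      using measure_orthogonal_image[OF T lm] \<open>bij T\<close> by (simp add: surj_image_vimage_eq bij_is_surj)
    then have "emeasure lebesgue (T -` box l u) = emeasure lebesgue (box l u)"
      using lm by (simp add: emeasure_eq_measure2 fmeasurableD2)
    then have "emeasure lborel (T -` box l u) = emeasure lborel (box l u)"
      using P by simp
    then show "emeasure (distr lborel borel T) (box l u) = ennreal (\<Prod>b\<in>Basis. (u - l) \<bullet> b)"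
      using Tm lu by (simp add: emeasure_distr)
  qed simp
  then show ?thesis ..
qed

section \<open>Rotation invariance of the beta distribution\<close>

lemma beta_density_measurable [measurable]:
  "(beta_density b :: 'a::euclidean_space \<Rightarrow> real) \<in> borel_measurable borel"
  unfolding beta_density_def by measurable

lemma sets_beta_distribution [simp, measurable_cong]: "sets (beta_distribution b) = sets borel"
  by (simp add: beta_distribution_def uniform_sphere_def)

lemma space_beta_distribution [simp]: "space (beta_distribution b) = UNIV"
  by (simp add: beta_distribution_def uniform_sphere_def)

lemma beta_distribution_orthogonal_invariant:
  fixes T :: "real ^ 'n::{finite,wellorder} \<Rightarrow> real ^ 'n::{finite,wellorder}"
  assumes T: "orthogonal_transformation T"
  shows "distr (beta_distribution b) borel T = beta_distribution b"
proof (cases "b = -1")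
  case True
  then show ?thesis
    by (simp add: beta_distribution_def uniform_sphere_orthogonal_invariant[OF T])
next
  case False
  have "linear T" and nrm: "\<And>x. norm (T x) = norm x"
    using T by (auto simp: orthogonal_transformation_linear orthogonal_transformation_norm)
  then have Tm[measurable]: "T \<in> borel_measurable borel"
    by (intro borel_measurable_continuous_onI linear_continuous_on linear_conv_bounded_linear[THEN iffD1])
  let ?f = "\<lambda>x :: real ^ 'n::{finite,wellorder}. ennreal (beta_density b x)"
  have "density (distr lborel borel T) ?f = distr (density lborel (\<lambda>x. ?f (T x))) borel T"
    by (rule density_distr) simp_all
  moreover have "beta_density b (T x) = beta_density b x" for x
    by (simp add: beta_density_def nrm indicator_def)
  ultimately show ?thesis
    using False by (simp add: beta_distribution_def distr_lborel_orthogonal[OF T])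
qed

subsection \<open>Projection of the beta distribution to a plane\<close>

text \<open>Left unnormalized on purpose: the exponent -3/2 occurs in the substitutions for the
  sphere, and there the total mass is infinite.\<close>

definition beta_weight :: "real \<Rightarrow> real \<Rightarrow> real" where
  "beta_weight a t = (if \<bar>t\<bar> < 1 then (1 - t\<^sup>2) powr a else 0)"

text \<open>The first argument is sometimes a radius \<open>sqrt (x\<^sup>2 + y\<^sup>2)\<close>:
  the solid ball is then handled as a disc spanned by this radius and the height.\<close>

definition disc_weight :: "real \<Rightarrow> real \<Rightarrow> real \<Rightarrow> real" where
  "disc_weight a x y = (if x\<^sup>2 + y\<^sup>2 < 1 then (1 - x\<^sup>2 - y\<^sup>2) powr a else 0)"

lemma beta_weight_nonneg [simp]: "0 \<le> beta_weight a t"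
  by (simp add: beta_weight_def)

lemma disc_weight_nonneg [simp]: "0 \<le> disc_weight a x y"
  by (simp add: disc_weight_def)

lemma beta_weight_measurable [measurable]: "beta_weight a \<in> borel_measurable borel"
  unfolding beta_weight_def by measurable

lemma disc_weight_measurable [measurable (raw)]:
  assumes [measurable]: "f \<in> borel_measurable M" "g \<in> borel_measurable M"
  shows "(\<lambda>p. disc_weight a (f p) (g p)) \<in> borel_measurable M"
  unfolding disc_weight_def by measurable

text \<open>Rests on 1 - x^2 - (1 - x^2) s^2 = (1 - x^2) (1 - s^2); the parameter \<open>s\<close>
  is the position on the vertical chord in units of its half-length.\<close>

lemma disc_weight_scale:
  assumes "\<bar>x\<bar> < 1"
  shows "disc_weight a x (sqrt (1 - x\<^sup>2) * s) = (1 - x\<^sup>2) powr a * beta_weight a s"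
proof -
  have p: "0 < 1 - x\<^sup>2" using assms by (simp add: abs_square_less_1)
  have e: "1 - x\<^sup>2 - (sqrt (1 - x\<^sup>2) * s)\<^sup>2 = (1 - x\<^sup>2) * (1 - s\<^sup>2)"
    using p by (simp add: power_mult_distrib algebra_simps)
  have "x\<^sup>2 + (sqrt (1 - x\<^sup>2) * s)\<^sup>2 < 1 \<longleftrightarrow> 0 < (1 - x\<^sup>2) * (1 - s\<^sup>2)"
    unfolding e[symmetric] by linarith
  also have "\<dots> \<longleftrightarrow> \<bar>s\<bar> < 1"
    using p zero_less_mult_pos[of "1 - x\<^sup>2" "1 - s\<^sup>2"] mult_pos_pos[of "1 - x\<^sup>2" "1 - s\<^sup>2"]
    unfolding abs_square_less_1[symmetric] by linarith
  finally show ?thesis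
    using p by (simp add: disc_weight_def beta_weight_def e powr_mult abs_square_le_1)
qed

text \<open>The chord at \<open>x\<close> has half-length \<open>sqrt (1 - x\<^sup>2)\<close>.
  Rescaling it to half-length 1 produces this factor, which raises the exponent of 1 - x^2 from
  \<open>a\<close> to \<open>a + 1/2\<close>.\<close>

lemma nn_integral_disc_slice:
  assumes [measurable]: "f \<in> borel_measurable borel"
  shows "(\<integral>\<^sup>+y. ennreal (disc_weight a x y) * f y \<partial>lborel) =
    ennreal (beta_weight (a + 1/2) x) * (\<integral>\<^sup>+s. ennreal (beta_weight a s) * f (s * sqrt (1 - x\<^sup>2)) \<partial>lborel)"
proof (cases "\<bar>x\<bar> < 1")
  case True
  then have p: "0 < 1 - x\<^sup>2" by (simp add: abs_square_less_1)
  let ?c = "sqrt (1 - x\<^sup>2)"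
  have "(\<integral>\<^sup>+y. ennreal (disc_weight a x y) * f y \<partial>lborel)
     = ennreal \<bar>?c\<bar> * (\<integral>\<^sup>+s. ennreal (disc_weight a x (0 + ?c * s)) * f (0 + ?c * s) \<partial>lborel)"
    using p by (intro nn_integral_real_affine) simp_all
  also have "\<dots> = ennreal ?c * (\<integral>\<^sup>+s. ennreal ((1 - x\<^sup>2) powr a) * (ennreal (beta_weight a s) * f (s * ?c)) \<partial>lborel)"
    using p by (simp add: disc_weight_scale[OF True] ennreal_mult mult.assoc mult.commute[of _ ?c])
  also have "\<dots> = ennreal (?c * (1 - x\<^sup>2) powr a) * (\<integral>\<^sup>+s. ennreal (beta_weight a s) * f (s * ?c) \<partial>lborel)"
    using p by (simp add: nn_integral_cmult ennreal_mult mult.assoc)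
  also have "?c * (1 - x\<^sup>2) powr a = beta_weight (a + 1/2) x"
    using p True by (simp add: beta_weight_def powr_add powr_half_sqrt mult.commute)
  finally show ?thesis .
next
  case False
  then have "1 \<le> x\<^sup>2" by (metis abs_square_less_1 not_less)
  then have "disc_weight a x y = 0" for y
    using zero_le_power2[of y] by (simp add: disc_weight_def) (smt (verit) zero_le_power2)
  then show ?thesis using False by (simp add: beta_weight_def)
qed

text \<open>Two substitutions of this form carry the measure \<open>(1 + u\<^sup>2 + v\<^sup>2) powr (-3/2)\<close> on the plane, which
  is the central projection of the uniform distribution on the sphere, to its orthogonal projection.\<close>

lemma nn_integral_line_arc:
  assumes [measurable]: "f \<in> borel_measurable borel"
  shows "(\<integral>\<^sup>+x. f x \<partial>lborel) = (\<integral>\<^sup>+t. ennreal (beta_weight (-3/2) t) * f (t / sqrt (1 - t\<^sup>2)) \<partial>lborel)"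
proof -
  let ?S = "{-1<..<1::real}" and ?g = "\<lambda>t::real. t / sqrt (1 - t\<^sup>2)"
  have pos: "0 < 1 - t\<^sup>2" if "t \<in> ?S" for t :: real
    using that abs_square_less_1[of t] by (simp add: abs_less_iff)
  \<comment> \<open>With \<open>t\<close> the sine of an angle, \<open>?g t\<close> is its tangent;
    the inverse map y / sqrt (1 + y^2) recovers the sine and gives injectivity.\<close>
  have inv: "?g t / sqrt (1 + (?g t)\<^sup>2) = t" if "t \<in> ?S" for t
  proof -
    have "1 + (?g t)\<^sup>2 = 1 / (1 - t\<^sup>2)"
      using pos[OF that] by (simp add: field_simps)
    then show ?thesis using pos[OF that] by (simp add: real_sqrt_divide)
  qed
  have range: "?g ` ?S = UNIV"
  proof (intro equalityI subsetI)
    fix y :: real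
    let ?t = "y / sqrt (1 + y\<^sup>2)"
    have p: "0 < 1 + y\<^sup>2" by (simp add: add_pos_nonneg)
    have "?t\<^sup>2 = y\<^sup>2 / (1 + y\<^sup>2)" using p by (simp add: power_divide)
    also have "\<dots> < 1" using p by (simp add: divide_less_eq)
    finally have "?t \<in> ?S" unfolding abs_square_less_1 abs_less_iff greaterThanLessThan_iff by linarith
    moreover have "1 - ?t\<^sup>2 = 1 / (1 + y\<^sup>2)" using p by (simp add: power_divide field_simps)
    then have "?g ?t = y" using p by (simp add: real_sqrt_divide)
    ultimately show "y \<in> ?g ` ?S" by (intro image_eqI[of _ _ ?t]) simp_all
  qed simp
  have der: "(?g has_field_derivative (1 - t\<^sup>2) powr (-3/2)) (at t)" if "t \<in> ?S" for t
  proof -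
    let ?q = "sqrt (1 - t\<^sup>2)"
    have q: "0 < ?q" "?q\<^sup>2 = 1 - t\<^sup>2" using pos[OF that] by simp_all
    have "(?g has_field_derivative (?q - t * (- t / ?q)) / (?q * ?q)) (at t)"
      using pos[OF that] by (auto intro!: derivative_eq_intros simp: field_simps)
    also have "(?q - t * (- t / ?q)) / (?q * ?q) = (?q\<^sup>2 + t\<^sup>2) / ?q ^ 3"
      using q(1) by (simp add: field_simps power2_eq_square power3_eq_cube)
    also have "\<dots> = (1 - t\<^sup>2) powr (-3/2)"
      using pos[OF that] by (simp add: q powr_minus powr_half_sqrt[symmetric] powr_powr powr_numeral[symmetric] inverse_eq_divide del: powr_numeral)
    finally show ?thesis .
  qed
  have "(\<integral>\<^sup>+x\<in>?g ` ?S. f x \<partial>lborel) = (\<integral>\<^sup>+t\<in>?S. ennreal \<bar>(1 - t\<^sup>2) powr (-3/2)\<bar> * f (?g t) \<partial>lborel)"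
    using der inv by (intro nn_integral_injective_substitution inj_on_inverseI[of _ "\<lambda>y. y / sqrt (1 + y\<^sup>2)"])
      (simp_all add: range)
  also have "\<dots> = (\<integral>\<^sup>+t. ennreal (beta_weight (-3/2) t) * f (?g t) \<partial>lborel)"
    by (intro nn_integral_cong) (auto simp: beta_weight_def indicator_def abs_less_iff)
  finally show ?thesis by (simp add: range)
qed

lemma beta_weight_sqrt_sum: "beta_weight a (sqrt (x\<^sup>2 + y\<^sup>2)) = disc_weight a x y"
proof -
  have "\<bar>sqrt (x\<^sup>2 + y\<^sup>2)\<bar> < 1 \<longleftrightarrow> x\<^sup>2 + y\<^sup>2 < 1" by simp
  then show ?thesis by (simp only: beta_weight_def disc_weight_def) (simp add: diff_diff_eq)
qed

lemma norm_vector3: "(norm (vector [x, y, z] :: real^3))\<^sup>2 = x\<^sup>2 + y\<^sup>2 + z\<^sup>2"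
  unfolding power2_norm_eq_inner by (simp add: inner_vec_def sum_3 power2_eq_square)

text \<open>For a fixed planar radius the density of the ball is a disc weight in the height, so
  that the slice formula can also integrate out \<open>z\<close>.\<close>

lemma beta_density_vector3:
  "beta_density b (vector [x, y, z] :: real^3) =
    beta_const 3 b * disc_weight b (sqrt (x\<^sup>2 + y\<^sup>2)) z"
proof -
  have "norm (vector [x, y, z] :: real^3) < 1 \<longleftrightarrow> x\<^sup>2 + y\<^sup>2 + z\<^sup>2 < 1"
    unfolding norm_vector3[symmetric] by (simp add: abs_square_less_1)
  then show ?thesis
    unfolding beta_density_def norm_vector3 by (simp add: disc_weight_def diff_diff_eq)
qed

text \<open>Integrating out \<open>z\<close> raises the exponent by 1/2, and passing to chord
  coordinates in the plane by another 1/2, whence \<open>b + 1/2\<close> and \<open>b + 1\<close>.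
  Chord coordinates are kept because the law of a single coordinate can be read off from
  them.\<close>

lemma ball_beta_projection:
  assumes [measurable]: "f \<in> borel_measurable borel"
  shows "(\<integral>\<^sup>+v. f (v$1, v$2) \<partial>density lborel (\<lambda>v :: real^3. ennreal (beta_density b v))) =
    ennreal (beta_const 3 b) * (\<integral>\<^sup>+z. ennreal (beta_weight b z) \<partial>lborel) *
    (\<integral>\<^sup>+x. ennreal (beta_weight (b + 1) x) *
      (\<integral>\<^sup>+s. ennreal (beta_weight (b + 1/2) s) * f (x, s * sqrt (1 - x\<^sup>2)) \<partial>lborel) \<partial>lborel)"
  (is "_ = ?c * ?J * _")
proof -
  have "(\<integral>\<^sup>+v. f (v$1, v$2) \<partial>density lborel (\<lambda>v :: real^3. ennreal (beta_density b v)))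
     = (\<integral>\<^sup>+x. \<integral>\<^sup>+y. \<integral>\<^sup>+z. ?c * f (x, y) * (ennreal (disc_weight b (sqrt (x\<^sup>2 + y\<^sup>2)) z) * 1) \<partial>lborel \<partial>lborel \<partial>lborel)"
    by (simp add: nn_integral_density nn_integral_lborel_vec3 beta_density_vector3 ennreal_mult'' mult_ac)
  also have "\<dots> = (\<integral>\<^sup>+x. \<integral>\<^sup>+y. ?c * f (x, y) * (ennreal (disc_weight (b + 1/2) x y) * ?J) \<partial>lborel \<partial>lborel)"
    by (subst nn_integral_cmult, simp, subst nn_integral_disc_slice) (simp_all add: beta_weight_sqrt_sum)
  also have "\<dots> = (\<integral>\<^sup>+x. \<integral>\<^sup>+y. ?c * ?J * (ennreal (disc_weight (b + 1/2) x y) * f (x, y)) \<partial>lborel \<partial>lborel)"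
    by (simp add: mult_ac)
  also have "\<dots> = (\<integral>\<^sup>+x. ?c * ?J * (\<integral>\<^sup>+y. ennreal (disc_weight (b + 1/2) x y) * f (x, y) \<partial>lborel) \<partial>lborel)"
    by (intro nn_integral_cong nn_integral_cmult) measurable
  also have "\<dots> = ?c * ?J * (\<integral>\<^sup>+x. (\<integral>\<^sup>+y. ennreal (disc_weight (b + 1/2) x y) * f (x, y) \<partial>lborel) \<partial>lborel)"
    by (intro nn_integral_cmult) measurable
  also have "\<dots> = ?c * ?J * (\<integral>\<^sup>+x. ennreal (beta_weight (b + 1/2 + 1/2) x) *
      (\<integral>\<^sup>+s. ennreal (beta_weight (b + 1/2) s) * f (x, s * sqrt (1 - x\<^sup>2)) \<partial>lborel) \<partial>lborel)"
    by (subst nn_integral_disc_slice) simp_all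
  also have "b + 1/2 + 1/2 = b + 1" by simp
  finally show ?thesis .
qed

text \<open>The integrand depends only on the direction of \<open>v\<close>, so in coordinates (|z|
  x, |z| y, z) the integral over the ball splits into a factor in \<open>z\<close> and an integral
  over the plane at height 1 with weight r^(-3), where r is the distance of (x, y, 1) from the
  origin. Two substitutions from tangents to sines then turn central projection into orthogonal
  projection.\<close>

lemma sphere_projection:
  assumes [measurable]: "f \<in> borel_measurable borel"
  shows "(\<integral>\<^sup>+v. f (v$1, v$2) \<partial>(uniform_sphere :: (real^3) measure)) =
    inverse (emeasure lborel (cball (0 :: real^3) 1)) *
    (\<integral>\<^sup>+z. ennreal (z\<^sup>2) * indicator {-1..1} z \<partial>lborel) *
    (\<integral>\<^sup>+x. ennreal (beta_weight 0 x) *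
      (\<integral>\<^sup>+s. ennreal (beta_weight (-1/2) s) * f (x, s * sqrt (1 - x\<^sup>2)) \<partial>lborel) \<partial>lborel)"
  (is "_ = ?c * ?K * _")
proof -
  define r where "r x y z = sqrt (x\<^sup>2 + y\<^sup>2 + z\<^sup>2)" for x y z :: real
  have r[measurable]: "(\<lambda>p. r (g p) (h p) (k p)) \<in> borel_measurable M"
    if [measurable]: "g \<in> borel_measurable M" "h \<in> borel_measurable M" "k \<in> borel_measurable M" for g h k and M :: "'z measure"
    unfolding r_def by measurable
  have norm: "norm (vector [x, y, z] :: real^3) = r x y z" for x y z
    unfolding r_def norm_vector3[symmetric] by simp
  have rpos: "0 < r x y 1" for x y
    by (simp add: r_def add_nonneg_pos)
  let ?F = "\<lambda>x y z. f (x / r x y z, y / r x y z) * indicator {..1} (r x y z)"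
  let ?G = "\<lambda>x y. f (x / r x y 1, y / r x y 1)"
  have "(\<integral>\<^sup>+v. f (v$1, v$2) \<partial>(uniform_sphere :: (real^3) measure))
     = (\<integral>\<^sup>+v. f ((v /\<^sub>R norm v)$1, (v /\<^sub>R norm v)$2) * indicator (cball (0 :: real^3) 1) v \<partial>lborel) / emeasure lborel (cball (0 :: real^3) 1)"
    unfolding uniform_sphere_def
    by (subst nn_integral_distr) (simp_all add: nn_integral_uniform_measure)
  also have "\<dots> = ?c * (\<integral>\<^sup>+v. f ((v /\<^sub>R norm v)$1, (v /\<^sub>R norm v)$2) * indicator (cball (0 :: real^3) 1) v \<partial>lborel)"
    by (simp add: divide_ennreal_def mult.commute)
  also have "(\<integral>\<^sup>+v. f ((v /\<^sub>R norm v)$1, (v /\<^sub>R norm v)$2) * indicator (cball (0 :: real^3) 1) v \<partial>lborel)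
     = (\<integral>\<^sup>+x. \<integral>\<^sup>+y. \<integral>\<^sup>+z. ?F x y z \<partial>lborel \<partial>lborel \<partial>lborel)"
    by (subst nn_integral_lborel_vec3)
      (simp_all add: norm divide_inverse mult.commute indicator_def)
  also have "\<dots> = (\<integral>\<^sup>+z. \<integral>\<^sup>+y. \<integral>\<^sup>+x. ?F x y z \<partial>lborel \<partial>lborel \<partial>lborel)"
    using nn_integral_lborel_reverse3[of "\<lambda>(x, y, z). ?F x y z"] by simp
  \<comment> \<open>Scaling by |z| instead of z lets both hemispheres use the same planar point; the
    two scalings give the factor z^2.\<close>
  also have "\<dots> = (\<integral>\<^sup>+z. \<integral>\<^sup>+y. \<integral>\<^sup>+x. ennreal (z\<^sup>2) * ?G x y * indicator {..1} (\<bar>z\<bar> * r x y 1) \<partial>lborel \<partial>lborel \<partial>lborel)"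
  proof (rule nn_integral_cong_AE, rule AE_mp[OF AE_lborel_singleton[of 0]], rule AE_I2, rule impI)
    fix z :: real assume z: "z \<noteq> 0"
    have rz: "r (\<bar>z\<bar> * x) (\<bar>z\<bar> * y) z = \<bar>z\<bar> * r x y 1" for x y
    proof -
      have "(\<bar>z\<bar> * x)\<^sup>2 + (\<bar>z\<bar> * y)\<^sup>2 + z\<^sup>2 = \<bar>z\<bar>\<^sup>2 * (x\<^sup>2 + y\<^sup>2 + 1\<^sup>2)"
        by (simp add: power_mult_distrib algebra_simps)
      then show ?thesis by (simp add: r_def real_sqrt_mult)
    qed
    have Fz: "?F (\<bar>z\<bar> * x) (\<bar>z\<bar> * y) z = ?G x y * indicator {..1} (\<bar>z\<bar> * r x y 1)" for x y
      unfolding rz using z by simp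
    have "(\<integral>\<^sup>+y. \<integral>\<^sup>+x. ?F x y z \<partial>lborel \<partial>lborel)
       = ennreal \<bar>\<bar>z\<bar>\<bar> * (\<integral>\<^sup>+y. \<integral>\<^sup>+x. ?F x (0 + \<bar>z\<bar> * y) z \<partial>lborel \<partial>lborel)"
      using z by (intro nn_integral_real_affine) simp_all
    also have "\<dots> = ennreal \<bar>z\<bar> * (\<integral>\<^sup>+y. ennreal \<bar>\<bar>z\<bar>\<bar> * (\<integral>\<^sup>+x. ?F (0 + \<bar>z\<bar> * x) (0 + \<bar>z\<bar> * y) z \<partial>lborel) \<partial>lborel)"
      using z by (subst nn_integral_real_affine[where t=0 and c="\<bar>z\<bar>"]) simp_all
    also have "\<dots> = ennreal \<bar>z\<bar> * (ennreal \<bar>z\<bar> * (\<integral>\<^sup>+y. (\<integral>\<^sup>+x. ?G x y * indicator {..1} (\<bar>z\<bar> * r x y 1) \<partial>lborel) \<partial>lborel))"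
      by (simp only: add_0 Fz abs_abs) (simp add: nn_integral_cmult)
    also have "\<dots> = ennreal (z\<^sup>2) * (\<integral>\<^sup>+y. (\<integral>\<^sup>+x. ?G x y * indicator {..1} (\<bar>z\<bar> * r x y 1) \<partial>lborel) \<partial>lborel)"
      by (simp add: mult.assoc[symmetric] power2_eq_square flip: ennreal_mult)
    finally show "(\<integral>\<^sup>+y. \<integral>\<^sup>+x. ?F x y z \<partial>lborel \<partial>lborel) =
        (\<integral>\<^sup>+y. \<integral>\<^sup>+x. ennreal (z\<^sup>2) * ?G x y * indicator {..1} (\<bar>z\<bar> * r x y 1) \<partial>lborel \<partial>lborel)"
      by (simp add: nn_integral_cmult mult.assoc)
  qed
  also have "\<dots> = (\<integral>\<^sup>+x. \<integral>\<^sup>+y. \<integral>\<^sup>+z. ennreal (z\<^sup>2) * ?G x y * indicator {..1} (\<bar>z\<bar> * r x y 1) \<partial>lborel \<partial>lborel \<partial>lborel)"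
    using nn_integral_lborel_reverse3[of "\<lambda>(z, y, x). ennreal (z\<^sup>2) * ?G x y * indicator {..1} (\<bar>z\<bar> * r x y 1)"]
    by simp
  \<comment> \<open>Replacing \<open>z\<close> by z / r turns the cutoff |z| r <= 1 into |z| <= 1.
    The differential contributes r^(-1) and the square of \<open>z\<close> contributes
    r^(-2).\<close>
  also have "\<dots> = (\<integral>\<^sup>+x. \<integral>\<^sup>+y. ?K * (ennreal (r x y 1 powr -3) * ?G x y) \<partial>lborel \<partial>lborel)"
  proof (intro nn_integral_cong)
    fix x y :: real
    let ?r = "r x y 1"
    note p = rpos[of x y]
    have "(\<integral>\<^sup>+z. ennreal (z\<^sup>2) * ?G x y * indicator {..1} (\<bar>z\<bar> * ?r) \<partial>lborel)
       = ennreal \<bar>1 / ?r\<bar> * (\<integral>\<^sup>+z. ennreal ((0 + 1 / ?r * z)\<^sup>2) * ?G x y * indicator {..1} (\<bar>0 + 1 / ?r * z\<bar> * ?r) \<partial>lborel)"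
      using p by (intro nn_integral_real_affine) simp_all
    also have "\<dots> = ennreal (1 / ?r) * (\<integral>\<^sup>+z. (ennreal ((1 / ?r)\<^sup>2) * ?G x y) * (ennreal (z\<^sup>2) * indicator {-1..1} z) \<partial>lborel)"
    proof -
      have "ennreal ((0 + 1 / ?r * z)\<^sup>2) * ?G x y * indicator {..1} (\<bar>0 + 1 / ?r * z\<bar> * ?r)
          = (ennreal ((1 / ?r)\<^sup>2) * ?G x y) * (ennreal (z\<^sup>2) * indicator {-1..1} z)" for z
      proof -
        have "\<bar>0 + 1 / ?r * z\<bar> * ?r = \<bar>z\<bar>" using p by (simp add: abs_mult)
        moreover have "indicator {..1} \<bar>z\<bar> = (indicator {-1..1} z :: ennreal)"
          by (auto simp: indicator_def abs_le_iff)
        moreover have "ennreal ((0 + 1 / ?r * z)\<^sup>2) = ennreal ((1 / ?r)\<^sup>2) * ennreal (z\<^sup>2)"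
          by (simp add: power_divide flip: ennreal_mult)
        ultimately show ?thesis by (simp only: mult_ac)
      qed
      then show ?thesis using p by simp
    qed
    also have "\<dots> = (ennreal (1 / ?r) * ennreal ((1 / ?r)\<^sup>2)) * (?G x y * ?K)"
      by (subst nn_integral_cmult) (simp_all only: mult.assoc, measurable)
    also have "ennreal (1 / ?r) * ennreal ((1 / ?r)\<^sup>2) = ennreal (?r powr -3)"
      using p by (simp add: powr_minus power_divide power3_eq_cube power2_eq_square inverse_eq_divide flip: ennreal_mult)
    finally show "(\<integral>\<^sup>+z. ennreal (z\<^sup>2) * ?G x y * indicator {..1} (\<bar>z\<bar> * ?r) \<partial>lborel) = ?K * (ennreal (?r powr -3) * ?G x y)"
      by (simp add: mult_ac)
  qed
  also have "\<dots> = ?K * (\<integral>\<^sup>+x. \<integral>\<^sup>+y. ennreal (r x y 1 powr -3) * ?G x y \<partial>lborel \<partial>lborel)"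
    by (simp add: nn_integral_cmult)
  also have "(\<integral>\<^sup>+x. \<integral>\<^sup>+y. ennreal (r x y 1 powr -3) * ?G x y \<partial>lborel \<partial>lborel) =
     (\<integral>\<^sup>+y. \<integral>\<^sup>+x. ennreal (r x y 1 powr -3) * ?G x y \<partial>lborel \<partial>lborel)"
    by (intro lborel_pair.Fubini') simp
  \<comment> \<open>For fixed \<open>y\<close> put x = q t / p with q = sqrt (1 + y^2) and p = sqrt
    (1 - t^2). Then r = q / p, so that the first coordinate x / r is \<open>t\<close> and the second
    is y p / q.\<close>
  also have "\<dots> = (\<integral>\<^sup>+y. \<integral>\<^sup>+t. ennreal (beta_weight 0 t) * (ennreal (1 / (1 + y\<^sup>2)) * f (t, y / sqrt (1 + y\<^sup>2) * sqrt (1 - t\<^sup>2))) \<partial>lborel \<partial>lborel)"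
  proof (rule nn_integral_cong)
    fix y :: real
    let ?q = "sqrt (1 + y\<^sup>2)"
    have q: "0 < 1 + y\<^sup>2" "0 < ?q" by (simp_all add: add_pos_nonneg)
    have "(\<integral>\<^sup>+x. ennreal (r x y 1 powr -3) * ?G x y \<partial>lborel) =
      ennreal \<bar>?q\<bar> * (\<integral>\<^sup>+x. ennreal (r (0 + ?q * x) y 1 powr -3) * ?G (0 + ?q * x) y \<partial>lborel)"
      using q by (intro nn_integral_real_affine) simp_all
    also have "\<dots> = ennreal ?q * (\<integral>\<^sup>+x. ennreal (r (?q * x) y 1 powr -3) * ?G (?q * x) y \<partial>lborel)"
      using q by simp
    also have "\<dots> = (\<integral>\<^sup>+x. ennreal (?q * r (?q * x) y 1 powr -3) * ?G (?q * x) y \<partial>lborel)"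
      using q by (simp add: ennreal_mult mult.assoc nn_integral_cmult)
    also have "\<dots> = (\<integral>\<^sup>+t. ennreal (beta_weight (-3/2) t) * (ennreal (?q * r (?q * (t / sqrt (1 - t\<^sup>2))) y 1 powr -3) * ?G (?q * (t / sqrt (1 - t\<^sup>2))) y) \<partial>lborel)"
      by (rule nn_integral_line_arc) simp
    also have "\<dots> = (\<integral>\<^sup>+t. ennreal (beta_weight 0 t) * (ennreal (1 / (1 + y\<^sup>2)) * f (t, y / ?q * sqrt (1 - t\<^sup>2))) \<partial>lborel)"
    proof (rule nn_integral_cong)
      fix t :: real
      let ?p = "sqrt (1 - t\<^sup>2)"
      show "ennreal (beta_weight (-3/2) t) * (ennreal (?q * r (?q * (t / ?p)) y 1 powr -3) * ?G (?q * (t / ?p)) y) =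
        ennreal (beta_weight 0 t) * (ennreal (1 / (1 + y\<^sup>2)) * f (t, y / ?q * ?p))"
      proof (cases "\<bar>t\<bar> < 1")
        case True
        then have p: "0 < 1 - t\<^sup>2" "0 < ?p" by (simp_all add: abs_square_less_1)
        have "(?q * (t / ?p))\<^sup>2 + y\<^sup>2 + 1\<^sup>2 = (1 + y\<^sup>2) / (1 - t\<^sup>2)"
          using p q by (simp add: power_mult_distrib power_divide field_simps)
        then have rr: "r (?q * (t / ?p)) y 1 = ?q / ?p"
          by (simp add: r_def real_sqrt_divide)
        have "Q * (Q / P) powr -3 = P ^ 3 / Q\<^sup>2" if "0 < P" "0 < Q" for P Q :: real
          using that by (simp add: powr_minus power_divide power2_eq_square power3_eq_cube)
        from this[OF p(2) q(2)] have "?q * (?q / ?p) powr -3 = ?p ^ 3 / (1 + y\<^sup>2)"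
          using q by simp
        also have "?p ^ 3 = (1 - t\<^sup>2) powr (3/2)"
          using p by (simp add: powr_half_sqrt[symmetric] powr_powr powr_numeral[symmetric] del: powr_numeral)
        finally have e: "?q * (?q / ?p) powr -3 = (1 - t\<^sup>2) powr (3/2) / (1 + y\<^sup>2)" .
        have "beta_weight (-3/2) t * (?q * (?q / ?p) powr -3) = beta_weight 0 t * (1 / (1 + y\<^sup>2))"
          using True p unfolding e by (simp add: beta_weight_def powr_minus)
        moreover have "?G (?q * (t / ?p)) y = f (t, y / ?q * ?p)"
          unfolding rr using p q by simp
        ultimately show ?thesis
          unfolding rr using q by (simp add: mult.assoc[symmetric] flip: ennreal_mult)
      qed (simp add: beta_weight_def)
    qed
    finally show "(\<integral>\<^sup>+x. ennreal (r x y 1 powr -3) * ?G x y \<partial>lborel) =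
      (\<integral>\<^sup>+t. ennreal (beta_weight 0 t) * (ennreal (1 / (1 + y\<^sup>2)) * f (t, y / ?q * sqrt (1 - t\<^sup>2))) \<partial>lborel)" .
  qed
  \<comment> \<open>Now y = s / sqrt (1 - s^2), hence y / sqrt (1 + y^2) = s and 1 / (1 + y^2) = 1 -
    s^2; the latter raises the exponent from -3/2 to -1/2.\<close>
  also have "\<dots> = (\<integral>\<^sup>+s. ennreal (beta_weight (-3/2) s) * (\<integral>\<^sup>+t. ennreal (beta_weight 0 t) * (ennreal (1 / (1 + (s / sqrt (1 - s\<^sup>2))\<^sup>2)) * f (t, (s / sqrt (1 - s\<^sup>2)) / sqrt (1 + (s / sqrt (1 - s\<^sup>2))\<^sup>2) * sqrt (1 - t\<^sup>2))) \<partial>lborel) \<partial>lborel)"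
    by (rule nn_integral_line_arc) simp
  also have "\<dots> = (\<integral>\<^sup>+s. ennreal (beta_weight (-1/2) s) * (\<integral>\<^sup>+t. ennreal (beta_weight 0 t) * f (t, s * sqrt (1 - t\<^sup>2)) \<partial>lborel) \<partial>lborel)"
  proof (rule nn_integral_cong)
    fix s :: real
    let ?p = "sqrt (1 - s\<^sup>2)" and ?I = "\<lambda>s. \<integral>\<^sup>+t. ennreal (beta_weight 0 t) * f (t, s * sqrt (1 - t\<^sup>2)) \<partial>lborel"
    show "ennreal (beta_weight (-3/2) s) * (\<integral>\<^sup>+t. ennreal (beta_weight 0 t) * (ennreal (1 / (1 + (s / ?p)\<^sup>2)) * f (t, (s / ?p) / sqrt (1 + (s / ?p)\<^sup>2) * sqrt (1 - t\<^sup>2))) \<partial>lborel)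
      = ennreal (beta_weight (-1/2) s) * ?I s"
    proof (cases "\<bar>s\<bar> < 1")
      case True
      then have p: "0 < 1 - s\<^sup>2" "0 < ?p" by (simp_all add: abs_square_less_1)
      have e: "1 + (s / ?p)\<^sup>2 = 1 / (1 - s\<^sup>2)"
        using p by (simp add: power_divide field_simps)
      have e2: "(s / ?p) / sqrt (1 / (1 - s\<^sup>2)) = s" "1 / (1 / (1 - s\<^sup>2)) = 1 - s\<^sup>2"
        using p by (simp_all add: real_sqrt_divide)
      have "ennreal (beta_weight (-3/2) s) * (\<integral>\<^sup>+t. ennreal (beta_weight 0 t) * (ennreal (1 - s\<^sup>2) * f (t, s * sqrt (1 - t\<^sup>2))) \<partial>lborel)
        = ennreal (beta_weight (-3/2) s) * (\<integral>\<^sup>+t. ennreal (1 - s\<^sup>2) * (ennreal (beta_weight 0 t) * f (t, s * sqrt (1 - t\<^sup>2))) \<partial>lborel)"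
        by (simp only: mult.left_commute)
      also have "\<dots> = ennreal (beta_weight (-3/2) s * (1 - s\<^sup>2)) * ?I s"
        using p by (simp add: nn_integral_cmult ennreal_mult mult.assoc)
      also have "beta_weight (-3/2) s * (1 - s\<^sup>2) = (1 - s\<^sup>2) powr (-3/2) * (1 - s\<^sup>2) powr 1"
        using True p by (simp add: beta_weight_def)
      also have "\<dots> = beta_weight (-1/2) s"
        unfolding powr_add[symmetric] using True by (simp add: beta_weight_def)
      finally show ?thesis unfolding e e2 .
    qed (simp add: beta_weight_def)
  qed
  also have "\<dots> = (\<integral>\<^sup>+s. \<integral>\<^sup>+t. ennreal (beta_weight (-1/2) s) * (ennreal (beta_weight 0 t) * f (t, s * sqrt (1 - t\<^sup>2))) \<partial>lborel \<partial>lborel)"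
    by (simp add: nn_integral_cmult)
  also have "\<dots> = (\<integral>\<^sup>+t. \<integral>\<^sup>+s. ennreal (beta_weight (-1/2) s) * (ennreal (beta_weight 0 t) * f (t, s * sqrt (1 - t\<^sup>2))) \<partial>lborel \<partial>lborel)"
    by (intro lborel_pair.Fubini') simp
  also have "\<dots> = (\<integral>\<^sup>+t. \<integral>\<^sup>+s. ennreal (beta_weight 0 t) * (ennreal (beta_weight (-1/2) s) * f (t, s * sqrt (1 - t\<^sup>2))) \<partial>lborel \<partial>lborel)"
    by (simp only: mult.left_commute)
  also have "\<dots> = (\<integral>\<^sup>+t. ennreal (beta_weight 0 t) * (\<integral>\<^sup>+s. ennreal (beta_weight (-1/2) s) * f (t, s * sqrt (1 - t\<^sup>2)) \<partial>lborel) \<partial>lborel)"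
    by (simp add: nn_integral_cmult)
  finally show ?thesis by (simp only: mult.assoc)
qed

text \<open>At \<open>b = -1\<close> the exponents \<open>b + 1\<close> and \<open>b + 1/2\<close>
  are the 0 and -1/2 found on the sphere, so one statement covers both cases. \<open>C\<close> is
  chosen before \<open>f\<close>, so that the test function 1 can determine it.\<close>

lemma beta_projection:
  obtains C where "\<And>f :: real \<times> real \<Rightarrow> ennreal. f \<in> borel_measurable borel \<Longrightarrow>
    (\<integral>\<^sup>+v. f (v$1, v$2) \<partial>(beta_distribution b :: (real^3) measure)) =
      C * (\<integral>\<^sup>+x. ennreal (beta_weight (b + 1) x) *
        (\<integral>\<^sup>+s. ennreal (beta_weight (b + 1/2) s) * f (x, s * sqrt (1 - x\<^sup>2)) \<partial>lborel) \<partial>lborel)"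
proof (cases "b = -1")
  case True
  show ?thesis
  proof (rule that)
    fix f :: "real \<times> real \<Rightarrow> ennreal" assume "f \<in> borel_measurable borel"
    note sphere_projection[OF this]
    then show "(\<integral>\<^sup>+v. f (v$1, v$2) \<partial>(beta_distribution b :: (real^3) measure)) =
      inverse (emeasure lborel (cball (0 :: real^3) 1)) * (\<integral>\<^sup>+z. ennreal (z\<^sup>2) * indicator {-1..1} z \<partial>lborel) *
      (\<integral>\<^sup>+x. ennreal (beta_weight (b + 1) x) *
        (\<integral>\<^sup>+s. ennreal (beta_weight (b + 1/2) s) * f (x, s * sqrt (1 - x\<^sup>2)) \<partial>lborel) \<partial>lborel)"
      by (simp add: True beta_distribution_def)
  qed
next
  case False
  show ?thesis
  proof (rule that)
    fix f :: "real \<times> real \<Rightarrow> ennreal" assume "f \<in> borel_measurable borel"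
    then show "(\<integral>\<^sup>+v. f (v$1, v$2) \<partial>(beta_distribution b :: (real^3) measure)) =
      ennreal (beta_const 3 b) * (\<integral>\<^sup>+z. ennreal (beta_weight b z) \<partial>lborel) *
      (\<integral>\<^sup>+x. ennreal (beta_weight (b + 1) x) *
        (\<integral>\<^sup>+s. ennreal (beta_weight (b + 1/2) s) * f (x, s * sqrt (1 - x\<^sup>2)) \<partial>lborel) \<partial>lborel)"
      unfolding beta_distribution_def if_not_P[OF False] by (rule ball_beta_projection)
  qed
qed

subsection \<open>Lines through two points of the disc\<close>

text \<open>The distance of the origin from the line through \<open>(x\<^sub>0, y\<^sub>0)\<close> and \<open>(x\<^sub>1, y\<^sub>1)\<close>.\<close>

definition line_dist :: "real \<Rightarrow> real \<Rightarrow> real \<Rightarrow> real \<Rightarrow> real" where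
  "line_dist x\<^sub>0 y\<^sub>0 x\<^sub>1 y\<^sub>1 = \<bar>x\<^sub>1 * y\<^sub>0 - x\<^sub>0 * y\<^sub>1\<bar> / sqrt ((x\<^sub>1 - x\<^sub>0)\<^sup>2 + (y\<^sub>1 - y\<^sub>0)\<^sup>2)"

lemma line_dist_measurable [measurable (raw)]:
  assumes [measurable]: "f \<in> borel_measurable M" "g \<in> borel_measurable M"
    "h \<in> borel_measurable M" "k \<in> borel_measurable M"
  shows "(\<lambda>p. line_dist (f p) (g p) (h p) (k p)) \<in> borel_measurable M"
  unfolding line_dist_def by measurable

lemma line_dist_slope:
  assumes "x\<^sub>0 \<noteq> x\<^sub>1"
  shows "line_dist x\<^sub>0 (m * x\<^sub>0 + c) x\<^sub>1 (m * x\<^sub>1 + c) = \<bar>c\<bar> / sqrt (1 + m\<^sup>2)"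
proof -
  have 1: "x\<^sub>1 * (m * x\<^sub>0 + c) - x\<^sub>0 * (m * x\<^sub>1 + c) = (x\<^sub>1 - x\<^sub>0) * c"
    by (simp add: algebra_simps)
  have 2: "(x\<^sub>1 - x\<^sub>0)\<^sup>2 + (m * x\<^sub>1 + c - (m * x\<^sub>0 + c))\<^sup>2 = (x\<^sub>1 - x\<^sub>0)\<^sup>2 * (1 + m\<^sup>2)"
    by (simp add: algebra_simps power2_eq_square)
  show ?thesis
    unfolding line_dist_def 1 2 using assms by (simp add: abs_mult real_sqrt_mult)
qed

text \<open>Pythagoras for a point of the line y = m x + q h: here \<open>h\<close> is the signed
  distance of the line from the origin, and \<open>q * x + m * h\<close> is the coordinate along the
  line, measured from the foot of the perpendicular.\<close>

lemma sum_squares_line: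
  fixes m h x :: real
  defines "q \<equiv> sqrt (1 + m\<^sup>2)"
  shows "x\<^sup>2 + (m * x + q * h)\<^sup>2 = (q * x + m * h)\<^sup>2 + h\<^sup>2"
proof -
  have q: "q * q = 1 + m * m" by (simp add: q_def power2_eq_square add_nonneg_nonneg)
  have "x\<^sup>2 + (m * x + q * h)\<^sup>2 = (1 + m * m) * x\<^sup>2 + 2 * m * q * h * x + (q * q) * h\<^sup>2"
    by (simp add: power2_eq_square algebra_simps)
  also have "\<dots> = (q * q) * x\<^sup>2 + 2 * m * q * h * x + (1 + m * m) * h\<^sup>2"
    by (simp only: q)
  also have "\<dots> = (q * x + m * h)\<^sup>2 + h\<^sup>2"
    by (simp add: power2_eq_square algebra_simps)
  finally show ?thesis .
qed

text \<open>The line cuts out a chord of half-length \<open>sqrt (1 - h\<^sup>2)\<close>, and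
  \<open>t\<close> is the position on it in units of this half-length. After a rotation it is the
  vertical chord at abscissa \<open>h\<close>.\<close>

lemma disc_weight_line:
  fixes m h t :: real
  defines "q \<equiv> sqrt (1 + m\<^sup>2)"
  assumes h: "\<bar>h\<bar> < 1" and x: "x = - m * h / q + sqrt (1 - h\<^sup>2) / q * t"
  shows "disc_weight a x (m * x + q * h) = (1 - h\<^sup>2) powr a * beta_weight a t"
proof -
  have q: "0 < q" by (simp add: q_def add_pos_nonneg)
  have "q * x + m * h = sqrt (1 - h\<^sup>2) * t"
    using q unfolding x by (simp add: field_simps)
  then have "x\<^sup>2 + (m * x + q * h)\<^sup>2 = h\<^sup>2 + (sqrt (1 - h\<^sup>2) * t)\<^sup>2"
    unfolding q_def sum_squares_line by (simp add: q_def)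
  then have "disc_weight a x (m * x + q * h) = disc_weight a h (sqrt (1 - h\<^sup>2) * t)"
    unfolding disc_weight_def diff_diff_eq by simp
  then show ?thesis by (simp add: disc_weight_scale[OF h])
qed

lemma disc_weight_line_outside:
  fixes m h :: real
  assumes "1 \<le> \<bar>h\<bar>"
  shows "disc_weight a x (m * x + sqrt (1 + m\<^sup>2) * h) = 0"
proof -
  have "1 \<le> h\<^sup>2" using assms abs_square_less_1[of h] by linarith
  then have "1 \<le> x\<^sup>2 + (m * x + sqrt (1 + m\<^sup>2) * h)\<^sup>2"
    unfolding sum_squares_line by (simp add: add_increasing)
  then show ?thesis by (simp add: disc_weight_def)
qed

lemma nn_integral_swap_2_2:
  fixes f :: "real \<times> real \<times> real \<times> real \<Rightarrow> ennreal"
  assumes [measurable]: "f \<in> borel_measurable (borel \<Otimes>\<^sub>M (borel \<Otimes>\<^sub>M (borel \<Otimes>\<^sub>M borel)))"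
  shows "(\<integral>\<^sup>+x. \<integral>\<^sup>+y. \<integral>\<^sup>+z. \<integral>\<^sup>+w. f (x, y, z, w) \<partial>lborel \<partial>lborel \<partial>lborel \<partial>lborel) =
    (\<integral>\<^sup>+z. \<integral>\<^sup>+w. \<integral>\<^sup>+x. \<integral>\<^sup>+y. f (x, y, z, w) \<partial>lborel \<partial>lborel \<partial>lborel \<partial>lborel)"
proof -
  have "(\<integral>\<^sup>+x. \<integral>\<^sup>+y. \<integral>\<^sup>+z. \<integral>\<^sup>+w. f (x, y, z, w) \<partial>lborel \<partial>lborel \<partial>lborel \<partial>lborel) =
    (\<integral>\<^sup>+x. \<integral>\<^sup>+z. \<integral>\<^sup>+y. \<integral>\<^sup>+w. f (x, y, z, w) \<partial>lborel \<partial>lborel \<partial>lborel \<partial>lborel)"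
    by (rule nn_integral_cong, rule lborel_pair.Fubini') simp
  also have "\<dots> = (\<integral>\<^sup>+z. \<integral>\<^sup>+x. \<integral>\<^sup>+y. \<integral>\<^sup>+w. f (x, y, z, w) \<partial>lborel \<partial>lborel \<partial>lborel \<partial>lborel)"
    by (rule lborel_pair.Fubini') simp
  also have "\<dots> = (\<integral>\<^sup>+z. \<integral>\<^sup>+x. \<integral>\<^sup>+w. \<integral>\<^sup>+y. f (x, y, z, w) \<partial>lborel \<partial>lborel \<partial>lborel \<partial>lborel)"
    by (rule nn_integral_cong, rule nn_integral_cong, rule lborel_pair.Fubini') simp
  also have "\<dots> = (\<integral>\<^sup>+z. \<integral>\<^sup>+w. \<integral>\<^sup>+x. \<integral>\<^sup>+y. f (x, y, z, w) \<partial>lborel \<partial>lborel \<partial>lborel \<partial>lborel)"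
    by (rule nn_integral_cong, rule lborel_pair.Fubini') simp
  finally show ?thesis .
qed

text \<open>Slope and intercept replace the two ordinates one variable at a time, by
  \<open>y\<^sub>1 = y\<^sub>0 + (x\<^sub>1 - x\<^sub>0) * m\<close> and
  \<open>y\<^sub>0 = m * x\<^sub>0 + c\<close>. The second substitution is a translation, so the
  Jacobian comes from the first alone.\<close>

lemma nn_integral_points_on_line:
  fixes f :: "real \<times> real \<Rightarrow> ennreal"
  assumes [measurable]: "f \<in> borel_measurable (borel \<Otimes>\<^sub>M borel)" and ne: "x\<^sub>0 \<noteq> x\<^sub>1"
  shows "(\<integral>\<^sup>+y\<^sub>0. \<integral>\<^sup>+y\<^sub>1. f (y\<^sub>0, y\<^sub>1) \<partial>lborel \<partial>lborel) =
    (\<integral>\<^sup>+m. \<integral>\<^sup>+c. ennreal \<bar>x\<^sub>1 - x\<^sub>0\<bar> * f (m * x\<^sub>0 + c, m * x\<^sub>1 + c) \<partial>lborel \<partial>lborel)"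
proof -
  have "(\<integral>\<^sup>+y\<^sub>0. \<integral>\<^sup>+y\<^sub>1. f (y\<^sub>0, y\<^sub>1) \<partial>lborel \<partial>lborel) =
    (\<integral>\<^sup>+y\<^sub>0. ennreal \<bar>x\<^sub>1 - x\<^sub>0\<bar> * (\<integral>\<^sup>+m. f (y\<^sub>0, y\<^sub>0 + (x\<^sub>1 - x\<^sub>0) * m) \<partial>lborel) \<partial>lborel)"
    using ne by (intro nn_integral_cong nn_integral_real_affine) simp_all
  also have "\<dots> = (\<integral>\<^sup>+y\<^sub>0. \<integral>\<^sup>+m. ennreal \<bar>x\<^sub>1 - x\<^sub>0\<bar> * f (y\<^sub>0, y\<^sub>0 + (x\<^sub>1 - x\<^sub>0) * m) \<partial>lborel \<partial>lborel)"
    by (simp add: nn_integral_cmult)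
  also have "\<dots> = (\<integral>\<^sup>+m. \<integral>\<^sup>+y\<^sub>0. ennreal \<bar>x\<^sub>1 - x\<^sub>0\<bar> * f (y\<^sub>0, y\<^sub>0 + (x\<^sub>1 - x\<^sub>0) * m) \<partial>lborel \<partial>lborel)"
    by (rule lborel_pair.Fubini') simp
  also have "\<dots> = (\<integral>\<^sup>+m. \<integral>\<^sup>+c. ennreal \<bar>x\<^sub>1 - x\<^sub>0\<bar> * f (m * x\<^sub>0 + c, m * x\<^sub>1 + c) \<partial>lborel \<partial>lborel)"
  proof (rule nn_integral_cong)
    fix m :: real
    have "(\<integral>\<^sup>+y\<^sub>0. ennreal \<bar>x\<^sub>1 - x\<^sub>0\<bar> * f (y\<^sub>0, y\<^sub>0 + (x\<^sub>1 - x\<^sub>0) * m) \<partial>lborel) =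
      ennreal \<bar>1\<bar> * (\<integral>\<^sup>+c. ennreal \<bar>x\<^sub>1 - x\<^sub>0\<bar> * f (m * x\<^sub>0 + 1 * c, m * x\<^sub>0 + 1 * c + (x\<^sub>1 - x\<^sub>0) * m) \<partial>lborel)"
      by (rule nn_integral_real_affine) simp_all
    also have "\<dots> = (\<integral>\<^sup>+c. ennreal \<bar>x\<^sub>1 - x\<^sub>0\<bar> * f (m * x\<^sub>0 + c, m * x\<^sub>1 + c) \<partial>lborel)"
      by (simp add: algebra_simps)
    finally show "(\<integral>\<^sup>+y\<^sub>0. ennreal \<bar>x\<^sub>1 - x\<^sub>0\<bar> * f (y\<^sub>0, y\<^sub>0 + (x\<^sub>1 - x\<^sub>0) * m) \<partial>lborel) = \<dots>" .
  qed
  finally show ?thesis .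
qed

text \<open>A planar Blaschke--Petkantschin formula for the weight \<open>disc_weight\<close>, in which lines are
  parametrized as \<open>y = m x + c\<close>; the factor \<open>\<bar>x\<^sub>1 - x\<^sub>0\<bar>\<close> is the Jacobian.\<close>

lemma disc_weight_line_integral:
  assumes g[measurable]: "g \<in> borel_measurable borel"
  defines "q \<equiv> \<lambda>m. sqrt (1 + m\<^sup>2)"
  shows "(\<integral>\<^sup>+x\<^sub>0. \<integral>\<^sup>+x\<^sub>1. ennreal \<bar>x\<^sub>1 - x\<^sub>0\<bar> * (ennreal (disc_weight a x\<^sub>0 (m * x\<^sub>0 + q m * h)) *
        ennreal (disc_weight a x\<^sub>1 (m * x\<^sub>1 + q m * h)) * g (line_dist x\<^sub>0 (m * x\<^sub>0 + q m * h) x\<^sub>1 (m * x\<^sub>1 + q m * h))) \<partial>lborel \<partial>lborel)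
    = ennreal (1 / q m ^ 3) * (\<integral>\<^sup>+s. \<integral>\<^sup>+t. ennreal \<bar>t - s\<bar> * (ennreal (beta_weight a s) * ennreal (beta_weight a t)) \<partial>lborel \<partial>lborel)
      * (ennreal (beta_weight (2 * a + 3/2) h) * g \<bar>h\<bar>)"
  (is "(\<integral>\<^sup>+x\<^sub>0. \<integral>\<^sup>+x\<^sub>1. ?f x\<^sub>0 x\<^sub>1 \<partial>lborel \<partial>lborel) = _ * ?L * _")
proof (cases "\<bar>h\<bar> < 1")
  case False
  then show ?thesis by (simp add: disc_weight_line_outside q_def beta_weight_def)
next
  case True
  then have h: "0 < 1 - h\<^sup>2" by (simp add: abs_square_less_1)
  have q: "0 < q m" by (simp add: q_def add_pos_nonneg)
  define c where "c = sqrt (1 - h\<^sup>2) / q m"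
  have c: "0 < c" using h q by (simp add: c_def)
  let ?x = "\<lambda>t. - m * h / q m + c * t"
  have f: "?f (?x s) (?x t) = ennreal (c * ((1 - h\<^sup>2) powr a)\<^sup>2) * g \<bar>h\<bar> *
      (ennreal \<bar>t - s\<bar> * (ennreal (beta_weight a s) * ennreal (beta_weight a t)))" for s t
  \<comment> \<open>For \<open>s = t\<close> the two points coincide and determine no line, but the
    factor \<open>\<bar>t - s\<bar>\<close> makes both sides vanish.\<close>
  proof (cases "s = t")
    case False
    then have "line_dist (?x s) (m * ?x s + q m * h) (?x t) (m * ?x t + q m * h) = \<bar>q m * h\<bar> / q m"
      using c unfolding q_def by (intro line_dist_slope) simp
    also have "\<dots> = \<bar>h\<bar>" using q by (simp add: abs_mult)
    finally have 1: "line_dist (?x s) (m * ?x s + q m * h) (?x t) (m * ?x t + q m * h) = \<bar>h\<bar>" .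
    have 2: "disc_weight a (?x u) (m * ?x u + q m * h) = (1 - h\<^sup>2) powr a * beta_weight a u" for u
      unfolding q_def by (rule disc_weight_line[OF True]) (simp add: c_def q_def)
    have 3: "\<bar>?x t - ?x s\<bar> = c * \<bar>t - s\<bar>"
      using c by (simp add: abs_mult flip: right_diff_distrib)
    show ?thesis
      unfolding 1 2 3 using c by (simp add: ennreal_mult power2_eq_square mult_ac)
  qed simp
  have "(\<integral>\<^sup>+x\<^sub>0. \<integral>\<^sup>+x\<^sub>1. ?f x\<^sub>0 x\<^sub>1 \<partial>lborel \<partial>lborel) =
      ennreal \<bar>c\<bar> * (\<integral>\<^sup>+s. \<integral>\<^sup>+x\<^sub>1. ?f (?x s) x\<^sub>1 \<partial>lborel \<partial>lborel)"
    using c unfolding q_def by (intro nn_integral_real_affine) simp_all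
  also have "\<dots> = ennreal \<bar>c\<bar> * (\<integral>\<^sup>+s. ennreal \<bar>c\<bar> * (\<integral>\<^sup>+t. ?f (?x s) (?x t) \<partial>lborel) \<partial>lborel)"
    using c unfolding q_def by (intro arg_cong2[where f="(*)"] refl nn_integral_cong nn_integral_real_affine) simp_all
  also have "\<dots> = ennreal c * (ennreal c * (ennreal (c * ((1 - h\<^sup>2) powr a)\<^sup>2) * g \<bar>h\<bar> * ?L))"
    unfolding f using c by (simp add: nn_integral_cmult)
  also have "\<dots> = ennreal (c ^ 3 * ((1 - h\<^sup>2) powr a)\<^sup>2) * (?L * g \<bar>h\<bar>)"
    using c by (simp add: ennreal_mult power3_eq_cube mult_ac)
  \<comment> \<open>Three factors \<open>c\<close>, two from the substitutions and one from the
    Jacobian, supply the 3/2 in the exponent.\<close>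
  also have "c ^ 3 * ((1 - h\<^sup>2) powr a)\<^sup>2 = 1 / q m ^ 3 * beta_weight (2 * a + 3/2) h"
  proof -
    have "c ^ 3 = (1 - h\<^sup>2) powr (3/2) / q m ^ 3"
      using h by (simp add: c_def power_divide powr_half_sqrt[symmetric] powr_powr powr_numeral[symmetric] del: powr_numeral)
    moreover have "((1 - h\<^sup>2) powr a)\<^sup>2 = (1 - h\<^sup>2) powr (2 * a)"
      by (simp add: power2_eq_square flip: powr_add)
    ultimately show ?thesis
      using True by (simp add: beta_weight_def powr_add)
  qed
  also have "ennreal (1 / q m ^ 3 * beta_weight (2 * a + 3/2) h) =
      ennreal (1 / q m ^ 3) * ennreal (beta_weight (2 * a + 3/2) h)"
    using q by (intro ennreal_mult) (simp_all add: less_imp_le)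
  finally show ?thesis
    by (simp only: mult_ac)
qed

text \<open>Writing the intercept as \<open>q m * h\<close> separates the integrand into a function
  of the slope and a function of \<open>h\<close>. \<open>A\<close> collects the former together
  with the chord integral; whether it is finite is left open here.\<close>

lemma disc_weight_line_dist:
  obtains A where "\<And>g. g \<in> borel_measurable borel \<Longrightarrow>
    (\<integral>\<^sup>+x\<^sub>0. \<integral>\<^sup>+y\<^sub>0. \<integral>\<^sup>+x\<^sub>1. \<integral>\<^sup>+y\<^sub>1. ennreal (disc_weight a x\<^sub>0 y\<^sub>0) * ennreal (disc_weight a x\<^sub>1 y\<^sub>1) *
      g (line_dist x\<^sub>0 y\<^sub>0 x\<^sub>1 y\<^sub>1) \<partial>lborel \<partial>lborel \<partial>lborel \<partial>lborel) =
    A * (\<integral>\<^sup>+h. ennreal (beta_weight (2 * a + 3/2) h) * g \<bar>h\<bar> \<partial>lborel)"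
proof
  define q where "q m = sqrt (1 + m\<^sup>2)" for m :: real
  have [measurable]: "q \<in> borel_measurable borel" unfolding q_def by measurable
  have q: "0 < q m" for m by (simp add: q_def add_pos_nonneg)
  let ?L = "\<integral>\<^sup>+s. \<integral>\<^sup>+t. ennreal \<bar>t - s\<bar> * (ennreal (beta_weight a s) * ennreal (beta_weight a t)) \<partial>lborel \<partial>lborel"
  fix g :: "real \<Rightarrow> ennreal" assume [measurable]: "g \<in> borel_measurable borel"
  let ?f = "\<lambda>x\<^sub>0 y\<^sub>0 x\<^sub>1 y\<^sub>1. ennreal (disc_weight a x\<^sub>0 y\<^sub>0) * ennreal (disc_weight a x\<^sub>1 y\<^sub>1) * g (line_dist x\<^sub>0 y\<^sub>0 x\<^sub>1 y\<^sub>1)"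
  let ?K = "\<lambda>x\<^sub>0 x\<^sub>1 m c. ennreal \<bar>x\<^sub>1 - x\<^sub>0\<bar> * ?f x\<^sub>0 (m * x\<^sub>0 + c) x\<^sub>1 (m * x\<^sub>1 + c)"
  let ?I = "\<integral>\<^sup>+h. ennreal (beta_weight (2 * a + 3/2) h) * g \<bar>h\<bar> \<partial>lborel"
  have "(\<integral>\<^sup>+x\<^sub>0. \<integral>\<^sup>+y\<^sub>0. \<integral>\<^sup>+x\<^sub>1. \<integral>\<^sup>+y\<^sub>1. ?f x\<^sub>0 y\<^sub>0 x\<^sub>1 y\<^sub>1 \<partial>lborel \<partial>lborel \<partial>lborel \<partial>lborel) =
      (\<integral>\<^sup>+x\<^sub>0. \<integral>\<^sup>+x\<^sub>1. \<integral>\<^sup>+y\<^sub>0. \<integral>\<^sup>+y\<^sub>1. ?f x\<^sub>0 y\<^sub>0 x\<^sub>1 y\<^sub>1 \<partial>lborel \<partial>lborel \<partial>lborel \<partial>lborel)"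
    by (rule nn_integral_cong, rule lborel_pair.Fubini') simp
  also have "\<dots> = (\<integral>\<^sup>+x\<^sub>0. \<integral>\<^sup>+x\<^sub>1. \<integral>\<^sup>+m. \<integral>\<^sup>+c. ?K x\<^sub>0 x\<^sub>1 m c \<partial>lborel \<partial>lborel \<partial>lborel \<partial>lborel)"
  proof (rule nn_integral_cong, rule nn_integral_cong_AE, rule AE_mp[OF AE_lborel_singleton], rule AE_I2, rule impI)
    fix x\<^sub>0 x\<^sub>1 :: real assume "x\<^sub>1 \<noteq> x\<^sub>0"
    then show "(\<integral>\<^sup>+y\<^sub>0. \<integral>\<^sup>+y\<^sub>1. ?f x\<^sub>0 y\<^sub>0 x\<^sub>1 y\<^sub>1 \<partial>lborel \<partial>lborel) = (\<integral>\<^sup>+m. \<integral>\<^sup>+c. ?K x\<^sub>0 x\<^sub>1 m c \<partial>lborel \<partial>lborel)"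
      using nn_integral_points_on_line[of "\<lambda>(y\<^sub>0, y\<^sub>1). ?f x\<^sub>0 y\<^sub>0 x\<^sub>1 y\<^sub>1" x\<^sub>0 x\<^sub>1] by simp
  qed
  also have "\<dots> = (\<integral>\<^sup>+m. \<integral>\<^sup>+c. \<integral>\<^sup>+x\<^sub>0. \<integral>\<^sup>+x\<^sub>1. ?K x\<^sub>0 x\<^sub>1 m c \<partial>lborel \<partial>lborel \<partial>lborel \<partial>lborel)"
    using nn_integral_swap_2_2[of "\<lambda>(x\<^sub>0, x\<^sub>1, m, c). ?K x\<^sub>0 x\<^sub>1 m c"] by simp
  also have "\<dots> = (\<integral>\<^sup>+m. ennreal \<bar>q m\<bar> * (\<integral>\<^sup>+h. \<integral>\<^sup>+x\<^sub>0. \<integral>\<^sup>+x\<^sub>1. ?K x\<^sub>0 x\<^sub>1 m (0 + q m * h) \<partial>lborel \<partial>lborel \<partial>lborel) \<partial>lborel)"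
    using q by (intro nn_integral_cong nn_integral_real_affine) (simp_all add: less_imp_neq[symmetric])
  also have "\<dots> = (\<integral>\<^sup>+m. ennreal (q m) * (\<integral>\<^sup>+h. ennreal (1 / q m ^ 3) * ?L * (ennreal (beta_weight (2 * a + 3/2) h) * g \<bar>h\<bar>) \<partial>lborel) \<partial>lborel)"
    using q by (simp add: less_imp_le q_def disc_weight_line_integral)
  also have "\<dots> = (\<integral>\<^sup>+m. ennreal (q m) * (ennreal (1 / q m ^ 3) * ?L) * ?I \<partial>lborel)"
    by (simp add: nn_integral_cmult mult.assoc)
  also have "\<dots> = (\<integral>\<^sup>+m. ennreal (q m) * (ennreal (1 / q m ^ 3) * ?L) \<partial>lborel) * ?I"
    by (rule nn_integral_multc) simp
  finally show "(\<integral>\<^sup>+x\<^sub>0. \<integral>\<^sup>+y\<^sub>0. \<integral>\<^sup>+x\<^sub>1. \<integral>\<^sup>+y\<^sub>1. ?f x\<^sub>0 y\<^sub>0 x\<^sub>1 y\<^sub>1 \<partial>lborel \<partial>lborel \<partial>lborel \<partial>lborel) =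
    (\<integral>\<^sup>+m. ennreal (q m) * (ennreal (1 / q m ^ 3) * ?L) \<partial>lborel) * ?I" .
qed

subsection \<open>Half-spaces and planes\<close>

text \<open>The device by which total mass 1 replaces a computation: \<open>C\<close> is an unknown
  constant and \<open>J\<close> the integral for the test function 1. Since 0 * \<infinity> = 0 in
  \<open>ennreal\<close>, the product 1 also excludes the values 0 and \<infinity> for
  \<open>J\<close>.\<close>

lemma ennreal_mult_eq_divide:
  fixes C J :: ennreal
  assumes "C * J = 1"
  shows "C * I = I / J" and "0 < J" and "J < \<infinity>"
proof -
  show "0 < J" using assms by (auto simp: zero_less_iff_neq_zero)
  have "J \<noteq> \<top>"
    using assms by (cases "C = 0") (auto simp: ennreal_mult_top)
  then show J: "J < \<infinity>" by (simp add: less_top)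
  have "C = C * (J * inverse J)"
    using \<open>0 < J\<close> J by (simp add: ennreal_mult_divide_eq flip: divide_ennreal_def)
  also have "\<dots> = inverse J" using assms by (simp add: mult.assoc[symmetric])
  finally show "C * I = I / J" by (simp add: divide_ennreal_def mult.commute)
qed

definition beta_norm :: "real \<Rightarrow> ennreal" where
  "beta_norm a = (\<integral>\<^sup>+x. ennreal (beta_weight a x) \<partial>lborel)"

text \<open>The distribution function of the coordinates of a beta-distributed point, for \<open>a\<close> the parameter plus 1.\<close>

definition cap :: "real \<Rightarrow> real \<Rightarrow> ennreal" where
  "cap a h = (\<integral>\<^sup>+x. ennreal (beta_weight a x) * indicator {..<h} x \<partial>lborel) / beta_norm a"

text \<open>For a unit vector \<open>u\<close>, twice the signed area of the triangle \<open>x y z\<close> projected along \<open>u\<close>.\<close>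

definition orient :: "real^3 \<Rightarrow> real^3 \<Rightarrow> real^3 \<Rightarrow> real^3 \<Rightarrow> real" where
  "orient u x y z = u \<bullet> cross3 (y - x) (z - x)"

lemma borel_measurable_vec_nth [measurable (raw)]:
  fixes f :: "'a \<Rightarrow> real ^ 'n"
  assumes [measurable]: "f \<in> borel_measurable M"
  shows "(\<lambda>x. f x $ i) \<in> borel_measurable M"
  unfolding cart_eq_inner_axis by measurable

lemma triple_product_measurable:
  assumes [measurable]: "f \<in> borel_measurable M" "g \<in> borel_measurable M" "h \<in> borel_measurable M"
  shows "(\<lambda>p. f p \<bullet> cross3 (g p) (h p)) \<in> borel_measurable M"
  by (simp add: cross3_def inner_vec_def sum_3)

lemma orient_measurable [measurable (raw)]:
  assumes [measurable]: "f \<in> borel_measurable M" "g \<in> borel_measurable M"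
    "h \<in> borel_measurable M" "k \<in> borel_measurable M"
  shows "(\<lambda>p. orient (f p) (g p) (h p) (k p)) \<in> borel_measurable M"
  unfolding orient_def by (intro triple_product_measurable) measurable

text \<open>The cross product commutes with rotations; a reflection would reverse the sign of
  \<open>orient\<close>.\<close>

lemma orient_orthogonal:
  assumes "orthogonal_transformation T" "det (matrix T) = 1"
  shows "orient (T u) (T x) (T y) (T z) = orient u x y z"
proof -
  have "T y - T x = T (y - x)" "T z - T x = T (z - x)"
    using assms(1) by (simp_all add: linear_diff orthogonal_transformation_linear)
  then show ?thesis
    using assms by (simp add: orient_def cross_orthogonal_transformation orthogonal_transformation_def)
qed

text \<open>In its last argument \<open>orient\<close> is affine with normal vector
  \<open>cross3 u (y - x)\<close>, so its sign tells on which side of a plane parallel to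
  \<open>u\<close> the point \<open>z\<close> lies.\<close>

lemma orient_eq_inner: "orient u x y z = z \<bullet> cross3 u (y - x) - u \<bullet> cross3 y x"
  by (simp add: orient_def cross3_simps)

lemma norm_cross_axis_3: "norm (cross3 (axis 3 1) v) = sqrt ((v$1)\<^sup>2 + (v$2)\<^sup>2)"
  by (simp add: norm_eq_sqrt_inner cross3_simps axis_def power2_eq_square)

text \<open>For \<open>u = axis 3 1\<close> the right-hand side is the distance of the origin from
  the plane on which \<open>orient\<close> vanishes. A planar distance thus governs half-space
  probabilities in space.\<close>

lemma line_dist_eq:
  "line_dist (x$1) (x$2) (y$1) (y$2) = \<bar>axis 3 1 \<bullet> cross3 y x\<bar> / norm (cross3 (axis 3 1) (y - x))"
  unfolding norm_cross_axis_3 line_dist_def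
  by (simp add: cross3_def inner_axis' power2_commute mult.commute)

text \<open>Total mass 1 is assumed and never computed: in the application the distribution is the
  law of a random point, hence a probability measure.\<close>

locale beta_law = prob_space "beta_distribution b :: (real^3) measure" for b :: real
begin

abbreviation "B \<equiv> beta_distribution b :: (real^3) measure"

lemma nn_integral_B_orthogonal:
  assumes T: "orthogonal_transformation T" and [measurable]: "f \<in> borel_measurable borel"
  shows "(\<integral>\<^sup>+v. f (T v) \<partial>B) = (\<integral>\<^sup>+v. f v \<partial>B)"
proof -
  have [measurable]: "T \<in> borel_measurable borel"
    using T by (intro borel_measurable_continuous_onI linear_continuous_on linear_conv_bounded_linear[THEN iffD1]
        orthogonal_transformation_linear)
  have "(\<integral>\<^sup>+v. f v \<partial>B) = (\<integral>\<^sup>+v. f v \<partial>distr B borel T)"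
    by (simp add: beta_distribution_orthogonal_invariant[OF T])
  also have "\<dots> = (\<integral>\<^sup>+v. f (T v) \<partial>B)" by (rule nn_integral_distr) simp_all
  finally show ?thesis ..
qed

text \<open>An orthogonal transformation moves the first axis to \<open>u\<close>. For functions of
  the first coordinate the inner integral over \<open>s\<close> is a constant, which the test
  function 1 identifies.\<close>

lemma nn_integral_marginal:
  assumes u: "norm u = 1" and g[measurable]: "g \<in> borel_measurable borel"
  shows "(\<integral>\<^sup>+v. g (v \<bullet> u) \<partial>B) = (\<integral>\<^sup>+x. ennreal (beta_weight (b + 1) x) * g x \<partial>lborel) / beta_norm (b + 1)"
    and "0 < beta_norm (b + 1)" and "beta_norm (b + 1) < \<infinity>"
proof -
  obtain C where C: "\<And>f :: real \<times> real \<Rightarrow> ennreal. f \<in> borel_measurable borel \<Longrightarrow>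
    (\<integral>\<^sup>+v. f (v$1, v$2) \<partial>B) = C * (\<integral>\<^sup>+x. ennreal (beta_weight (b + 1) x) *
        (\<integral>\<^sup>+s. ennreal (beta_weight (b + 1/2) s) * f (x, s * sqrt (1 - x\<^sup>2)) \<partial>lborel) \<partial>lborel)"
    by (rule beta_projection[of b]) blast
  define K where "K = C * (\<integral>\<^sup>+s. ennreal (beta_weight (b + 1/2) s) \<partial>lborel)"
  have *: "(\<integral>\<^sup>+v. h (v$1) \<partial>B) = K * (\<integral>\<^sup>+x. ennreal (beta_weight (b + 1) x) * h x \<partial>lborel)"
    if [measurable]: "h \<in> borel_measurable borel" for h
  proof -
    have [measurable]: "(\<lambda>p :: real \<times> real. h (fst p)) \<in> borel_measurable borel"
      unfolding borel_prod[symmetric] by measurable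
    show ?thesis
      using C[of "\<lambda>p. h (fst p)"]
      by (simp add: K_def nn_integral_multc nn_integral_cmult mult_ac)
        (simp add: nn_integral_multc mult.assoc[symmetric])
  qed
  have K: "K * beta_norm (b + 1) = 1"
    using *[of "\<lambda>_. 1"] emeasure_space_1 by (simp add: beta_norm_def)
  from ennreal_mult_eq_divide[OF K]
  show "0 < beta_norm (b + 1)" "beta_norm (b + 1) < \<infinity>" by simp_all
  have "norm (axis 1 1 :: real^3) = 1" by simp
  then obtain T :: "real^3 \<Rightarrow> real^3" where T: "orthogonal_transformation T" "T (axis 1 1) = u"
    using u by (rule orthogonal_transformation_exists_1)
  have Tv: "T v \<bullet> u = v$1" for v
  proof -
    have "T v \<bullet> u = v \<bullet> axis 1 1"
      using T(1) by (simp add: T(2)[symmetric] orthogonal_transformation_def)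
    then show ?thesis by (simp add: inner_axis)
  qed
  have "(\<integral>\<^sup>+v. g (v \<bullet> u) \<partial>B) = (\<integral>\<^sup>+v. g (T v \<bullet> u) \<partial>B)"
    by (rule nn_integral_B_orthogonal[OF T(1), symmetric]) simp
  also have "\<dots> = K * (\<integral>\<^sup>+x. ennreal (beta_weight (b + 1) x) * g x \<partial>lborel)"
    by (simp only: Tv *[OF g])
  finally show "(\<integral>\<^sup>+v. g (v \<bullet> u) \<partial>B) = (\<integral>\<^sup>+x. ennreal (beta_weight (b + 1) x) * g x \<partial>lborel) / beta_norm (b + 1)"
    by (simp only: ennreal_mult_eq_divide(1)[OF K])
qed

lemma emeasure_halfspace:
  assumes "w \<noteq> 0"
  shows "emeasure B {v. v \<bullet> w < d} = cap (b + 1) (d / norm w)"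
    and "emeasure B {v. d < v \<bullet> w} = cap (b + 1) (- d / norm w)"
proof -
  have *: "emeasure B {v. v \<bullet> w < d} = cap (b + 1) (d / norm w)" if "w \<noteq> 0" for w and d
  proof -
    have "emeasure B {v. v \<bullet> w < d} = (\<integral>\<^sup>+v. indicator {v. v \<bullet> w < d} v \<partial>B)" by simp
    also have "\<dots> = (\<integral>\<^sup>+v. indicator {..<d / norm w} (v \<bullet> (w /\<^sub>R norm w)) \<partial>B)"
      using that by (intro nn_integral_cong) (simp add: indicator_def field_simps)
    also have "\<dots> = cap (b + 1) (d / norm w)"
      unfolding cap_def using that by (intro nn_integral_marginal) simp_all
    finally show ?thesis .
  qed
  then show "emeasure B {v. v \<bullet> w < d} = cap (b + 1) (d / norm w)" using assms .
  show "emeasure B {v. d < v \<bullet> w} = cap (b + 1) (- d / norm w)"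
    using *[of "- w" "- d"] assms by simp
qed

text \<open>One-dimensional marginals have a density even for \<open>b = -1\<close>, so a prescribed
  value of \<open>v \<bullet> w\<close> has probability zero.\<close>

lemma emeasure_hyperplane:
  assumes "w \<noteq> 0"
  shows "emeasure B {v. v \<bullet> w = d} = 0"
proof -
  have "emeasure B {v. v \<bullet> w = d} = (\<integral>\<^sup>+v. indicator {v. v \<bullet> w = d} v \<partial>B)" by simp
  also have "\<dots> = (\<integral>\<^sup>+v. indicator {d / norm w} (v \<bullet> (w /\<^sub>R norm w)) \<partial>B)"
    using assms by (intro nn_integral_cong) (auto simp: indicator_def field_simps)
  also have "\<dots> = (\<integral>\<^sup>+x. ennreal (beta_weight (b + 1) x) * indicator {d / norm w} x \<partial>lborel) / beta_norm (b + 1)"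
    using assms by (intro nn_integral_marginal) simp_all
  also have "(\<integral>\<^sup>+x. ennreal (beta_weight (b + 1) x) * indicator {d / norm w} x \<partial>lborel) = 0"
    by (intro nn_integral_null_set null_setsI) simp_all
  finally show ?thesis by simp
qed

lemma AE_not_hyperplane:
  assumes "w \<noteq> 0"
  shows "AE v in B. v \<bullet> w \<noteq> d"
  using emeasure_hyperplane[OF assms, of d] by (intro AE_I[where N="{v. v \<bullet> w = d}"]) auto

text \<open>A vanishing product would make \<open>y - x\<close> vertical, and in particular equate
  the first coordinates.\<close>

lemma AE_cross_axis_3: "AE y in B. cross3 (axis 3 1) (y - x) \<noteq> 0"
proof (rule AE_mp[OF AE_not_hyperplane[of "axis 1 1" "x$1"] AE_I2], simp_all add: axis_eq_0_iff, rule impI)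
  fix y :: "real^3" assume "y \<bullet> axis 1 1 \<noteq> x$1"
  then have "norm (cross3 (axis 3 1) (y - x)) \<noteq> 0"
    unfolding norm_cross_axis_3 by (simp add: inner_axis sum_power2_eq_zero_iff)
  then show "cross3 (axis 3 1) (y - x) \<noteq> 0" by simp
qed

text \<open>Each point brings a factor \<open>C\<close> from the projection and the pair brings
  \<open>A\<close> from the line formula; their product is one constant, again found from the test
  function 1.\<close>

lemma nn_integral_line_dist:
  assumes [measurable]: "g \<in> borel_measurable borel"
  shows "(\<integral>\<^sup>+x. \<integral>\<^sup>+y. g (line_dist (x$1) (x$2) (y$1) (y$2)) \<partial>B \<partial>B) =
    (\<integral>\<^sup>+h. ennreal (beta_weight (2 * b + 5/2) h) * g \<bar>h\<bar> \<partial>lborel) / beta_norm (2 * b + 5/2)"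
    and "0 < beta_norm (2 * b + 5/2)" and "beta_norm (2 * b + 5/2) < \<infinity>"
proof -
  let ?q = "disc_weight (b + 1/2)"
  obtain C where C: "\<And>f :: real \<times> real \<Rightarrow> ennreal. f \<in> borel_measurable borel \<Longrightarrow>
    (\<integral>\<^sup>+v. f (v$1, v$2) \<partial>B) = C * (\<integral>\<^sup>+x. ennreal (beta_weight (b + 1) x) *
        (\<integral>\<^sup>+s. ennreal (beta_weight (b + 1/2) s) * f (x, s * sqrt (1 - x\<^sup>2)) \<partial>lborel) \<partial>lborel)"
    by (rule beta_projection[of b]) blast
  \<comment> \<open>The slice formula is used backwards here, returning from chord coordinates to
    Cartesian ones.\<close>
  have C': "(\<integral>\<^sup>+v. f (v$1) (v$2) \<partial>B) = C * (\<integral>\<^sup>+x. \<integral>\<^sup>+y. ennreal (?q x y) * f x y \<partial>lborel \<partial>lborel)"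
    if [measurable]: "case_prod f \<in> borel_measurable (borel \<Otimes>\<^sub>M borel)" for f
  proof -
    have f: "f x \<in> borel_measurable borel" for x
      using measurable_compose[OF measurable_Pair1' that, of x] by simp
    have "b + 1/2 + 1/2 = b + 1" by simp
    note nn_integral_disc_slice[OF f, of "b + 1/2", unfolded this]
    then have "(\<integral>\<^sup>+y. ennreal (?q x y) * f x y \<partial>lborel) = ennreal (beta_weight (b + 1) x) *
        (\<integral>\<^sup>+s. ennreal (beta_weight (b + 1/2) s) * f x (s * sqrt (1 - x\<^sup>2)) \<partial>lborel)" for x .
    moreover have "case_prod f \<in> borel_measurable borel"
      using that by (simp only: borel_prod)
    ultimately show ?thesis
      by (simp only: C[of "case_prod f", simplified prod.case])
  qed
  obtain A where A: "\<And>g. g \<in> borel_measurable borel \<Longrightarrow>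
    (\<integral>\<^sup>+x\<^sub>0. \<integral>\<^sup>+y\<^sub>0. \<integral>\<^sup>+x\<^sub>1. \<integral>\<^sup>+y\<^sub>1. ennreal (?q x\<^sub>0 y\<^sub>0) * ennreal (?q x\<^sub>1 y\<^sub>1) *
      g (line_dist x\<^sub>0 y\<^sub>0 x\<^sub>1 y\<^sub>1) \<partial>lborel \<partial>lborel \<partial>lborel \<partial>lborel) =
    A * (\<integral>\<^sup>+h. ennreal (beta_weight (2 * (b + 1/2) + 3/2) h) * g \<bar>h\<bar> \<partial>lborel)"
    by (rule disc_weight_line_dist[of "b + 1/2"]) blast
  have e: "2 * (b + 1/2) + 3/2 = 2 * b + 5/2" by simp
  have *: "(\<integral>\<^sup>+x. \<integral>\<^sup>+y. g (line_dist (x$1) (x$2) (y$1) (y$2)) \<partial>B \<partial>B) =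
    C * C * A * (\<integral>\<^sup>+h. ennreal (beta_weight (2 * b + 5/2) h) * g \<bar>h\<bar> \<partial>lborel)"
    if [measurable]: "g \<in> borel_measurable borel" for g
  proof -
    have "(\<integral>\<^sup>+x. \<integral>\<^sup>+y. g (line_dist (x$1) (x$2) (y$1) (y$2)) \<partial>B \<partial>B) =
      (\<integral>\<^sup>+x. C * (\<integral>\<^sup>+x\<^sub>1. \<integral>\<^sup>+y\<^sub>1. ennreal (?q x\<^sub>1 y\<^sub>1) * g (line_dist (x$1) (x$2) x\<^sub>1 y\<^sub>1) \<partial>lborel \<partial>lborel) \<partial>B)"
      by (intro nn_integral_cong C') measurable
    also have "\<dots> = C * (\<integral>\<^sup>+x\<^sub>0. \<integral>\<^sup>+y\<^sub>0. ennreal (?q x\<^sub>0 y\<^sub>0) * (C * (\<integral>\<^sup>+x\<^sub>1. \<integral>\<^sup>+y\<^sub>1. ennreal (?q x\<^sub>1 y\<^sub>1) * g (line_dist x\<^sub>0 y\<^sub>0 x\<^sub>1 y\<^sub>1) \<partial>lborel \<partial>lborel)) \<partial>lborel \<partial>lborel)"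
      by (rule C') measurable
    also have "\<dots> = C * (\<integral>\<^sup>+x\<^sub>0. \<integral>\<^sup>+y\<^sub>0. C * (\<integral>\<^sup>+x\<^sub>1. \<integral>\<^sup>+y\<^sub>1. ennreal (?q x\<^sub>0 y\<^sub>0) * ennreal (?q x\<^sub>1 y\<^sub>1) * g (line_dist x\<^sub>0 y\<^sub>0 x\<^sub>1 y\<^sub>1) \<partial>lborel \<partial>lborel) \<partial>lborel \<partial>lborel)"
    proof -
      have "ennreal (?q x\<^sub>0 y\<^sub>0) * (C * (\<integral>\<^sup>+x\<^sub>1. \<integral>\<^sup>+y\<^sub>1. ennreal (?q x\<^sub>1 y\<^sub>1) * g (line_dist x\<^sub>0 y\<^sub>0 x\<^sub>1 y\<^sub>1) \<partial>lborel \<partial>lborel)) =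
        C * (\<integral>\<^sup>+x\<^sub>1. \<integral>\<^sup>+y\<^sub>1. ennreal (?q x\<^sub>0 y\<^sub>0) * ennreal (?q x\<^sub>1 y\<^sub>1) * g (line_dist x\<^sub>0 y\<^sub>0 x\<^sub>1 y\<^sub>1) \<partial>lborel \<partial>lborel)" for x\<^sub>0 y\<^sub>0
        by (simp add: nn_integral_cmult mult.assoc) (simp only: mult.left_commute)
      then show ?thesis by (simp only:)
    qed
    also have "\<dots> = C * (C * (A * (\<integral>\<^sup>+h. ennreal (beta_weight (2 * b + 5/2) h) * g \<bar>h\<bar> \<partial>lborel)))"
      unfolding A[OF that, unfolded e, symmetric] by (simp add: nn_integral_cmult)
    finally show ?thesis by (simp only: mult.assoc)
  qed
  have K: "C * C * A * beta_norm (2 * b + 5/2) = 1"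
    using *[of "\<lambda>_. 1"] emeasure_space_1 by (simp add: beta_norm_def)
  from ennreal_mult_eq_divide[OF K]
  show "0 < beta_norm (2 * b + 5/2)" "beta_norm (2 * b + 5/2) < \<infinity>" by simp_all
  show "(\<integral>\<^sup>+x. \<integral>\<^sup>+y. g (line_dist (x$1) (x$2) (y$1) (y$2)) \<partial>B \<partial>B) =
    (\<integral>\<^sup>+h. ennreal (beta_weight (2 * b + 5/2) h) * g \<bar>h\<bar> \<partial>lborel) / beta_norm (2 * b + 5/2)"
    by (simp only: *[OF assms] ennreal_mult_eq_divide(1)[OF K])
qed

end

text \<open>The probability that the segment between two fixed points of the sample projects to an edge of the hull.\<close>

definition edge_prob :: "real \<Rightarrow> ennreal" where
  "edge_prob b = (\<integral>\<^sup>+h. ennreal (beta_weight (2 * b + 5/2) h) *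
    ((cap (b + 1) \<bar>h\<bar>)\<^sup>2 + (cap (b + 1) (- \<bar>h\<bar>))\<^sup>2) \<partial>lborel) / beta_norm (2 * b + 5/2)"

lemma cap_measurable [measurable]: "cap a \<in> borel_measurable borel"
proof -
  have "cap a = (\<lambda>h. (\<integral>\<^sup>+x. ennreal (beta_weight a x) * (if x < h then 1 else 0) \<partial>lborel) / beta_norm a)"
    by (simp add: fun_eq_iff cap_def indicator_def of_bool_def)
  then show ?thesis by simp
qed

text \<open>Independence makes the joint law a product measure, from which one coordinate at a time
  is split off. The order of the indices is free, so that one statement serves all six pairs of
  points.\<close>

lemma (in prob_space) nn_integral_indep4:
  fixes X :: "'i \<Rightarrow> 'a \<Rightarrow> 'b::second_countable_topology"
  assumes indep: "indep_vars (\<lambda>_. borel) X I"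
    and distr: "\<And>i. i \<in> I \<Longrightarrow> distr M borel (X i) = N"
    and I: "I = {i, j, k, l}" "distinct [i, j, k, l]"
    and f[measurable]: "f \<in> borel_measurable (borel \<Otimes>\<^sub>M (borel \<Otimes>\<^sub>M (borel \<Otimes>\<^sub>M borel)))"
  shows "(\<integral>\<^sup>+\<omega>. f (X i \<omega>, X j \<omega>, X k \<omega>, X l \<omega>) \<partial>M) =
    (\<integral>\<^sup>+x. \<integral>\<^sup>+y. \<integral>\<^sup>+z. \<integral>\<^sup>+w. f (x, y, z, w) \<partial>N \<partial>N \<partial>N \<partial>N)"
proof -
  have rv[measurable]: "random_variable borel (X m)" if "m \<in> I" for m
    using indep that by (auto simp: indep_vars_def)
  have "prob_space N"
    using distr[of i] I rv[of i] prob_space_distr[of "X i" borel] by auto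
  then interpret N: prob_space N .
  have [measurable_cong, simp]: "sets N = sets borel"
    using distr[of i] I by (metis insertI1 sets_distr)
  interpret product_sigma_finite "\<lambda>_ :: 'i. N"
    by (rule product_sigma_finite.intro) (rule N.sigma_finite_measure_axioms)
  have "distr M (\<Pi>\<^sub>M i\<in>I. borel) (\<lambda>x. \<lambda>i\<in>I. X i x) = (\<Pi>\<^sub>M i\<in>I. distr M borel (X i))"
    using indep rv I by (subst indep_vars_iff_distr_eq_PiM'[symmetric]) auto
  also have "\<dots> = (\<Pi>\<^sub>M i\<in>I. N)"
    by (intro PiM_cong distr) simp_all
  finally have D: "distr M (\<Pi>\<^sub>M i\<in>I. borel) (\<lambda>x. \<lambda>i\<in>I. X i x) = (\<Pi>\<^sub>M i\<in>I. N)" .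
  let ?g = "\<lambda>x. f (x i, x j, x k, x l)"
  have mem: "i \<in> I" "j \<in> I" "k \<in> I" "l \<in> I" using I by auto
  have g: "?g \<in> borel_measurable (\<Pi>\<^sub>M i\<in>I. borel)"
    using mem by measurable
  have s: "sets (\<Pi>\<^sub>M i\<in>I. N) = sets (\<Pi>\<^sub>M i\<in>I. borel)"
    by (intro sets_PiM_cong) simp_all
  have "(\<integral>\<^sup>+\<omega>. f (X i \<omega>, X j \<omega>, X k \<omega>, X l \<omega>) \<partial>M) =
      (\<integral>\<^sup>+\<omega>. ?g (\<lambda>i\<in>I. X i \<omega>) \<partial>M)"
    using mem by simp
  also have "\<dots> = (\<integral>\<^sup>+x. ?g x \<partial>distr M (\<Pi>\<^sub>M i\<in>I. borel) (\<lambda>x. \<lambda>i\<in>I. X i x))"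
    by (subst nn_integral_distr) (use g in \<open>auto intro!: measurable_restrict rv\<close>)
  also have "\<dots> = (\<integral>\<^sup>+x. ?g x \<partial>(\<Pi>\<^sub>M i\<in>{i, j, k, l}. N))"
    unfolding D by (simp only: I(1))
  also have "\<dots> = (\<integral>\<^sup>+x. \<integral>\<^sup>+y. \<integral>\<^sup>+z. \<integral>\<^sup>+w. f (x, y, z, w) \<partial>N \<partial>N \<partial>N \<partial>N)"
  proof -
    have 1: "(\<integral>\<^sup>+x. ?g x \<partial>(\<Pi>\<^sub>M i\<in>{i, j, k, l}. N)) = (\<integral>\<^sup>+x. \<integral>\<^sup>+p. f (x, p j, p k, p l) \<partial>(\<Pi>\<^sub>M i\<in>{j, k, l}. N) \<partial>N)"
      using I(2) g s I(1) by (subst product_nn_integral_insert_rev) auto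
    have 2: "(\<integral>\<^sup>+p. f (x, p j, p k, p l) \<partial>(\<Pi>\<^sub>M i\<in>{j, k, l}. N)) = (\<integral>\<^sup>+y. \<integral>\<^sup>+p. f (x, y, p k, p l) \<partial>(\<Pi>\<^sub>M i\<in>{k, l}. N) \<partial>N)" for x
      using I(2) by (subst product_nn_integral_insert_rev) auto
    have 3: "(\<integral>\<^sup>+p. f (x, y, p k, p l) \<partial>(\<Pi>\<^sub>M i\<in>{k, l}. N)) = (\<integral>\<^sup>+z. \<integral>\<^sup>+p. f (x, y, z, p l) \<partial>(\<Pi>\<^sub>M i\<in>{l}. N) \<partial>N)" for x y
      using I(2) by (subst product_nn_integral_insert_rev) auto
    have 4: "(\<integral>\<^sup>+p. f (x, y, z, p l) \<partial>(\<Pi>\<^sub>M i\<in>{l}. N)) = (\<integral>\<^sup>+w. f (x, y, z, w) \<partial>N)" for x y z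
      by (subst product_nn_integral_singleton[symmetric]) simp_all
    show ?thesis by (simp only: 1 2 3 4)
  qed
  finally show ?thesis .
qed

section \<open>Edge probability and general position\<close>

context beta_law
begin

text \<open>A positive product means that both signs are positive or both negative; each of these
  events is a product of two half-space events.\<close>

lemma nn_integral_same_side:
  assumes w: "cross3 u (y - x) \<noteq> 0"
  defines "h \<equiv> \<bar>u \<bullet> cross3 y x\<bar> / norm (cross3 u (y - x))"
  shows "(\<integral>\<^sup>+z. \<integral>\<^sup>+z'. indicator {p. 0 < p} (orient u x y z * orient u x y z') \<partial>B \<partial>B) =
    (cap (b + 1) h)\<^sup>2 + (cap (b + 1) (- h))\<^sup>2"
proof -
  let ?d = "u \<bullet> cross3 y x" and ?w = "cross3 u (y - x)"
  let ?P = "\<lambda>z. indicator {p. 0 < p} (orient u x y z) :: ennreal"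
  let ?N = "\<lambda>z. indicator {p. p < 0} (orient u x y z) :: ennreal"
  have P: "(\<integral>\<^sup>+z. ?P z \<partial>B) = cap (b + 1) (- ?d / norm ?w)"
  proof -
    have "(\<integral>\<^sup>+z. ?P z \<partial>B) = (\<integral>\<^sup>+z. indicator {z. ?d < z \<bullet> ?w} z \<partial>B)"
      by (intro nn_integral_cong) (simp add: orient_eq_inner indicator_def)
    also have "\<dots> = emeasure B {z. ?d < z \<bullet> ?w}" by simp
    finally show ?thesis using emeasure_halfspace(2)[OF w] by simp
  qed
  have N: "(\<integral>\<^sup>+z. ?N z \<partial>B) = cap (b + 1) (?d / norm ?w)"
  proof -
    have "(\<integral>\<^sup>+z. ?N z \<partial>B) = (\<integral>\<^sup>+z. indicator {z. z \<bullet> ?w < ?d} z \<partial>B)"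
      by (intro nn_integral_cong) (simp add: orient_eq_inner indicator_def)
    also have "\<dots> = emeasure B {z. z \<bullet> ?w < ?d}" by simp
    finally show ?thesis using emeasure_halfspace(1)[OF w] by simp
  qed
  have "(\<integral>\<^sup>+z. \<integral>\<^sup>+z'. indicator {p. 0 < p} (orient u x y z * orient u x y z') \<partial>B \<partial>B)
    = (\<integral>\<^sup>+z. \<integral>\<^sup>+z'. ?P z * ?P z' + ?N z * ?N z' \<partial>B \<partial>B)"
    by (intro nn_integral_cong) (auto simp: indicator_def zero_less_mult_iff)
  also have "\<dots> = (\<integral>\<^sup>+z. ?P z \<partial>B) * (\<integral>\<^sup>+z. ?P z \<partial>B) + (\<integral>\<^sup>+z. ?N z \<partial>B) * (\<integral>\<^sup>+z. ?N z \<partial>B)"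
    by (simp add: nn_integral_add nn_integral_cmult nn_integral_multc)
  also have "\<dots> = (cap (b + 1) h)\<^sup>2 + (cap (b + 1) (- h))\<^sup>2"
    \<comment> \<open>A negative \<open>?d\<close> merely exchanges the two squares, so the absolute
      value in \<open>h\<close> is harmless.\<close>
    unfolding P N h_def power2_eq_square by (cases "0 \<le> ?d") (simp_all add: add.commute)
  finally show ?thesis .
qed

lemma nn_integral_edge_axis:
  "(\<integral>\<^sup>+x. \<integral>\<^sup>+y. \<integral>\<^sup>+z. \<integral>\<^sup>+z'. indicator {p. 0 < p} (orient (axis 3 1) x y z * orient (axis 3 1) x y z') \<partial>B \<partial>B \<partial>B \<partial>B)
    = edge_prob b"
proof -
  let ?g = "\<lambda>h. (cap (b + 1) h)\<^sup>2 + (cap (b + 1) (- h))\<^sup>2"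
  have "(\<integral>\<^sup>+x. \<integral>\<^sup>+y. \<integral>\<^sup>+z. \<integral>\<^sup>+z'. indicator {p. 0 < p} (orient (axis 3 1) x y z * orient (axis 3 1) x y z') \<partial>B \<partial>B \<partial>B \<partial>B)
    = (\<integral>\<^sup>+x. \<integral>\<^sup>+y. ?g (line_dist (x$1) (x$2) (y$1) (y$2)) \<partial>B \<partial>B)"
  proof (rule nn_integral_cong, rule nn_integral_cong_AE, rule AE_mp[OF AE_cross_axis_3], rule AE_I2, rule impI)
    fix x y :: "real^3" assume "cross3 (axis 3 1) (y - x) \<noteq> 0"
    then show "(\<integral>\<^sup>+z. \<integral>\<^sup>+z'. indicator {p. 0 < p} (orient (axis 3 1) x y z * orient (axis 3 1) x y z') \<partial>B \<partial>B)
      = ?g (line_dist (x$1) (x$2) (y$1) (y$2))"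
      unfolding line_dist_eq by (rule nn_integral_same_side)
  qed
  also have "\<dots> = edge_prob b"
    unfolding edge_prob_def by (rule nn_integral_line_dist) simp
  finally show ?thesis .
qed

lemma nn_integral_edge:
  assumes "norm u = 1"
  shows "(\<integral>\<^sup>+x. \<integral>\<^sup>+y. \<integral>\<^sup>+z. \<integral>\<^sup>+z'. indicator {p. 0 < p} (orient u x y z * orient u x y z') \<partial>B \<partial>B \<partial>B \<partial>B)
    = edge_prob b"
proof -
  have "2 \<le> CARD(3)" "norm (axis 3 1 :: real^3) = 1" by simp_all
  then obtain T :: "real^3 \<Rightarrow> real^3"
    where T: "orthogonal_transformation T" "det (matrix T) = 1" "T (axis 3 1) = u"
    using assms by (rule rotation_exists_1)
  let ?f = "\<lambda>x y z z'. indicator {p. 0 < p} (orient u x y z * orient u x y z') :: ennreal"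
  note inv = nn_integral_B_orthogonal[OF T(1), symmetric]
  have "(\<integral>\<^sup>+x. \<integral>\<^sup>+y. \<integral>\<^sup>+z. \<integral>\<^sup>+z'. ?f x y z z' \<partial>B \<partial>B \<partial>B \<partial>B) =
    (\<integral>\<^sup>+x. \<integral>\<^sup>+y. \<integral>\<^sup>+z. \<integral>\<^sup>+z'. ?f (T x) y z z' \<partial>B \<partial>B \<partial>B \<partial>B)"
    by (rule inv) simp
  also have "\<dots> = (\<integral>\<^sup>+x. \<integral>\<^sup>+y. \<integral>\<^sup>+z. \<integral>\<^sup>+z'. ?f (T x) (T y) z z' \<partial>B \<partial>B \<partial>B \<partial>B)"
    by (rule nn_integral_cong, rule inv) simp
  also have "\<dots> = (\<integral>\<^sup>+x. \<integral>\<^sup>+y. \<integral>\<^sup>+z. \<integral>\<^sup>+z'. ?f (T x) (T y) (T z) z' \<partial>B \<partial>B \<partial>B \<partial>B)"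
    by (rule nn_integral_cong, rule nn_integral_cong, rule inv) simp
  also have "\<dots> = (\<integral>\<^sup>+x. \<integral>\<^sup>+y. \<integral>\<^sup>+z. \<integral>\<^sup>+z'. ?f (T x) (T y) (T z) (T z') \<partial>B \<partial>B \<partial>B \<partial>B)"
    by (rule nn_integral_cong, rule nn_integral_cong, rule nn_integral_cong, rule inv) simp
  also have "\<dots> = edge_prob b"
    unfolding T(3)[symmetric] orient_orthogonal[OF T(1,2)] by (rule nn_integral_edge_axis)
  finally show ?thesis .
qed

text \<open>The vector \<open>?p\<close> is orthogonal to \<open>u\<close>. If \<open>x\<close> and
  \<open>y\<close> differ in direction \<open>?p\<close>, then \<open>y - x\<close> is not parallel
  to \<open>u\<close>, and a vanishing orientation confines \<open>z\<close> to a plane of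
  probability zero.\<close>

lemma AE_orient:
  assumes "norm u = 1"
  shows "AE x in B. AE y in B. AE z in B. orient u x y z \<noteq> 0"
proof -
  have "2 \<le> CARD(3)" "norm (axis 3 1 :: real^3) = 1" by simp_all
  then obtain T :: "real^3 \<Rightarrow> real^3"
    where T: "orthogonal_transformation T" "det (matrix T) = 1" "T (axis 3 1) = u"
    using assms by (rule rotation_exists_1)
  have u: "u \<noteq> 0" using assms by auto
  let ?p = "T (axis 1 1)"
  have "norm ?p = 1" using orthogonal_transformation_norm[OF T(1), of "axis 1 1"] by simp
  then have p: "?p \<noteq> 0" by auto
  have pu: "?p \<bullet> u = 0"
  proof -
    have "?p \<bullet> u = axis 1 1 \<bullet> (axis 3 1 :: real^3)"
      using T(1) unfolding T(3)[symmetric] by (simp add: orthogonal_transformation_def)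
    then show ?thesis by (simp add: inner_axis_axis)
  qed
  have *: "AE z in B. orient u x y z \<noteq> 0" if "y \<bullet> ?p \<noteq> x \<bullet> ?p" for x y
  proof -
    have "cross3 u (y - x) \<noteq> 0"
    proof
      assume "cross3 u (y - x) = 0"
      then have "cross3 (cross3 u (y - x)) u \<bullet> ?p = 0" by simp
      \<comment> \<open>Up to scale this is the part of \<open>y - x\<close> orthogonal to
        \<open>u\<close>; pairing with \<open>?p\<close> removes the second term.\<close>
      moreover have "cross3 (cross3 u (y - x)) u = (u \<bullet> u) *\<^sub>R (y - x) - (u \<bullet> (y - x)) *\<^sub>R u"
        by (simp add: cross3_simps forall_3)
      ultimately have "(u \<bullet> u) * ((y - x) \<bullet> ?p) = 0"
        using pu by (simp add: inner_diff_left inner_diff_right inner_commute)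
      then show False using u that by (simp add: inner_diff_left)
    qed
    from AE_not_hyperplane[OF this, of "u \<bullet> cross3 y x"] show ?thesis
      by (simp add: orient_eq_inner)
  qed
  have "AE y in B. AE z in B. orient u x y z \<noteq> 0" for x
    by (rule eventually_mono[OF AE_not_hyperplane[OF p, of "x \<bullet> ?p"]]) (rule *)
  then show ?thesis by simp
qed

text \<open>A nonzero orientation in one fixed direction already makes \<open>y - x\<close> and
  \<open>z - x\<close> independent, and \<open>w\<close> then only has to avoid the plane they span
  through \<open>x\<close>.\<close>

lemma AE_volume:
  "AE x in B. AE y in B. AE z in B. AE w in B. (w - x) \<bullet> cross3 (y - x) (z - x) \<noteq> 0"
proof -
  have *: "AE w in B. (w - x) \<bullet> cross3 (y - x) (z - x) \<noteq> 0" if "orient (axis 3 1) x y z \<noteq> 0" for x y z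
  proof -
    have "cross3 (y - x) (z - x) \<noteq> 0" using that by (auto simp: orient_def)
    from AE_not_hyperplane[OF this, of "x \<bullet> cross3 (y - x) (z - x)"] show ?thesis
      by (simp add: inner_diff_left)
  qed
  have "norm (axis 3 1 :: real^3) = 1" by simp
  from AE_orient[OF this] show ?thesis
  proof (rule eventually_mono)
    fix x assume "AE y in B. AE z in B. orient (axis 3 1) x y z \<noteq> 0"
    then show "AE y in B. AE z in B. AE w in B. (w - x) \<bullet> cross3 (y - x) (z - x) \<noteq> 0"
    proof (rule eventually_mono)
      fix y assume "AE z in B. orient (axis 3 1) x y z \<noteq> 0"
      then show "AE z in B. AE w in B. (w - x) \<bullet> cross3 (y - x) (z - x) \<noteq> 0"
        by (rule eventually_mono) (rule *)
    qed
  qed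
qed

end

subsection \<open>Solid angles of a tetrahedron\<close>

definition volume6 :: "real^3 \<Rightarrow> real^3 \<Rightarrow> real^3 \<Rightarrow> real^3 \<Rightarrow> real" where
  "volume6 p a b c = (a - p) \<bullet> cross3 (b - p) (c - p)"

text \<open>By Cramer's rule the coordinates of \<open>u\<close> in the basis \<open>a - p\<close>,
  \<open>b - p\<close>, \<open>c - p\<close> are the three orientations divided by
  \<open>volume6\<close>. Multiplying instead keeps their signs and gives a polynomial condition,
  measurable at sight.\<close>

definition in_cone :: "real^3 \<Rightarrow> real^3 \<Rightarrow> real^3 \<Rightarrow> real^3 \<Rightarrow> real^3 \<Rightarrow> bool" where
  "in_cone p a b c u \<longleftrightarrow> 0 \<le> volume6 p a b c * orient u p b c \<and>
    0 \<le> volume6 p a b c * orient u p c a \<and> 0 \<le> volume6 p a b c * orient u p a b"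

lemma volume6_measurable [measurable (raw)]:
  assumes [measurable]: "f \<in> borel_measurable M" "g \<in> borel_measurable M"
    "h \<in> borel_measurable M" "k \<in> borel_measurable M"
  shows "(\<lambda>p. volume6 (f p) (g p) (h p) (k p)) \<in> borel_measurable M"
  unfolding volume6_def by (intro triple_product_measurable) measurable

lemma volume6_swap:
  "volume6 a p b c = - volume6 p a b c" "volume6 b p a c = volume6 p a b c" "volume6 c p a b = - volume6 p a b c"
  by (simp_all add: volume6_def cross3_simps)

lemma cramer_cross3:
  "(a \<bullet> cross3 b c) *\<^sub>R u = (u \<bullet> cross3 b c) *\<^sub>R a + (u \<bullet> cross3 c a) *\<^sub>R b + (u \<bullet> cross3 a b) *\<^sub>R c"
  by (simp add: cross3_simps forall_3)

text \<open>Pairing with the cross product of two edge vectors removes those two. The factor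
  \<open>e\<close> allows two uses: a positive step length towards a point of the hull, and 0 for an
  affine relation among the vertices.\<close>

lemma volume6_combination:
  assumes "e *\<^sub>R u = \<alpha> *\<^sub>R (a - p) + \<beta> *\<^sub>R (b - p) + \<gamma> *\<^sub>R (c - p)"
  shows "e * orient u p b c = \<alpha> * volume6 p a b c" "e * orient u p c a = \<beta> * volume6 p a b c"
    "e * orient u p a b = \<gamma> * volume6 p a b c"
proof -
  have *: "e * (u \<bullet> w) = (\<alpha> *\<^sub>R (a - p) + \<beta> *\<^sub>R (b - p) + \<gamma> *\<^sub>R (c - p)) \<bullet> w" for w
    using assms by (metis inner_scaleR_left)
  have v: "(a - p) \<bullet> cross3 (b - p) (c - p) = volume6 p a b c" "(b - p) \<bullet> cross3 (c - p) (a - p) = volume6 p a b c" "(c - p) \<bullet> cross3 (a - p) (b - p) = volume6 p a b c"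
    by (simp_all add: volume6_def cross3_simps)
  show "e * orient u p b c = \<alpha> * volume6 p a b c" "e * orient u p c a = \<beta> * volume6 p a b c"
    "e * orient u p a b = \<gamma> * volume6 p a b c"
    unfolding orient_def * by (simp_all add: inner_add_left dot_cross_self v)
qed

lemma in_cone_iff:
  assumes D: "volume6 p a b c \<noteq> 0"
  shows "(\<exists>\<epsilon>>0. p + \<epsilon> *\<^sub>R u \<in> convex hull {p, a, b, c}) \<longleftrightarrow> in_cone p a b c u"
proof
  let ?D = "volume6 p a b c"
  assume "\<exists>\<epsilon>>0. p + \<epsilon> *\<^sub>R u \<in> convex hull {p, a, b, c}"
  then obtain e s t y where e: "0 < e" "0 \<le> s" "0 \<le> t" "s + t = 1" "y \<in> convex hull {a, b, c}"
      "p + e *\<^sub>R u = s *\<^sub>R p + t *\<^sub>R y"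
    unfolding convex_hull_insert[OF insert_not_empty, of p a "{b, c}"] by blast
  from e(5) obtain \<alpha> \<beta> \<gamma> where y: "0 \<le> \<alpha>" "0 \<le> \<beta>" "0 \<le> \<gamma>" "\<alpha> + \<beta> + \<gamma> = 1"
      "y = \<alpha> *\<^sub>R a + \<beta> *\<^sub>R b + \<gamma> *\<^sub>R c"
    unfolding convex_hull_3 by auto
  have s: "s = 1 - t" and \<gamma>: "\<gamma> = 1 - \<alpha> - \<beta>" using e(4) y(4) by simp_all
  have "e *\<^sub>R u = s *\<^sub>R p + t *\<^sub>R y - p" using e(6) by (simp add: algebra_simps)
  also have "\<dots> = (t * \<alpha>) *\<^sub>R (a - p) + (t * \<beta>) *\<^sub>R (b - p) + (t * \<gamma>) *\<^sub>R (c - p)"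
    unfolding y(5) s \<gamma> by (simp add: algebra_simps)
  finally have *: "e *\<^sub>R u = \<dots>" .
  have nonneg: "0 \<le> ?D * o'" if "e * o' = r * ?D" "0 \<le> r" for o' r
  proof -
    have "e * (?D * o') = r * ?D\<^sup>2" using that(1) by (simp add: power2_eq_square algebra_simps)
    then have "0 \<le> e * (?D * o')" using that(2) by simp
    then show ?thesis using e(1) by (simp add: zero_le_mult_iff)
  qed
  show "in_cone p a b c u"
    unfolding in_cone_def
    by (intro conjI nonneg[OF volume6_combination(1)[OF *]] nonneg[OF volume6_combination(2)[OF *]]
        nonneg[OF volume6_combination(3)[OF *]] mult_nonneg_nonneg e y)
next
  let ?D = "volume6 p a b c"
  define \<alpha> \<beta> \<gamma> where "\<alpha> = orient u p b c / ?D" and "\<beta> = orient u p c a / ?D" and "\<gamma> = orient u p a b / ?D"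
  assume "in_cone p a b c u"
  then have nn: "0 \<le> \<alpha>" "0 \<le> \<beta>" "0 \<le> \<gamma>"
    by (auto simp: in_cone_def \<alpha>_def \<beta>_def \<gamma>_def zero_le_mult_iff zero_le_divide_iff)
  have "u = (1 / ?D) *\<^sub>R (?D *\<^sub>R u)" using D by simp
  also have "\<dots> = \<alpha> *\<^sub>R (a - p) + \<beta> *\<^sub>R (b - p) + \<gamma> *\<^sub>R (c - p)"
    unfolding volume6_def cramer_cross3[of "a - p"]
    by (simp add: \<alpha>_def \<beta>_def \<gamma>_def orient_def volume6_def scaleR_add_right)
  finally have u: "u = \<alpha> *\<^sub>R (a - p) + \<beta> *\<^sub>R (b - p) + \<gamma> *\<^sub>R (c - p)" .
  define s where "s = \<alpha> + \<beta> + \<gamma>"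
  show "\<exists>\<epsilon>>0. p + \<epsilon> *\<^sub>R u \<in> convex hull {p, a, b, c}"
  proof (cases "s = 0")
    \<comment> \<open>All coordinates vanish, so \<open>u\<close> is the zero vector; any step
      length stays at the vertex.\<close>
    case True
    then have "\<alpha> = 0" "\<beta> = 0" "\<gamma> = 0" using nn by (auto simp: s_def)
    then have "p + 1 *\<^sub>R u \<in> convex hull {p, a, b, c}" using u by (simp add: hull_inc)
    then show ?thesis by (intro exI[of _ 1]) simp
  next
    case False
    then have s: "0 < s" using nn by (auto simp: s_def)
    \<comment> \<open>A step of length 1 / s makes the three coordinates sum to 1 and so ends on the
      face opposite \<open>p\<close>.\<close>
    have "p + (1 / s) *\<^sub>R u = (1 / s) *\<^sub>R (s *\<^sub>R p + u)" using s by (simp add: scaleR_add_right)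
    also have "s *\<^sub>R p + u = \<alpha> *\<^sub>R a + \<beta> *\<^sub>R b + \<gamma> *\<^sub>R c"
      unfolding u s_def by (simp add: algebra_simps)
    finally have "p + (1 / s) *\<^sub>R u = (\<alpha> / s) *\<^sub>R a + (\<beta> / s) *\<^sub>R b + (\<gamma> / s) *\<^sub>R c"
      by (simp add: scaleR_add_right)
    moreover have "\<alpha> / s + \<beta> / s + \<gamma> / s = 1" using s by (simp add: s_def flip: add_divide_distrib)
    ultimately have "p + (1 / s) *\<^sub>R u \<in> convex hull {a, b, c}"
      unfolding convex_hull_3 using nn s by (intro CollectI exI[of _ "\<alpha> / s"] exI[of _ "\<beta> / s"] exI[of _ "\<gamma> / s"]) simp
    moreover have "convex hull {a, b, c} \<subseteq> convex hull {p, a, b, c}" by (intro hull_mono) auto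
    ultimately show ?thesis using s by (intro exI[of _ "1 / s"]) auto
  qed
qed

lemma vertex_notin_hull:
  assumes D: "volume6 p a b c \<noteq> 0"
  shows "p \<notin> convex hull {a, b, c}"
proof
  assume "p \<in> convex hull {a, b, c}"
  then obtain \<alpha> \<beta> \<gamma> where y: "\<alpha> + \<beta> + \<gamma> = 1" "p = \<alpha> *\<^sub>R a + \<beta> *\<^sub>R b + \<gamma> *\<^sub>R c"
    unfolding convex_hull_3 by auto
  \<comment> \<open>The left-hand side has the shape of \<open>volume6_combination\<close> with
    \<open>e = 0\<close>; all coefficients then vanish, against their sum 1.\<close>
  have "0 *\<^sub>R (0 :: real^3) = p - (\<alpha> + \<beta> + \<gamma>) *\<^sub>R p" by (simp add: y(1))
  also have "\<dots> = \<alpha> *\<^sub>R (a - p) + \<beta> *\<^sub>R (b - p) + \<gamma> *\<^sub>R (c - p)"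
    by (subst (1) y(2)) (simp add: algebra_simps)
  finally have *: "0 *\<^sub>R (0 :: real^3) = \<dots>" .
  have "\<alpha> = 0" "\<beta> = 0" "\<gamma> = 0"
    using volume6_combination[OF *] D by simp_all
  then show False using y(1) by simp
qed

lemma simplex_extreme_points:
  assumes D: "volume6 p a b c \<noteq> 0"
  shows "distinct [p, a, b, c]" and "{x. x extreme_point_of convex hull {p, a, b, c}} = {p, a, b, c}"
proof -
  show d: "distinct [p, a, b, c]"
    using D by (auto simp: volume6_def dot_cross_self)
  have vp: "volume6 a p b c \<noteq> 0" "volume6 b p a c \<noteq> 0" "volume6 c p a b \<noteq> 0"
    using D by (simp_all add: volume6_swap(1)[of a p b c] volume6_swap(2)[of b p a c] volume6_swap(3)[of c p a b])
  have rest: "{p, a, b, c} - {p} = {a, b, c}" "{p, a, b, c} - {a} = {p, b, c}"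
      "{p, a, b, c} - {b} = {p, a, c}" "{p, a, b, c} - {c} = {p, a, b}"
    using d by auto
  have "x \<notin> convex hull ({p, a, b, c} - {x})" if x: "x \<in> {p, a, b, c}" for x
  proof -
    from x consider "x = p" | "x = a" | "x = b" | "x = c" by blast
    then show ?thesis
    proof cases
      case 1 then show ?thesis by (simp only: rest vertex_notin_hull[OF D] not_False_eq_True)
    next
      case 2 then show ?thesis by (simp only: rest vertex_notin_hull[OF vp(1)] not_False_eq_True)
    next
      case 3 then show ?thesis by (simp only: rest vertex_notin_hull[OF vp(2)] not_False_eq_True)
    next
      case 4 then show ?thesis by (simp only: rest vertex_notin_hull[OF vp(3)] not_False_eq_True)
    qed
  qed
  then show "{x. x extreme_point_of convex hull {p, a, b, c}} = {p, a, b, c}"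
    using extreme_point_of_convex_hull_convex_independent[of "{p, a, b, c}"]
    by (auto simp: finite_imp_compact)
qed

text \<open>Rescaling does not affect membership in a hyperplane through the origin, so the radial
  projection of the ball reduces the claim to a Lebesgue null set.\<close>

lemma uniform_sphere_hyperplane:
  fixes v :: "'a::euclidean_space"
  assumes "v \<noteq> 0"
  shows "emeasure uniform_sphere {u. v \<bullet> u = 0} = 0"
proof -
  have "{x. v \<bullet> x = 0} \<in> null_sets lborel"
    using negligible_hyperplane[of v 0] assms
    by (simp add: negligible_iff_null_sets null_sets_completion_iff)
  then have "AE x in lborel. v \<bullet> x \<noteq> 0" by (auto dest: AE_not_in)
  then have "AE x in uniform_measure lborel (cball 0 1). \<not> (v \<bullet> (x /\<^sub>R norm x) = 0)"
    using emeasure_unit_cball[where 'a='a]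
    by (subst AE_uniform_measure) (auto simp: less_top elim!: eventually_mono)
  then have "AE u in uniform_sphere. \<not> (v \<bullet> u = 0)"
    unfolding uniform_sphere_def by (subst AE_distr_iff) auto
  then show ?thesis
    by (subst emeasure_eq_0_AE[symmetric]) (auto simp: uniform_sphere_def)
qed

lemma solid_angle_in_hyperplane:
  assumes v: "v \<noteq> 0" and P: "\<And>x. x \<in> P \<Longrightarrow> v \<bullet> x = d" and x: "x \<in> P"
  shows "solid_angle x P = 0"
proof -
  let ?S = "{u. \<exists>\<epsilon>>0. x + \<epsilon> *\<^sub>R u \<in> P}"
  have sub: "?S \<subseteq> {u. v \<bullet> u = 0}"
  proof
    fix u assume "u \<in> ?S"
    then obtain e where e: "0 < e" "x + e *\<^sub>R u \<in> P" by auto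
    then have "e * (v \<bullet> u) = 0" using P[OF e(2)] P[OF x] by (simp add: inner_add_right)
    then show "u \<in> {u. v \<bullet> u = 0}" using e(1) by simp
  qed
  show ?thesis
  \<comment> \<open>A set outside the sigma-algebra has \<open>measure\<close> 0 by convention, so
    measurability of \<open>?S\<close> need not be decided.\<close>
  proof (cases "?S \<in> sets uniform_sphere")
    case True
    have "emeasure uniform_sphere ?S \<le> emeasure uniform_sphere {u. v \<bullet> u = 0}"
      using sub by (intro emeasure_mono) (simp_all add: uniform_sphere_def)
    then show ?thesis by (simp add: solid_angle_def measure_def uniform_sphere_hyperplane[OF v])
  qed (simp add: solid_angle_def measure_notin_sets)
qed

text \<open>A vector in the kernel of the singular matrix of edge vectors is normal to a plane that
  contains the hull. The definite value 0 later gives measurability of the angle sum on the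
  degenerate event.\<close>

lemma vertex_angle_sum_degenerate:
  assumes D: "volume6 p a b c = 0"
  shows "vertex_angle_sum (convex hull {p, a, b, c}) = 0"
proof -
  let ?A = "vector [a - p, b - p, c - p] :: real^3^3"
  have "det ?A = 0" using D by (simp add: volume6_def dot_cross_det)
  then obtain v where v: "v \<noteq> 0" "?A *v v = 0"
    using invertible_det_nz[of ?A] invertible_left_inverse[of ?A] matrix_left_invertible_ker[of ?A] by blast
  have "(a - p) \<bullet> v = 0" "(b - p) \<bullet> v = 0" "(c - p) \<bullet> v = 0"
    using arg_cong[OF v(2), of "\<lambda>x. x$1"] arg_cong[OF v(2), of "\<lambda>x. x$2"] arg_cong[OF v(2), of "\<lambda>x. x$3"]
    by (simp_all add: matrix_vector_mul_component)
  then have "{p, a, b, c} \<subseteq> {x. v \<bullet> x = v \<bullet> p}"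
    by (auto simp: inner_diff_left inner_diff_right inner_commute)
  then have hull: "convex hull {p, a, b, c} \<subseteq> {x. v \<bullet> x = v \<bullet> p}"
    by (rule hull_minimal) (rule convex_hyperplane)
  show ?thesis
    unfolding vertex_angle_sum_def
  proof (rule sum.neutral, rule ballI)
    fix x assume "x \<in> {x. x extreme_point_of convex hull {p, a, b, c}}"
    then have "x \<in> convex hull {p, a, b, c}" by (simp add: extreme_point_of_def)
    then show "solid_angle x (convex hull {p, a, b, c}) = 0"
      using hull by (intro solid_angle_in_hyperplane[OF v(1)]) auto
  qed
qed

lemma vertex_angle_sum_simplex:
  assumes D: "volume6 p a b c \<noteq> 0"
  shows "vertex_angle_sum (convex hull {p, a, b, c}) =
    measure uniform_sphere {u. in_cone p a b c u} + measure uniform_sphere {u. in_cone a p b c u} +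
    measure uniform_sphere {u. in_cone b p a c u} + measure uniform_sphere {u. in_cone c p a b u}"
proof -
  have vp: "volume6 a p b c \<noteq> 0" "volume6 b p a c \<noteq> 0" "volume6 c p a b \<noteq> 0"
    using D by (simp_all add: volume6_swap(1)[of a p b c] volume6_swap(2)[of b p a c] volume6_swap(3)[of c p a b])
  have 1: "{a, p, b, c} = {p, a, b, c}" "{b, p, a, c} = {p, a, b, c}" "{c, p, a, b} = {p, a, b, c}"
    by auto
  have angle:
    "solid_angle p (convex hull {p, a, b, c}) = measure uniform_sphere {u. in_cone p a b c u}"
    "solid_angle a (convex hull {p, a, b, c}) = measure uniform_sphere {u. in_cone a p b c u}"
    "solid_angle b (convex hull {p, a, b, c}) = measure uniform_sphere {u. in_cone b p a c u}"
    "solid_angle c (convex hull {p, a, b, c}) = measure uniform_sphere {u. in_cone c p a b u}"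
    unfolding solid_angle_def in_cone_iff[OF D] in_cone_iff[OF vp(1), unfolded 1]
      in_cone_iff[OF vp(2), unfolded 1] in_cone_iff[OF vp(3), unfolded 1] by (rule refl)+
  show ?thesis
    unfolding vertex_angle_sum_def simplex_extreme_points(2)[OF D]
    using simplex_extreme_points(1)[OF D] by (simp add: angle add.assoc)
qed

text \<open>Four points in general position in the plane span a triangle or a quadrilateral: the number
  of points inside the triangle of the others and the number of edges of the hull add up to 4.\<close>

lemma sign_count:
  fixes a b c d :: real
  assumes "a \<noteq> 0" "b \<noteq> 0" "c \<noteq> 0" "d \<noteq> 0" "a + c = b + d"
  shows "of_bool (0 < c * - b \<and> 0 < c * a) + of_bool (0 < d * b \<and> 0 < d * - a) +
      of_bool (0 < - d * c \<and> 0 < - d * a) + of_bool (0 < d * - c \<and> 0 < d * b) +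
      (of_bool (0 < a * b) + of_bool (0 < - a * c) + of_bool (0 < b * c) +
      of_bool (0 < a * d) + of_bool (0 < - b * d) + of_bool (0 < c * d)) = (4 :: ennreal)"
proof -
  have sgn: "0 < x * y \<longleftrightarrow> (0 < x \<longleftrightarrow> 0 < y)" "0 < x * - y \<longleftrightarrow> \<not> (0 < x \<longleftrightarrow> 0 < y)"
    "0 < - x * y \<longleftrightarrow> \<not> (0 < x \<longleftrightarrow> 0 < y)"
    if "x \<noteq> 0" "y \<noteq> 0" for x y :: real
    using that by (auto simp: zero_less_mult_iff mult_less_0_iff)
  \<comment> \<open>The linear relation excludes these two sign patterns; the remaining ones are
    checked by cases.\<close>
  have "\<not> (0 < a \<and> 0 < c \<and> \<not> 0 < b \<and> \<not> 0 < d)" "\<not> (\<not> 0 < a \<and> \<not> 0 < c \<and> 0 < b \<and> 0 < d)"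
    using assms by linarith+
  then show ?thesis
    unfolding sgn(1)[OF assms(1,2)] sgn(1)[OF assms(2,3)] sgn(1)[OF assms(1,4)] sgn(1)[OF assms(3,4)]
      sgn(1)[OF assms(3,1)] sgn(1)[OF assms(4,2)] sgn(2)[OF assms(3,2)] sgn(2)[OF assms(4,1)]
      sgn(2)[OF assms(4,3)] sgn(3)[OF assms(4,3)] sgn(3)[OF assms(1,3)] sgn(3)[OF assms(2,4)]
      sgn(3)[OF assms(4,1)]
    by (cases "0 < a"; cases "0 < b"; cases "0 < c"; cases "0 < d") simp_all
qed

subsection \<open>The expected angle sum\<close>

lemma of_bool_measurable [measurable (raw)]:
  assumes [measurable]: "Measurable.pred M P"
  shows "(\<lambda>x. of_bool (P x) :: ennreal) \<in> borel_measurable M"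
  unfolding of_bool_def by measurable

lemma in_cone_measurable [measurable (raw)]:
  assumes [measurable]: "p \<in> borel_measurable M" "a \<in> borel_measurable M"
    "b \<in> borel_measurable M" "c \<in> borel_measurable M" "u \<in> borel_measurable M"
  shows "Measurable.pred M (\<lambda>x. in_cone (p x) (a x) (b x) (c x) (u x))"
  unfolding in_cone_def by measurable

text \<open>Either diagonal cuts the projected quadrilateral into two triangles, with the same total
  signed area.\<close>

lemma orient_cocycle: "orient u x y z + orient u x z w = orient u x y w + orient u y z w"
  by (simp add: orient_def cross3_simps)

lemma orient_uminus: "orient (- u) x y z = - orient u x y z"
  by (simp add: orient_def)

definition cones :: "real^3 \<Rightarrow> real^3 \<Rightarrow> real^3 \<Rightarrow> real^3 \<Rightarrow> real^3 \<Rightarrow> ennreal" where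
  "cones x y z w u = of_bool (in_cone x y z w u) + of_bool (in_cone y x z w u) +
     of_bool (in_cone z x y w u) + of_bool (in_cone w x y z u)"

text \<open>Whether \<open>x y\<close> becomes an edge of the hull of the four points when they are projected along \<open>u\<close>.\<close>

definition is_edge :: "real^3 \<Rightarrow> real^3 \<Rightarrow> real^3 \<Rightarrow> real^3 \<Rightarrow> real^3 \<Rightarrow> ennreal" where
  "is_edge u x y z w = indicator {p. 0 < p} (orient u x y z * orient u x y w)"

definition edges :: "real^3 \<Rightarrow> real^3 \<Rightarrow> real^3 \<Rightarrow> real^3 \<Rightarrow> real^3 \<Rightarrow> ennreal" where
  "edges u x y z w = is_edge u x y z w + is_edge u x z y w + is_edge u x w y z +
     is_edge u y z x w + is_edge u y w x z + is_edge u z w x y"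

lemma cones_measurable [measurable (raw)]:
  assumes [measurable]: "p \<in> borel_measurable M" "a \<in> borel_measurable M"
    "b \<in> borel_measurable M" "c \<in> borel_measurable M" "u \<in> borel_measurable M"
  shows "(\<lambda>x. cones (p x) (a x) (b x) (c x) (u x)) \<in> borel_measurable M"
  unfolding cones_def by measurable

lemma is_edge_measurable [measurable (raw)]:
  assumes [measurable]: "p \<in> borel_measurable M" "a \<in> borel_measurable M"
    "b \<in> borel_measurable M" "c \<in> borel_measurable M" "u \<in> borel_measurable M"
  shows "(\<lambda>x. is_edge (p x) (a x) (b x) (c x) (u x)) \<in> borel_measurable M"
  unfolding is_edge_def by measurable

text \<open>After projection along \<open>u\<close>, the vertex \<open>p\<close> lies inside the
  triangle of the others when its three orientations share one sign. The sign of the volume only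
  decides which of \<open>u\<close> and \<open>- u\<close> points inwards, so it disappears from the
  sum.\<close>

lemma in_cone_pair:
  assumes "volume6 p a b c \<noteq> 0" "orient u p b c \<noteq> 0" "orient u p c a \<noteq> 0" "orient u p a b \<noteq> 0"
  shows "of_bool (in_cone p a b c u) + of_bool (in_cone p a b c (- u)) =
    (of_bool (0 < orient u p b c * orient u p c a \<and> 0 < orient u p b c * orient u p a b) :: ennreal)"
proof -
  have "of_bool (0 \<le> D * \<alpha> \<and> 0 \<le> D * \<beta> \<and> 0 \<le> D * \<gamma>) + of_bool (0 \<le> D * - \<alpha> \<and> 0 \<le> D * - \<beta> \<and> 0 \<le> D * - \<gamma>) =
      (of_bool (0 < \<alpha> * \<beta> \<and> 0 < \<alpha> * \<gamma>) :: ennreal)"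
    if "D \<noteq> 0" "\<alpha> \<noteq> 0" "\<beta> \<noteq> 0" "\<gamma> \<noteq> 0" for D \<alpha> \<beta> \<gamma> :: real
    using that by (cases "0 < D"; cases "0 < \<alpha>"; cases "0 < \<beta>"; cases "0 < \<gamma>")
      (simp_all add: zero_le_mult_iff zero_less_mult_iff mult_le_0_iff)
  from this[OF assms] show ?thesis by (simp only: in_cone_def orient_uminus)
qed

lemma cones_add_edges:
  assumes V: "volume6 x y z w \<noteq> 0" and o: "orient u x y z \<noteq> 0" "orient u x y w \<noteq> 0"
    "orient u x z w \<noteq> 0" "orient u y z w \<noteq> 0"
  shows "cones x y z w u + cones x y z w (- u) + edges u x y z w = 4"
proof -
  let ?a = "orient u x y z" and ?b = "orient u x y w" and ?c = "orient u x z w" and ?d = "orient u y z w"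
  have V': "volume6 y x z w \<noteq> 0" "volume6 z x y w \<noteq> 0" "volume6 w x y z \<noteq> 0"
    using V by (simp_all add: volume6_swap(1)[of y x z w] volume6_swap(2)[of z x y w] volume6_swap(3)[of w x y z])
  \<comment> \<open>All orientations reduce to four: cyclic shifts of the three points keep the
    sign, transpositions reverse it.\<close>
  have perm: "orient u x w y = - ?b" "orient u y w x = ?b" "orient u y x z = - ?a"
    "orient u z y w = - ?d" "orient u z w x = ?c" "orient u z x y = ?a"
    "orient u w y z = ?d" "orient u w z x = - ?c" "orient u w x y = ?b"
    "orient u x z y = - ?a" "orient u x w z = - ?c" "orient u y z x = ?a" "orient u y w z = - ?d"
    "orient u z w y = ?d"
    by (simp_all add: orient_def cross3_simps)
  note cone = in_cone_pair[OF V, of u] in_cone_pair[OF V'(1), of u]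
    in_cone_pair[OF V'(2), of u] in_cone_pair[OF V'(3), of u]
  have "cones x y z w u + cones x y z w (- u) =
    (of_bool (in_cone x y z w u) + of_bool (in_cone x y z w (- u))) +
    (of_bool (in_cone y x z w u) + of_bool (in_cone y x z w (- u))) +
    (of_bool (in_cone z x y w u) + of_bool (in_cone z x y w (- u))) +
    (of_bool (in_cone w x y z u) + of_bool (in_cone w x y z (- u)))"
    by (simp only: cones_def ac_simps)
  also have "\<dots> = of_bool (0 < ?c * - ?b \<and> 0 < ?c * ?a) + of_bool (0 < ?d * ?b \<and> 0 < ?d * - ?a) +
      of_bool (0 < - ?d * ?c \<and> 0 < - ?d * ?a) + of_bool (0 < ?d * - ?c \<and> 0 < ?d * ?b)"
    using o cone by (simp only: perm neg_equal_0_iff_equal not_False_eq_True simp_thms)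
  finally have 1: "cones x y z w u + cones x y z w (- u) = \<dots>" .
  have 2: "edges u x y z w = of_bool (0 < ?a * ?b) + of_bool (0 < - ?a * ?c) + of_bool (0 < ?b * ?c) +
      of_bool (0 < ?a * ?d) + of_bool (0 < - ?b * ?d) + of_bool (0 < ?c * ?d)"
    unfolding edges_def is_edge_def perm indicator_def by simp
  show ?thesis
    unfolding 1 2 by (rule sign_count[OF o orient_cocycle])
qed

section \<open>Averaging over the direction of projection\<close>

lemma sets_uniform_sphere [simp, measurable_cong]: "sets uniform_sphere = sets borel"
  by (simp add: uniform_sphere_def)

lemma space_uniform_sphere [simp]: "space uniform_sphere = UNIV"
  by (simp add: uniform_sphere_def)

lemma nn_integral_uniform_sphere_uminus:
  assumes [measurable]: "f \<in> borel_measurable borel"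
  shows "(\<integral>\<^sup>+u. f (- u) \<partial>(uniform_sphere :: (real^3) measure)) = (\<integral>\<^sup>+u. f u \<partial>uniform_sphere)"
proof -
  have T: "orthogonal_transformation (\<lambda>u :: real^3. - u)"
    by (simp add: orthogonal_transformation_neg orthogonal_transformation_id)
  have "(\<integral>\<^sup>+u. f u \<partial>(uniform_sphere :: (real^3) measure)) = (\<integral>\<^sup>+u. f u \<partial>distr uniform_sphere borel (\<lambda>u. - u))"
    unfolding uniform_sphere_orthogonal_invariant[OF T] ..
  also have "\<dots> = (\<integral>\<^sup>+u. f (- u) \<partial>uniform_sphere)"
    by (rule nn_integral_distr) simp_all
  finally show ?thesis ..
qed

lemma vertex_angle_sum_nonneg: "0 \<le> vertex_angle_sum P"
  by (simp add: vertex_angle_sum_def solid_angle_def sum_nonneg)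

text \<open>The antipodal map preserves the uniform distribution, so each of the two summands
  contributes one angle sum.\<close>

lemma nn_integral_cones:
  assumes "volume6 x y z w \<noteq> 0"
  shows "(\<integral>\<^sup>+u. cones x y z w u + cones x y z w (- u) \<partial>uniform_sphere) =
    2 * ennreal (vertex_angle_sum (convex hull {x, y, z, w}))"
proof -
  interpret S: prob_space "uniform_sphere :: (real^3) measure" by (rule prob_space_uniform_sphere)
  have *: "ennreal (measure uniform_sphere {u. in_cone p a b c u}) = (\<integral>\<^sup>+u. of_bool (in_cone p a b c u) \<partial>uniform_sphere)" for p a b c
  proof -
    have "(\<integral>\<^sup>+u. of_bool (in_cone p a b c u) \<partial>uniform_sphere) = (\<integral>\<^sup>+u. indicator {u. in_cone p a b c u} u \<partial>uniform_sphere)"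
      by (simp add: indicator_def)
    also have "\<dots> = emeasure uniform_sphere {u. in_cone p a b c u}"
      by (rule nn_integral_indicator) simp
    finally show ?thesis by (simp add: S.emeasure_eq_measure)
  qed
  have "(\<integral>\<^sup>+u. cones x y z w u + cones x y z w (- u) \<partial>uniform_sphere) =
    (\<integral>\<^sup>+u. cones x y z w u \<partial>uniform_sphere) + (\<integral>\<^sup>+u. cones x y z w (- u) \<partial>uniform_sphere)"
    by (rule nn_integral_add) measurable
  also have "(\<integral>\<^sup>+u. cones x y z w (- u) \<partial>uniform_sphere) = (\<integral>\<^sup>+u. cones x y z w u \<partial>uniform_sphere)"
    by (rule nn_integral_uniform_sphere_uminus) measurable
  also have "(\<integral>\<^sup>+u. cones x y z w u \<partial>uniform_sphere) = ennreal (vertex_angle_sum (convex hull {x, y, z, w}))"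
    unfolding cones_def vertex_angle_sum_simplex[OF assms]
    by (simp add: nn_integral_add * ennreal_plus)
  finally show ?thesis by (simp add: mult_2)
qed

text \<open>The indicator of the exceptional event has iterated integral 0, which by independence is
  its expectation.\<close>

lemma (in prob_space) AE_indep4:
  fixes X :: "'i \<Rightarrow> 'a \<Rightarrow> 'b::second_countable_topology"
  assumes indep: "indep_vars (\<lambda>_. borel) X I"
    and distr: "\<And>i. i \<in> I \<Longrightarrow> distr M borel (X i) = N"
    and I: "I = {i, j, k, l}" "distinct [i, j, k, l]"
    and P[measurable]: "Measurable.pred (borel \<Otimes>\<^sub>M (borel \<Otimes>\<^sub>M (borel \<Otimes>\<^sub>M borel))) P"
    and AE: "AE x in N. AE y in N. AE z in N. AE w in N. P (x, y, z, w)"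
  shows "AE \<omega> in M. P (X i \<omega>, X j \<omega>, X k \<omega>, X l \<omega>)"
proof -
  have [measurable]: "X i \<in> borel_measurable M" "X j \<in> borel_measurable M"
    "X k \<in> borel_measurable M" "X l \<in> borel_measurable M"
    using indep I by (auto simp: indep_vars_def)
  have "prob_space N"
    using distr[of i] I prob_space_distr[of "X i" borel] by auto
  then interpret N: prob_space N .
  have [measurable_cong, simp]: "sets N = sets borel"
    using distr[of i] I by (metis insertI1 sets_distr)
  let ?f = "\<lambda>p. of_bool (\<not> P p) :: ennreal"
  have f[measurable]: "?f \<in> borel_measurable (borel \<Otimes>\<^sub>M (borel \<Otimes>\<^sub>M (borel \<Otimes>\<^sub>M borel)))" by measurable
  have null: "(\<integral>\<^sup>+x. h x \<partial>N) = 0" if "AE x in N. h x = 0" for h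
    using nn_integral_cong_AE[OF that] by simp
  have "(\<integral>\<^sup>+x. \<integral>\<^sup>+y. \<integral>\<^sup>+z. \<integral>\<^sup>+w. ?f (x, y, z, w) \<partial>N \<partial>N \<partial>N \<partial>N) = 0"
  proof (rule null, rule eventually_mono[OF AE], rule null, erule eventually_mono, rule null, erule eventually_mono, rule null)
    fix x y z assume "AE w in N. P (x, y, z, w)"
    then show "AE w in N. ?f (x, y, z, w) = 0" by (rule eventually_mono) simp
  qed
  then have "(\<integral>\<^sup>+\<omega>. ?f (X i \<omega>, X j \<omega>, X k \<omega>, X l \<omega>) \<partial>M) = 0"
    using nn_integral_indep4[OF indep distr I f] by simp
  then show ?thesis
    by (subst (asm) nn_integral_0_iff_AE) auto
qed

text \<open>The expectation over the points is evaluated for each fixed unit vector; exchanging the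
  two integrations turns it into an expected solid angle. The balance is a sum because a difference
  would presuppose finiteness.\<close>

lemma expected_vertex_angle_sum:
  fixes X :: "nat \<Rightarrow> 'w \<Rightarrow> real^3"
  assumes M: "prob_space M"
    and indep: "prob_space.indep_vars M (\<lambda>_. borel) X {0..3}"
    and distr: "\<And>i. i \<in> {0..3} \<Longrightarrow> distr M borel (X i) = beta_distribution b"
  defines "V \<equiv> \<lambda>\<omega>. vertex_angle_sum (convex hull {X 0 \<omega>, X 1 \<omega>, X 2 \<omega>, X 3 \<omega>})"
  shows "V \<in> borel_measurable M" and "beta_law b"
    and "2 * (\<integral>\<^sup>+\<omega>. ennreal (V \<omega>) \<partial>M) + 6 * edge_prob b = 4"
proof -
  interpret M: prob_space M by (rule M)
  have X[measurable]: "X 0 \<in> borel_measurable M" "X 1 \<in> borel_measurable M"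
    "X 2 \<in> borel_measurable M" "X 3 \<in> borel_measurable M"
    using indep by (auto simp: M.indep_vars_def)
  show "beta_law b"
    unfolding beta_law_def using M.prob_space_distr[OF X(1)] distr[of 0] by simp
  then interpret beta_law b .
  interpret S: prob_space "uniform_sphere :: (real^3) measure" by (rule prob_space_uniform_sphere)
  interpret MS: pair_sigma_finite M "uniform_sphere :: (real^3) measure" ..
  have I: "{0..3} = {i, j, k, l}" if "distinct [i, j, k, l]" "{i, j, k, l} \<subseteq> {0..3}" for i j k l :: nat
    using that by (intro card_subset_eq[symmetric]) auto
  note int4 = M.nn_integral_indep4[OF indep distr I] and ae4 = M.AE_indep4[OF indep distr I]
  \<comment> \<open>Measurability comes from this form: 0 on the degenerate event, and elsewhere an
    integral over \<open>u\<close> of a jointly measurable count.\<close>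
  have V: "V \<omega> = (if volume6 (X 0 \<omega>) (X 1 \<omega>) (X 2 \<omega>) (X 3 \<omega>) = 0 then 0 else
      enn2real ((\<integral>\<^sup>+u. cones (X 0 \<omega>) (X 1 \<omega>) (X 2 \<omega>) (X 3 \<omega>) u + cones (X 0 \<omega>) (X 1 \<omega>) (X 2 \<omega>) (X 3 \<omega>) (- u) \<partial>uniform_sphere) / 2))" for \<omega>
    unfolding V_def
    by (simp add: vertex_angle_sum_degenerate nn_integral_cones ennreal_mult_divide_eq mult.commute[of 2]
        vertex_angle_sum_nonneg)
  show mV[measurable]: "V \<in> borel_measurable M"
    unfolding V by measurable
  have vol: "AE \<omega> in M. volume6 (X 0 \<omega>) (X 1 \<omega>) (X 2 \<omega>) (X 3 \<omega>) \<noteq> 0"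
  proof -
    have "AE x in B. AE y in B. AE z in B. AE w in B. volume6 x y z w \<noteq> 0"
    proof -
      have "volume6 x y z w = (w - x) \<bullet> cross3 (y - x) (z - x)" for x y z w
        by (simp add: volume6_def cross3_simps)
      then show ?thesis using AE_volume by simp
    qed
    then show ?thesis
      using ae4[of 0 1 2 3 "\<lambda>(x, y, z, w). volume6 x y z w \<noteq> 0"] by simp
  qed
  have ori: "AE \<omega> in M. orient u (X i \<omega>) (X j \<omega>) (X k \<omega>) \<noteq> 0"
    if u: "norm u = 1" and d: "distinct [i, j, k, l]" "{i, j, k, l} \<subseteq> {0..3}" for u i j k l
    using ae4[OF asm_rl d d(1), of "\<lambda>(x, y, z, w). orient u x y z \<noteq> 0"] AE_orient[OF u] by simp
  have edge: "(\<integral>\<^sup>+\<omega>. is_edge u (X i \<omega>) (X j \<omega>) (X k \<omega>) (X l \<omega>) \<partial>M) = edge_prob b"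
    if u: "norm u = 1" and d: "distinct [i, j, k, l]" "{i, j, k, l} \<subseteq> {0..3}" for u i j k l
    using int4[OF asm_rl d d(1), of "\<lambda>(x, y, z, w). is_edge u x y z w"] nn_integral_edge[OF u]
    by (simp add: is_edge_def)
  have fixed: "(\<integral>\<^sup>+\<omega>. cones (X 0 \<omega>) (X 1 \<omega>) (X 2 \<omega>) (X 3 \<omega>) u + cones (X 0 \<omega>) (X 1 \<omega>) (X 2 \<omega>) (X 3 \<omega>) (- u) \<partial>M)
      + 6 * edge_prob b = 4" if u: "norm u = 1" for u
  proof -
    have "(\<integral>\<^sup>+\<omega>. edges u (X 0 \<omega>) (X 1 \<omega>) (X 2 \<omega>) (X 3 \<omega>) \<partial>M) = 6 * edge_prob b"
    proof -
      have six: "q + q + q + q + q + q = 6 * q" for q :: ennreal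
      proof -
        have "(6 :: ennreal) = 1 + 1 + 1 + 1 + 1 + 1" by simp
        then show ?thesis by (simp only: distrib_right mult_1)
      qed
      show ?thesis
        unfolding edges_def six[symmetric]
        by (simp add: nn_integral_add edge[OF u, of 0 1 2 3] edge[OF u, of 0 2 1 3] edge[OF u, of 0 3 1 2]
          edge[OF u, of 1 2 0 3] edge[OF u, of 1 3 0 2] edge[OF u, of 2 3 0 1] del: One_nat_def)
    qed
    moreover have "(\<integral>\<^sup>+\<omega>. (cones (X 0 \<omega>) (X 1 \<omega>) (X 2 \<omega>) (X 3 \<omega>) u + cones (X 0 \<omega>) (X 1 \<omega>) (X 2 \<omega>) (X 3 \<omega>) (- u)) +
        edges u (X 0 \<omega>) (X 1 \<omega>) (X 2 \<omega>) (X 3 \<omega>) \<partial>M) = (\<integral>\<^sup>+\<omega>. 4 \<partial>M)"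
    proof (rule nn_integral_cong_AE)
      have "AE \<omega> in M. orient u (X 0 \<omega>) (X 1 \<omega>) (X 2 \<omega>) \<noteq> 0" "AE \<omega> in M. orient u (X 0 \<omega>) (X 1 \<omega>) (X 3 \<omega>) \<noteq> 0"
        "AE \<omega> in M. orient u (X 0 \<omega>) (X 2 \<omega>) (X 3 \<omega>) \<noteq> 0" "AE \<omega> in M. orient u (X 1 \<omega>) (X 2 \<omega>) (X 3 \<omega>) \<noteq> 0"
        using ori[OF u, of 0 1 2 3] ori[OF u, of 0 1 3 2] ori[OF u, of 0 2 3 1] ori[OF u, of 1 2 3 0] by simp_all
      with vol show "AE \<omega> in M. (cones (X 0 \<omega>) (X 1 \<omega>) (X 2 \<omega>) (X 3 \<omega>) u + cones (X 0 \<omega>) (X 1 \<omega>) (X 2 \<omega>) (X 3 \<omega>) (- u)) +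
        edges u (X 0 \<omega>) (X 1 \<omega>) (X 2 \<omega>) (X 3 \<omega>) = 4"
        by eventually_elim (rule cones_add_edges)
    qed
    ultimately show ?thesis
      by (subst (asm) nn_integral_add) (simp_all add: edges_def M.emeasure_space_1 del: One_nat_def)
  qed
  have "2 * (\<integral>\<^sup>+\<omega>. ennreal (V \<omega>) \<partial>M) = (\<integral>\<^sup>+\<omega>. 2 * ennreal (V \<omega>) \<partial>M)"
    by (rule nn_integral_cmult[symmetric]) simp
  also have "\<dots> = (\<integral>\<^sup>+\<omega>. \<integral>\<^sup>+u. cones (X 0 \<omega>) (X 1 \<omega>) (X 2 \<omega>) (X 3 \<omega>) u + cones (X 0 \<omega>) (X 1 \<omega>) (X 2 \<omega>) (X 3 \<omega>) (- u) \<partial>uniform_sphere \<partial>M)"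
    by (rule nn_integral_cong_AE, rule eventually_mono[OF vol]) (simp add: V_def nn_integral_cones)
  also have "\<dots> = (\<integral>\<^sup>+u. \<integral>\<^sup>+\<omega>. cones (X 0 \<omega>) (X 1 \<omega>) (X 2 \<omega>) (X 3 \<omega>) u + cones (X 0 \<omega>) (X 1 \<omega>) (X 2 \<omega>) (X 3 \<omega>) (- u) \<partial>M \<partial>uniform_sphere)"
    by (rule MS.Fubini'[symmetric]) (simp del: One_nat_def)
  finally have "2 * (\<integral>\<^sup>+\<omega>. ennreal (V \<omega>) \<partial>M) + 6 * edge_prob b =
     (\<integral>\<^sup>+u. \<integral>\<^sup>+\<omega>. cones (X 0 \<omega>) (X 1 \<omega>) (X 2 \<omega>) (X 3 \<omega>) u + cones (X 0 \<omega>) (X 1 \<omega>) (X 2 \<omega>) (X 3 \<omega>) (- u) \<partial>M \<partial>uniform_sphere)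
     + (\<integral>\<^sup>+u. 6 * edge_prob b \<partial>(uniform_sphere :: (real^3) measure))"
    using S.emeasure_space_1 by simp
  also have "\<dots> = (\<integral>\<^sup>+u. (\<integral>\<^sup>+\<omega>. cones (X 0 \<omega>) (X 1 \<omega>) (X 2 \<omega>) (X 3 \<omega>) u + cones (X 0 \<omega>) (X 1 \<omega>) (X 2 \<omega>) (X 3 \<omega>) (- u) \<partial>M) + 6 * edge_prob b \<partial>uniform_sphere)"
    by (rule nn_integral_add[symmetric]) (simp_all del: One_nat_def)
  also have "\<dots> = (\<integral>\<^sup>+u. 4 \<partial>(uniform_sphere :: (real^3) measure))"
    \<comment> \<open>The identity \<open>fixed\<close> concerns unit vectors, and these carry
      \<open>uniform_sphere\<close>.\<close>
    by (rule nn_integral_cong_AE, rule eventually_mono[OF AE_uniform_sphere]) (simp add: fixed del: One_nat_def)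
  also have "\<dots> = 4" using S.emeasure_space_1 by simp
  finally show "2 * (\<integral>\<^sup>+\<omega>. ennreal (V \<omega>) \<partial>M) + 6 * edge_prob b = 4" .
qed

subsection \<open>Evaluation of the integral\<close>

lemma Gamma_duplication_real:
  fixes x :: real
  assumes "0 < x"
  shows "Gamma x * Gamma (x + 1/2) = 2 powr (1 - 2 * x) * sqrt pi * Gamma (2 * x)"
proof -
  have "complex_of_real x \<notin> \<int>\<^sub>\<le>\<^sub>0" "complex_of_real (x + 1/2) \<notin> \<int>\<^sub>\<le>\<^sub>0"
    using assms nonpos_Ints_nonpos[of x] nonpos_Ints_nonpos[of "x + 1/2"]
    unfolding of_real_in_nonpos_Ints_iff by auto
  then have "Gamma (complex_of_real x) * Gamma (complex_of_real x + 1/2) =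
      exp ((1 - 2 * complex_of_real x) * of_real (ln 2)) * of_real (sqrt pi) * Gamma (2 * complex_of_real x)"
    by (intro Gamma_legendre_duplication) simp_all
  also have "complex_of_real x + 1/2 = complex_of_real (x + 1/2)" by simp
  also have "2 * complex_of_real x = complex_of_real (2 * x)" by simp
  also have "exp ((1 - complex_of_real (2 * x)) * of_real (ln 2)) = complex_of_real (2 powr (1 - 2 * x))"
    by (simp add: powr_def exp_of_real[symmetric])
  finally have "complex_of_real (Gamma x * Gamma (x + 1/2)) =
      complex_of_real (2 powr (1 - 2 * x) * sqrt pi * Gamma (2 * x))"
    unfolding Gamma_complex_of_real by (simp only: of_real_mult)
  then show ?thesis by (simp only: of_real_eq_iff)
qed

text \<open>The substitution x = 2 t - 1 turns 1 - x^2 into 4 t (1 - t), which gives 2 * 4^a times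
  \<open>Beta (a + 1) (a + 1)\<close>; the duplication formula then rewrites
  \<open>Gamma (2 * a + 2)\<close>.\<close>

lemma beta_norm_eq:
  assumes "-1 < a"
  shows "beta_norm a = ennreal (sqrt pi * Gamma (a + 1) / Gamma (a + 3/2))"
proof -
  have "beta_norm a = ennreal \<bar>2\<bar> * (\<integral>\<^sup>+t. ennreal (beta_weight a (- 1 + 2 * t)) \<partial>lborel)"
    unfolding beta_norm_def by (rule nn_integral_real_affine) simp_all
  also have "(\<integral>\<^sup>+t. ennreal (beta_weight a (- 1 + 2 * t)) \<partial>lborel) =
      (\<integral>\<^sup>+t. ennreal (4 powr a) * (ennreal (t powr (a + 1 - 1) * (1 - t) powr (a + 1 - 1)) * indicator {0..1} t) \<partial>lborel)"
  proof (rule nn_integral_cong_AE, rule AE_mp[OF AE_lborel_singleton[of 0]],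
      rule AE_mp[OF AE_lborel_singleton[of 1]], rule AE_I2, intro impI)
    fix t :: real assume t: "t \<noteq> 0" "t \<noteq> 1"
    show "ennreal (beta_weight a (- 1 + 2 * t)) =
      ennreal (4 powr a) * (ennreal (t powr (a + 1 - 1) * (1 - t) powr (a + 1 - 1)) * indicator {0..1} t)"
    proof (cases "0 < t \<and> t < 1")
      case True
      have "1 - (- 1 + 2 * t)\<^sup>2 = 4 * (t * (1 - t))" by (simp add: power2_eq_square algebra_simps)
      then have "beta_weight a (- 1 + 2 * t) = 4 powr a * (t powr a * (1 - t) powr a)"
        using True by (simp add: beta_weight_def powr_mult abs_less_iff)
      then show ?thesis using True by (simp add: ennreal_mult)
    next
      case False
      then show ?thesis using t by (auto simp: beta_weight_def indicator_def abs_less_iff)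
    qed
  qed
  also have "\<dots> = ennreal (4 powr a) * (\<integral>\<^sup>+t. (ennreal (t powr (a + 1 - 1) * (1 - t) powr (a + 1 - 1)) * indicator {0..1} t) \<partial>lborel)"
    by (rule nn_integral_cmult) simp
  also have "(\<integral>\<^sup>+t. (ennreal (t powr (a + 1 - 1) * (1 - t) powr (a + 1 - 1)) * indicator {0..1} t) \<partial>lborel) = ennreal (Beta (a + 1) (a + 1))"
    using assms by (intro nn_integral_has_integral_lebesgue' has_integral_Beta_real) simp_all
  also have "ennreal \<bar>2\<bar> * (ennreal (4 powr a) * ennreal (Beta (a + 1) (a + 1))) =
      ennreal (2 * 4 powr a * Beta (a + 1) (a + 1))"
  proof -
    have "ennreal \<bar>2\<bar> * (ennreal p * ennreal q) = ennreal (2 * p * q)" if "0 \<le> p" "0 \<le> q" for p q :: real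
      using that by (simp only: ennreal_mult[symmetric] mult_nonneg_nonneg abs_ge_zero) (simp add: mult.assoc)
    moreover have "0 \<le> Beta (a + 1) (a + 1)"
      using assms by (simp add: Beta_def Gamma_real_pos less_imp_le)
    ultimately show ?thesis by simp
  qed
  also have "2 * 4 powr a * Beta (a + 1) (a + 1) = sqrt pi * Gamma (a + 1) / Gamma (a + 3/2)"
  proof -
    have pos: "0 < Gamma (a + 1)" "0 < Gamma (a + 3/2)" "0 < Gamma (2 * a + 2)"
      using assms by (auto intro!: Gamma_real_pos)
    have e: "a + 1 + 1/2 = a + 3/2" "2 * (a + 1) = 2 * a + 2" "1 - 2 * (a + 1) = - (1 + 2 * a)"
      by simp_all
    have "(4 :: real) powr a = 2 powr (2 * a)"
      by (simp add: powr_powr[symmetric])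
    then have "2 * 4 powr a = (2 :: real) powr (1 + 2 * a)"
      by (simp add: powr_add)
    then have "2 powr - (1 + 2 * a) = 1 / (2 * 4 powr a)"
      by (simp only: powr_minus inverse_eq_divide)
    then have "Gamma (a + 1) * Gamma (a + 3/2) = sqrt pi * Gamma (2 * a + 2) / (2 * 4 powr a)"
      using Gamma_duplication_real[of "a + 1"] assms unfolding e by simp
    then show ?thesis
      using pos by (simp add: Beta_def e(2) field_simps)
  qed
  finally show ?thesis .
qed

text \<open>At x = sin \<theta> the weight gives cos^(2 a), and the differential one more cosine. On
  the open interval sine is injective and cosine positive.\<close>

lemma nn_integral_beta_weight_sin:
  assumes [measurable]: "f \<in> borel_measurable borel"
  shows "(\<integral>\<^sup>+x. ennreal (beta_weight a x) * f x \<partial>lborel) =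
    (\<integral>\<^sup>+\<theta>. ennreal (cos \<theta> powr (2 * a + 1)) * f (sin \<theta>) * indicator {- pi/2<..<pi/2} \<theta> \<partial>lborel)"
proof -
  let ?S = "{- pi/2<..<pi/2}"
  have im: "sin ` ?S = {-1<..<1}"
  proof (intro equalityI subsetI)
    fix x :: real assume "x \<in> sin ` ?S"
    then obtain t where t: "- pi/2 < t" "t < pi/2" "x = sin t" by auto
    have "sin (- pi/2) < sin t" "sin t < sin (pi/2)"
      using t by (intro sin_monotone_2pi; simp)+
    then show "x \<in> {-1<..<1}" using t(3) by simp
  next
    fix x :: real assume "x \<in> {-1<..<1}"
    then show "x \<in> sin ` ?S"
      using arcsin_lt_bounded[of x] by (intro image_eqI[of _ _ "arcsin x"]) auto
  qed
  have "(\<integral>\<^sup>+x. ennreal (beta_weight a x) * f x \<partial>lborel) = (\<integral>\<^sup>+x\<in>sin ` ?S. ennreal (beta_weight a x) * f x \<partial>lborel)"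
    unfolding im by (intro nn_integral_cong) (auto simp: beta_weight_def indicator_def abs_less_iff)
  also have "\<dots> = (\<integral>\<^sup>+\<theta>\<in>?S. ennreal \<bar>cos \<theta>\<bar> * (ennreal (beta_weight a (sin \<theta>)) * f (sin \<theta>)) \<partial>lborel)"
  proof (rule nn_integral_injective_substitution)
    show "sin ` ?S \<in> sets borel" unfolding im by simp
    show "inj_on sin ?S" by (rule inj_on_inverseI[of _ arcsin]) (simp add: arcsin_sin)
  qed auto
  also have "\<dots> = (\<integral>\<^sup>+\<theta>. ennreal (cos \<theta> powr (2 * a + 1)) * f (sin \<theta>) * indicator ?S \<theta> \<partial>lborel)"
  proof (rule nn_integral_cong)
    fix \<theta> :: real
    show "ennreal \<bar>cos \<theta>\<bar> * (ennreal (beta_weight a (sin \<theta>)) * f (sin \<theta>)) * indicator ?S \<theta> =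
      ennreal (cos \<theta> powr (2 * a + 1)) * f (sin \<theta>) * indicator ?S \<theta>"
    proof (cases "\<theta> \<in> ?S")
      case True
      then have c: "0 < cos \<theta>" by (intro cos_gt_zero_pi) simp_all
      have "sin \<theta> \<in> sin ` ?S" using True by (rule imageI)
      then have "\<bar>sin \<theta>\<bar> < 1" unfolding im by (auto simp: abs_less_iff)
      moreover have "1 - (sin \<theta>)\<^sup>2 = (cos \<theta>)\<^sup>2" by (simp add: cos_squared_eq)
      moreover have "cos \<theta> * ((cos \<theta>)\<^sup>2) powr a = cos \<theta> powr (2 * a + 1)"
      proof -
        have "((cos \<theta>)\<^sup>2) powr a = cos \<theta> powr (2 * a)"
          using c by (simp add: powr_powr flip: powr_numeral)
        then show ?thesis using c by (simp add: powr_add)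
      qed
      ultimately have "\<bar>cos \<theta>\<bar> * beta_weight a (sin \<theta>) = cos \<theta> powr (2 * a + 1)"
        using c by (simp add: beta_weight_def)
      then have "ennreal \<bar>cos \<theta>\<bar> * ennreal (beta_weight a (sin \<theta>)) = ennreal (cos \<theta> powr (2 * a + 1))"
        by (simp flip: ennreal_mult)
      then show ?thesis by (simp only: mult.assoc[symmetric])
    qed simp
  qed
  finally show ?thesis .
qed

lemma nn_integral_continuous_Icc:
  fixes f :: "real \<Rightarrow> real"
  assumes "continuous_on {l..u} f" "\<And>x. x \<in> {l..u} \<Longrightarrow> 0 \<le> f x"
  shows "(\<integral>\<^sup>+x. ennreal (f x) * indicator {l<..<u} x \<partial>lborel) = ennreal (integral {l..u} f)"
proof -
  have "(\<integral>\<^sup>+x. ennreal (f x) * indicator {l<..<u} x \<partial>lborel) = (\<integral>\<^sup>+x. ennreal (f x) * indicator {l..u} x \<partial>lborel)"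
    by (rule nn_integral_cong_AE, rule AE_mp[OF AE_lborel_singleton[of l]],
      rule AE_mp[OF AE_lborel_singleton[of u]], rule AE_I2) (auto simp: indicator_def)
  also have "\<dots> = ennreal (integral {l..u} f)"
    using assms by (intro nn_integral_has_integral_lebesgue' integrable_integral integrable_continuous_real)
  finally show ?thesis .
qed

text \<open>Positivity of the exponent gives continuity at the endpoints, where the cosine
  vanishes.\<close>

lemma continuous_on_cos_powr:
  assumes "0 < c" "S \<subseteq> {- pi/2..pi/2}"
  shows "continuous_on S (\<lambda>\<theta>. cos \<theta> powr c)"
  using assms by (intro continuous_on_powr' continuous_intros) (auto intro!: cos_ge_zero)

lemma cap_sin:
  assumes a: "0 < 2 * a + 1" and \<phi>: "\<phi> \<in> {- pi/2<..<pi/2}"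
  shows "cap a (sin \<phi>) = ennreal (integral {- pi/2..\<phi>} (\<lambda>\<theta>. cos \<theta> powr (2 * a + 1))) / beta_norm a"
proof -
  have "(\<integral>\<^sup>+x. ennreal (beta_weight a x) * indicator {..<sin \<phi>} x \<partial>lborel) =
    (\<integral>\<^sup>+\<theta>. ennreal (cos \<theta> powr (2 * a + 1)) * indicator {..<sin \<phi>} (sin \<theta>) * indicator {- pi/2<..<pi/2} \<theta> \<partial>lborel)"
    by (rule nn_integral_beta_weight_sin) simp
  also have "\<dots> = (\<integral>\<^sup>+\<theta>. ennreal (cos \<theta> powr (2 * a + 1)) * indicator {- pi/2<..<\<phi>} \<theta> \<partial>lborel)"
  proof (rule nn_integral_cong)
    fix \<theta> :: real
    have "sin \<theta> < sin \<phi> \<longleftrightarrow> \<theta> < \<phi>" if "\<theta> \<in> {- pi/2<..<pi/2}"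
      using that \<phi> by (intro sin_mono_less_eq) simp_all
    then show "ennreal (cos \<theta> powr (2 * a + 1)) * indicator {..<sin \<phi>} (sin \<theta>) * indicator {- pi/2<..<pi/2} \<theta> =
      ennreal (cos \<theta> powr (2 * a + 1)) * indicator {- pi/2<..<\<phi>} \<theta>"
      using \<phi> by (auto simp: indicator_def)
  qed
  also have "\<dots> = ennreal (integral {- pi/2..\<phi>} (\<lambda>\<theta>. cos \<theta> powr (2 * a + 1)))"
    using a \<phi> by (intro nn_integral_continuous_Icc continuous_on_cos_powr) auto
  finally show ?thesis by (simp add: cap_def)
qed

lemma edge_prob_eq:
  assumes b: "-1 \<le> b"
  defines "K \<equiv> integral {- pi/2..pi/2} (\<lambda>\<phi>. cos \<phi> powr (4 * b + 6)
              * (integral {- pi/2..\<phi>} (\<lambda>\<theta>. cos \<theta> powr (2 * b + 3)))\<^sup>2)"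
  shows "3 * edge_prob b = ennreal (6 * (Gamma (b + 5/2))\<^sup>2 * Gamma (2 * b + 4)
            / (pi powr (3/2) * (Gamma (b + 2))\<^sup>2 * Gamma (2 * b + 7/2)) * K)"
    and "0 \<le> K"
proof -
  define I where "I \<phi> = integral {- pi/2..\<phi>} (\<lambda>\<theta>. cos \<theta> powr (2 * b + 3))" for \<phi>
  define J1 where "J1 = sqrt pi * Gamma (b + 2) / Gamma (b + 5/2)"
  define J2 where "J2 = sqrt pi * Gamma (2 * b + 7/2) / Gamma (2 * b + 4)"
  let ?k = "\<lambda>\<phi>. cos \<phi> powr (4 * b + 6) * (I \<phi>)\<^sup>2" and ?S = "{- pi/2<..<pi/2}"
  have Gpos: "0 < Gamma (b + 2)" "0 < Gamma (b + 5/2)" "0 < Gamma (2 * b + 7/2)" "0 < Gamma (2 * b + 4)"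
    using b by (auto intro!: Gamma_real_pos)
  then have Jpos: "0 < J1" "0 < J2" by (simp_all add: J1_def J2_def)
  have n1: "beta_norm (b + 1) = ennreal J1"
    using beta_norm_eq[of "b + 1"] b by (simp add: J1_def add.assoc)
  have n2: "beta_norm (2 * b + 5/2) = ennreal J2"
    using beta_norm_eq[of "2 * b + 5/2"] b by (simp add: J2_def add.assoc)
  \<comment> \<open>Asked for every \<phi>: where the integrand is not integrable, the integral is 0
    by convention.\<close>
  have I: "0 \<le> I \<phi>" for \<phi>
    unfolding I_def by (cases "(\<lambda>\<theta>. cos \<theta> powr (2 * b + 3)) integrable_on {- pi/2..\<phi>}")
      (auto intro: integral_nonneg simp: not_integrable_integral)
  have contI: "continuous_on {- pi/2..pi/2} I"
    unfolding I_def using b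
    by (intro indefinite_integral_continuous_1 integrable_continuous_real continuous_on_cos_powr) auto
  have cont: "continuous_on {- pi/2..pi/2} ?k"
    using b by (intro continuous_intros contI continuous_on_cos_powr) auto
  have K: "K = integral {- pi/2..pi/2} ?k" by (simp add: K_def I_def)
  show "0 \<le> K" unfolding K by (rule integral_nonneg[OF integrable_continuous_real[OF cont]]) simp
  let ?C = "\<lambda>h. ennreal (beta_weight (2 * b + 5/2) h) * (cap (b + 1) h)\<^sup>2"
  have "(\<integral>\<^sup>+h. ?C h \<partial>lborel) = (\<integral>\<^sup>+\<phi>. ennreal (cos \<phi> powr (2 * (2 * b + 5/2) + 1)) * (cap (b + 1) (sin \<phi>))\<^sup>2 * indicator ?S \<phi> \<partial>lborel)"
    by (rule nn_integral_beta_weight_sin) simp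
  also have "\<dots> = (\<integral>\<^sup>+\<phi>. ennreal (1 / J1\<^sup>2) * (ennreal (?k \<phi>) * indicator ?S \<phi>) \<partial>lborel)"
  proof (rule nn_integral_cong)
    fix \<phi> :: real
    have e: "2 * (2 * b + 5/2) + 1 = 4 * b + 6" "2 * (b + 1) + 1 = 2 * b + 3" by simp_all
    show "ennreal (cos \<phi> powr (2 * (2 * b + 5/2) + 1)) * (cap (b + 1) (sin \<phi>))\<^sup>2 * indicator ?S \<phi> =
      ennreal (1 / J1\<^sup>2) * (ennreal (?k \<phi>) * indicator ?S \<phi>)"
    proof (cases "\<phi> \<in> ?S")
      case True
      have "cap (b + 1) (sin \<phi>) = ennreal (I \<phi>) / ennreal J1"
        using cap_sin[of "b + 1" \<phi>] True b unfolding e n1 by (simp add: I_def)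
      also have "\<dots> = ennreal (I \<phi> / J1)" using I Jpos by (simp add: divide_ennreal)
      finally have "(cap (b + 1) (sin \<phi>))\<^sup>2 = ennreal ((I \<phi> / J1)\<^sup>2)"
        using I Jpos by (simp add: ennreal_power)
      also have "(I \<phi> / J1)\<^sup>2 = 1 / J1\<^sup>2 * (I \<phi>)\<^sup>2" by (simp add: power_divide)
      also have "ennreal (1 / J1\<^sup>2 * (I \<phi>)\<^sup>2) = ennreal (1 / J1\<^sup>2) * ennreal ((I \<phi>)\<^sup>2)"
        by (rule ennreal_mult) simp_all
      finally have c: "(cap (b + 1) (sin \<phi>))\<^sup>2 = ennreal (1 / J1\<^sup>2) * ennreal ((I \<phi>)\<^sup>2)" .
      show ?thesis unfolding e c by (simp add: ennreal_mult mult_ac)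
    qed simp
  qed
  also have "\<dots> = ennreal (1 / J1\<^sup>2) * (\<integral>\<^sup>+\<phi>. ennreal (?k \<phi>) * indicator ?S \<phi> \<partial>lborel)"
  proof (rule nn_integral_cmult)
    have "(\<lambda>\<phi>. indicator ?S \<phi> *\<^sub>R ?k \<phi>) \<in> borel_measurable borel"
      by (rule borel_measurable_continuous_on_indicator) (auto intro: continuous_on_subset[OF cont])
    then have "(\<lambda>\<phi>. ennreal (indicator ?S \<phi> *\<^sub>R ?k \<phi>)) \<in> borel_measurable lborel" by simp
    also have "(\<lambda>\<phi>. ennreal (indicator ?S \<phi> *\<^sub>R ?k \<phi>)) = (\<lambda>\<phi>. ennreal (?k \<phi>) * indicator ?S \<phi>)"
      by (auto simp: indicator_def)
    finally show "(\<lambda>\<phi>. ennreal (?k \<phi>) * indicator ?S \<phi>) \<in> borel_measurable lborel" .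
  qed
  also have "(\<integral>\<^sup>+\<phi>. ennreal (?k \<phi>) * indicator ?S \<phi> \<partial>lborel) = ennreal K"
    unfolding K by (rule nn_integral_continuous_Icc[OF cont]) simp
  finally have C: "(\<integral>\<^sup>+h. ?C h \<partial>lborel) = ennreal (1 / J1\<^sup>2) * ennreal K" .
  \<comment> \<open>The reflection h -> -h keeps the even weight and turns one squared cap into the
    other, so both contribute equally; this is the factor 2 below.\<close>
  have refl: "(\<integral>\<^sup>+h. ennreal (beta_weight (2 * b + 5/2) h) * (cap (b + 1) (- h))\<^sup>2 \<partial>lborel) = (\<integral>\<^sup>+h. ?C h \<partial>lborel)"
  proof -
    have "beta_weight a (- h) = beta_weight a h" for a h by (simp add: beta_weight_def)
    then show ?thesis using nn_integral_real_affine[of ?C "-1" 0] by simp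
  qed
  have "(\<integral>\<^sup>+h. ennreal (beta_weight (2 * b + 5/2) h) * ((cap (b + 1) \<bar>h\<bar>)\<^sup>2 + (cap (b + 1) (- \<bar>h\<bar>))\<^sup>2) \<partial>lborel) =
    (\<integral>\<^sup>+h. ?C h + ennreal (beta_weight (2 * b + 5/2) h) * (cap (b + 1) (- h))\<^sup>2 \<partial>lborel)"
    by (intro nn_integral_cong) (auto simp: abs_if distrib_left add.commute)
  also have "\<dots> = ennreal (1 / J1\<^sup>2) * ennreal K + ennreal (1 / J1\<^sup>2) * ennreal K"
    by (subst nn_integral_add) (simp_all add: refl C)
  also have "\<dots> = ennreal (2 * (1 / J1\<^sup>2 * K))"
    using \<open>0 \<le> K\<close> by (simp add: ennreal_mult[symmetric] ennreal_plus[symmetric] del: ennreal_plus)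
  finally have "edge_prob b = ennreal (2 * (1 / J1\<^sup>2 * K) / J2)"
    unfolding edge_prob_def n2 using Jpos \<open>0 \<le> K\<close> by (simp add: divide_ennreal)
  then have "3 * edge_prob b = ennreal (3 * (2 * (1 / J1\<^sup>2 * K) / J2))"
    using Jpos \<open>0 \<le> K\<close> by (subst ennreal_mult) simp_all
  also have "3 * (2 * (1 / J1\<^sup>2 * K) / J2) = 6 * (Gamma (b + 5/2))\<^sup>2 * Gamma (2 * b + 4)
            / (pi powr (3/2) * (Gamma (b + 2))\<^sup>2 * Gamma (2 * b + 7/2)) * K"
  proof -
    \<comment> \<open>The square of \<open>J1\<close> brings (sqrt pi)^2 and \<open>J2\<close>
      another \<open>sqrt pi\<close>.\<close>
    have "pi powr (3/2) = pi powr (1 + 1/2)" by simp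
    also have "\<dots> = (sqrt pi)\<^sup>2 * sqrt pi" unfolding powr_add by (simp add: powr_half_sqrt)
    finally show ?thesis
      using Gpos by (simp add: J1_def J2_def power_mult_distrib power_divide field_simps)
  qed
  finally show "3 * edge_prob b = ennreal (6 * (Gamma (b + 5/2))\<^sup>2 * Gamma (2 * b + 4)
            / (pi powr (3/2) * (Gamma (b + 2))\<^sup>2 * Gamma (2 * b + 7/2)) * K)" .
qed

theorem theorem1p3:
  fixes \<beta> :: real
    and M :: "'w measure"
    and X :: "nat \<Rightarrow> 'w \<Rightarrow> real ^ 3"
  assumes "\<beta> \<ge> -1"
    and "prob_space M"
    and "prob_space.indep_vars M (\<lambda>_. borel) X {0..3}"
    and "\<And>i. i \<in> {0..3} \<Longrightarrow> distr M borel (X i) = beta_distribution \<beta>"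
  shows "integrable M (\<lambda>\<omega>. vertex_angle_sum (convex hull ((\<lambda>i. X i \<omega>) ` {0..3}))) \<and>
    (LINT \<omega>|M. vertex_angle_sum (convex hull ((\<lambda>i. X i \<omega>) ` {0..3}))) =
      2 - 6 * (Gamma (\<beta> + 5/2))\<^sup>2 * Gamma (2 * \<beta> + 4)
            / (pi powr (3/2) * (Gamma (\<beta> + 2))\<^sup>2 * Gamma (2 * \<beta> + 7/2))
          * integral {-pi/2..pi/2} (\<lambda>\<phi>. cos \<phi> powr (4 * \<beta> + 6)
              * (integral {-pi/2..\<phi>} (\<lambda>\<theta>. cos \<theta> powr (2 * \<beta> + 3)))\<^sup>2)"
proof -
  define V where "V \<omega> = vertex_angle_sum (convex hull {X 0 \<omega>, X 1 \<omega>, X 2 \<omega>, X 3 \<omega>})" for \<omega>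
  define r where "r = 6 * (Gamma (\<beta> + 5/2))\<^sup>2 * Gamma (2 * \<beta> + 4)
            / (pi powr (3/2) * (Gamma (\<beta> + 2))\<^sup>2 * Gamma (2 * \<beta> + 7/2))
          * integral {-pi/2..pi/2} (\<lambda>\<phi>. cos \<phi> powr (4 * \<beta> + 6)
              * (integral {-pi/2..\<phi>} (\<lambda>\<theta>. cos \<theta> powr (2 * \<beta> + 3)))\<^sup>2)"
  have "{0..3::nat} = {0, 1, 2, 3}" by auto
  then have V: "vertex_angle_sum (convex hull ((\<lambda>i. X i \<omega>) ` {0..3})) = V \<omega>" for \<omega>
    by (simp add: V_def)
  note E = expected_vertex_angle_sum[OF assms(2-4), folded V_def]
  have "0 \<le> r"
    unfolding r_def using assms(1) edge_prob_eq(2)[OF assms(1)]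
    by (intro mult_nonneg_nonneg divide_nonneg_nonneg) (auto intro!: less_imp_le[OF Gamma_real_pos])
  have "2 * (\<integral>\<^sup>+\<omega>. ennreal (V \<omega>) \<partial>M) + 2 * (3 * edge_prob \<beta>) = 4"
    using E(3) by (simp add: mult.assoc[symmetric])
  then have eq: "2 * (\<integral>\<^sup>+\<omega>. ennreal (V \<omega>) \<partial>M) + 2 * ennreal r = 4"
    unfolding edge_prob_eq(1)[OF assms(1)] r_def .
  \<comment> \<open>A sum equal to 4 has no infinite term, so the expectation is a real number and
    subtraction becomes legitimate.\<close>
  then have "(\<integral>\<^sup>+\<omega>. ennreal (V \<omega>) \<partial>M) \<noteq> \<infinity>"
    by (auto simp: ennreal_mult_top)
  then obtain v where v: "(\<integral>\<^sup>+\<omega>. ennreal (V \<omega>) \<partial>M) = ennreal v" "0 \<le> v"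
    by (cases "\<integral>\<^sup>+\<omega>. ennreal (V \<omega>) \<partial>M") auto
  have "ennreal (2 * v + 2 * r) = ennreal 4"
    using eq v \<open>0 \<le> r\<close> by (simp add: ennreal_mult)
  then have "v = 2 - r"
    using v(2) \<open>0 \<le> r\<close> by (subst (asm) ennreal_inj) auto
  have nonneg: "0 \<le> V \<omega>" for \<omega> by (simp add: V_def vertex_angle_sum_nonneg)
  have "integrable M V"
    using E(1) v nonneg by (intro integrableI_nonneg) simp_all
  moreover have "integral\<^sup>L M V = v"
    using E(1) v nonneg by (subst integral_eq_nn_integral) simp_all
  ultimately show ?thesis
    unfolding V using \<open>v = 2 - r\<close> by (simp add: r_def)
qed

end
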